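(* Let $n\ge 2$ and let $\mu$ be a symmetric Borel probability measure on $SL_n(\mathbb{R})$ with finite second moment, i.e. $\int \bigl(\log\max\{\|g\|,\|g^{-1}\|\}\bigr)^2\,d\mu(g)<\infty$. Assume that the group generated by the support of $\mu$ is a finitely generated group with property $\mathrm{F}\mathbb{R}^{n(n+1)/2-1}$, and that it is unbounded in $SL_n(\mathbb{R})$ (not relatively compact). Then the top Lyapunov exponent $\lambda_{1,\mu}$ is strictly positive.
   Context: A group has property $\mathrm{F}\mathbb{R}^m$ if every action of it (as an abstract group) by isometries on Euclidean space $\mathbb{R}^m$ has a global fixed point. A measure $\mu$ on a group is symmetric if it is invariant under $g\mapsto g^{-1}$. The top Lyapunov exponent is $\lambda_{1,\mu}=\lim_{k\to\infty}\frac1k\int\log\|g\|\,d\mu^{*k}(g)$, where $\mu^{*k}$ is the $k$-th convolution power of $\mu$. *)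

theory Defs
  imports "HOL-Probability.Probability" "HOL-Algebra.Elementary_Groups" "HOL-Algebra.Group_Action"
begin

definition SL :: "(real ^ 'n ^ 'n) monoid"
  where "SL = \<lparr>carrier = {A. det A = 1}, mult = (**), one = mat 1\<rparr>"

definition finitely_generated_group :: "('a, 'b) monoid_scheme \<Rightarrow> bool"
  where "finitely_generated_group G \<longleftrightarrow>
    group G \<and> (\<exists>S. finite S \<and> S \<subseteq> carrier G \<and> generate G S = carrier G)"

text \<open>
  The dimension \<open>m\<close> is a natural number here, so points of \<open>m\<close>-space are the sequences vanishing
  from index \<open>m\<close> on, with the Euclidean distance of the first \<open>m\<close> coordinates. The group carries
  no topology: all homomorphisms into the isometries are considered.
\<close>

definition property_FR :: "('a, 'b) monoid_scheme \<Rightarrow> nat \<Rightarrow> bool"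
  where "property_FR G m \<longleftrightarrow>
    (\<forall>\<phi>. group_action G (topspace (Euclidean_space m)) \<phi> \<and>
         (\<forall>g \<in> carrier G. \<forall>x \<in> topspace (Euclidean_space m). \<forall>y \<in> topspace (Euclidean_space m).
            L2_set (\<lambda>i. \<phi> g x i - \<phi> g y i) {..<m} = L2_set (\<lambda>i. x i - y i) {..<m})
       \<longrightarrow> (\<exists>x \<in> topspace (Euclidean_space m). \<forall>g \<in> carrier G. \<phi> g x = x))"

definition SL_borel :: "(real ^ 'n ^ 'n) measure"
  where "SL_borel = restrict_space borel (carrier SL)"

definition SL_support :: "(real ^ 'n ^ 'n) measure \<Rightarrow> (real ^ 'n ^ 'n) set"
  where "SL_support \<mu> =
    {g \<in> carrier SL. \<forall>U. openin (top_of_set (carrier SL)) U \<and> g \<in> U \<longrightarrow> emeasure \<mu> U > 0}"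

definition symmetric_measure :: "(real ^ 'n ^ 'n) measure \<Rightarrow> bool"
  where "symmetric_measure \<mu> \<longleftrightarrow> distr \<mu> \<mu> matrix_inv = \<mu>"

text \<open>
  On matrices \<^const>\<open>norm\<close> is the Frobenius norm; the operator norm is used instead.
\<close>

definition op_norm :: "real ^ 'n ^ 'n \<Rightarrow> real"
  where "op_norm A = onorm ((*v) A)"

definition finite_second_moment :: "(real ^ 'n ^ 'n) measure \<Rightarrow> bool"
  where "finite_second_moment \<mu> \<longleftrightarrow>
    (\<integral>\<^sup>+ g. ennreal ((ln (max (op_norm g) (op_norm (matrix_inv g))))\<^sup>2) \<partial>\<mu>) < \<infinity>"

primrec conv_power :: "(real ^ 'n ^ 'n) measure \<Rightarrow> nat \<Rightarrow> (real ^ 'n ^ 'n) measure"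
  where
    "conv_power \<mu> 0 = return SL_borel (mat 1)"
  | "conv_power \<mu> (Suc k) = distr (\<mu> \<Otimes>\<^sub>M conv_power \<mu> k) SL_borel (\<lambda>(g, h). g ** h)"

definition top_lyapunov :: "(real ^ 'n ^ 'n) measure \<Rightarrow> real"
  where "top_lyapunov \<mu> = lim (\<lambda>k. (1 / real k) * (\<integral>g. ln (op_norm g) \<partial>conv_power \<mu> k))"

end

theory Submission
  imports Defs
begin

text \<open>
  Suppose the exponent vanishes. By symmetry the averaging operator of \<open>\<mu>\<close> on the square integrable functions on
  \<open>n\<close>-space is self-adjoint, and its matrix coefficients on the unit ball dominate the integrals of \<open>\<parallel>g\<parallel>\<close> to
  the power \<open>-n\<close> with respect to the convolution powers, so by Jensen's inequality its spectral radius is one. The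
  squares of almost invariant functions have a cluster point \<open>\<Lambda>\<close>, a finitely additive probability that is invariant
  under a dense subset of the group.

  Let \<open>B\<close> be a maximal invariant subspace on which the group is bounded, and suppose that it is proper. Subspaces of the
  quotient by \<open>B\<close> of minimal dimension that carry a given positive mass of \<open>\<Lambda>\<close> form a finite permuted family; by
  Furstenberg's lemma their stabilizers act by maps of bounded distortion. The logarithms of the scaling factors are
  at most \<open>n\<close> distinct characters of the subgroup fixing every member; they extend to a cocycle for an isometric
  action on \<open>n\<close>-space, whose fixed point makes them trivial. So the group is bounded on the span \<open>W\<close> of the family,
  and a fixed point on the affine space of complements of \<open>B\<close> in \<open>B + W\<close> shows that it is bounded on \<open>B + W\<close>,
  contradicting maximality.
\<close>

section \<open>Matrices and orthogonal projections\<close>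

text \<open>The squares of almost invariant functions may lose mass at the origin and at infinity,
  so a cluster point is only finitely additive. This is harmless because only directions are
  examined: the sets tested are cones, and the mass of a subspace is read off from shrinking cones
  around it, proper subspaces themselves being null. For the quotient by \<open>B\<close> the cones
  are pulled back along the projection, so one mean on n-space serves every \<open>B\<close>. Almost
  invariance is obtained for almost every group element only; cones leave room for a small error,
  and therefore invariance under a dense set is enough for every estimate. The spectral radius one
  might be attained at -1 instead of 1; replacing an iterate by its sum with the next one suppresses
  that end of the spectrum. Property FR is applied to the permuted characters, in dimension n, and
  to the complements, in dimension dim B * dim W \<le> n^2/4. Both numbers are at most n(n+1)/2 - 1
  as soon as n \<ge> 2.\<close>

lemma norm_matrix_vector_mult_le:
  fixes A :: "real^'n^'m"
  shows "norm (A *v x) \<le> norm A * norm x"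
proof -
  have "\<bar>(A *v x) $ i\<bar> \<le> norm (A $ i) * norm x" for i
    by (simp add: matrix_vector_mul_component Cauchy_Schwarz_ineq2)
  then have "norm (A *v x) \<le> L2_set (\<lambda>i. norm (A $ i) * norm x) UNIV"
    unfolding norm_vec_def by (intro L2_set_mono) auto
  also have "\<dots> = norm A * norm x"
    by (simp add: L2_set_left_distrib norm_vec_def)
  finally show ?thesis .
qed

lemma norm_transpose:
  fixes A :: "real^'n^'m"
  shows "norm (transpose A) = norm A"
proof -
  have "(norm (transpose A))\<^sup>2 = (\<Sum>j\<in>UNIV. \<Sum>i\<in>UNIV. (A $ i $ j)\<^sup>2)"
    by (simp add: norm_vec_def L2_set_def transpose_def sum_nonneg)
  also have "\<dots> = (\<Sum>i\<in>UNIV. \<Sum>j\<in>UNIV. (A $ i $ j)\<^sup>2)"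
    by (rule sum.swap)
  also have "\<dots> = (norm A)\<^sup>2"
    by (simp add: norm_vec_def L2_set_def sum_nonneg)
  finally show ?thesis by simp
qed

lemma norm_matrix_matrix_mult_le:
  fixes A :: "real^'n^'m" and B :: "real^'k^'n"
  shows "norm (A ** B) \<le> norm A * norm B"
proof -
  have row: "(A ** B) $ i = transpose B *v (A $ i)" for i
    by (simp add: vec_eq_iff matrix_matrix_mult_def matrix_vector_mult_def transpose_def mult.commute)
  have "norm ((A ** B) $ i) \<le> norm (A $ i) * norm B" for i
    using norm_matrix_vector_mult_le[of "transpose B" "A $ i"] by (simp add: row norm_transpose mult.commute)
  then have "norm (A ** B) \<le> L2_set (\<lambda>i. norm (A $ i) * norm B) UNIV"
    unfolding norm_vec_def[of "A ** B"] by (intro L2_set_mono) auto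
  also have "\<dots> = norm A * norm B"
    by (simp add: L2_set_left_distrib norm_vec_def)
  finally show ?thesis .
qed

lemma matrix_mult_scaleR_left: "(r *\<^sub>R A) ** B = r *\<^sub>R (A ** B)"
  for A :: "real^'n^'m" and B :: "real^'k^'n"
  by (simp add: vec_eq_iff matrix_matrix_mult_def sum_distrib_left mult_ac)

lemma matrix_mult_scaleR_right: "A ** (r *\<^sub>R B) = r *\<^sub>R (A ** B)"
  for A :: "real^'n^'m" and B :: "real^'k^'n"
  by (simp add: vec_eq_iff matrix_matrix_mult_def sum_distrib_left mult_ac)

lemma matrix_add_rdistrib: "(A + B) ** C = A ** C + B ** C"
  for A :: "real^'n^'m" and C :: "real^'k^'n"
  by (simp add: vec_eq_iff matrix_matrix_mult_def sum.distrib algebra_simps)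

lemma bounded_bilinear_matrix_matrix_mult:
  "bounded_bilinear ((**) :: real^'n^'m \<Rightarrow> real^'k^'n \<Rightarrow> real^'k^'m)"
proof (unfold_locales, goal_cases)
  case 5
  show ?case by (rule exI[of _ 1]) (simp add: norm_matrix_matrix_mult_le)
qed (simp_all add: matrix_add_ldistrib matrix_add_rdistrib matrix_mult_scaleR_left matrix_mult_scaleR_right)

lemma bounded_bilinear_matrix_vector_mult:
  "bounded_bilinear ((*v) :: real^'n^'m \<Rightarrow> real^'n \<Rightarrow> real^'m)"
proof (unfold_locales, goal_cases)
  case 5
  show ?case by (rule exI[of _ 1]) (simp add: norm_matrix_vector_mult_le)
qed (simp_all add: algebra_simps matrix_vector_mult_add_rdistrib scaleR_matrix_vector_assoc matrix_vector_mult_scaleR)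

lemmas mv_simps = matrix_vector_right_distrib matrix_vector_mult_diff_distrib
  matrix_vector_mult_add_rdistrib matrix_vector_mult_diff_rdistrib
  matrix_vector_mul_assoc[symmetric] matrix_vector_mult_scaleR

text \<open>The orthogonal projection onto a subspace, taken as a matrix so that its products with
  group elements remain matrices. It is selected by its characteristic property, which for a
  subspace determines it.\<close>

definition proj_mat :: "(real^'n) set \<Rightarrow> real^'n^'n"
  where "proj_mat U = (SOME P. \<forall>x. P *v x \<in> U \<and> (\<forall>u\<in>U. inner (x - P *v x) u = 0))"

lemma proj_mat:
  fixes U :: "(real^'n) set"
  assumes "subspace U"
  shows proj_mat_in: "proj_mat U *v x \<in> U"
    and proj_mat_orth: "u \<in> U \<Longrightarrow> inner (x - proj_mat U *v x) u = 0"
proof -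
  obtain b where b: "b \<subseteq> U" "pairwise orthogonal b" "\<And>x. x \<in> b \<Longrightarrow> norm x = 1"
    "independent b" "card b = dim U" "span b = U"
    using orthonormal_basis_subspace[OF assms] by metis
  have fin: "finite b" using b(4) by (rule independent_imp_finite)
  define f where "f = (\<lambda>x. \<Sum>v\<in>b. inner x v *\<^sub>R v)"
  have lin: "linear f"
    unfolding f_def by (intro linearI) (simp_all add: algebra_simps sum.distrib scaleR_sum_right)
  have f1: "f x \<in> U" for x
    unfolding f_def using b assms by (intro subspace_sum subspace_mul) auto
  have f2: "inner (x - f x) v = 0" if "v \<in> b" for x v
  proof -
    have "inner (f x) v = (\<Sum>w\<in>b. inner x w * inner w v)"
      by (simp add: f_def inner_sum_left)
    also have "\<dots> = (\<Sum>w\<in>b. if w = v then inner x v else 0)"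
      using b(2,3) that
      by (intro sum.cong refl) (auto simp: pairwise_def orthogonal_def norm_eq_1)
    also have "\<dots> = inner x v" using that fin by simp
    finally show ?thesis by (simp add: inner_diff_left)
  qed
  have f3: "inner (x - f x) u = 0" if "u \<in> U" for x u
  proof -
    have "u \<in> span b" using that b by simp
    then show ?thesis
      by (induction rule: span_induct) (auto simp: f2 subspace_def inner_add_right)
  qed
  have "\<exists>P::real^'n^'n. \<forall>x. P *v x \<in> U \<and> (\<forall>u\<in>U. inner (x - P *v x) u = 0)"
    using f1 f3 lin by (intro exI[of _ "matrix f"]) (auto simp: matrix_works)
  from someI_ex[OF this] show "proj_mat U *v x \<in> U"
    and "u \<in> U \<Longrightarrow> inner (x - proj_mat U *v x) u = 0"
    unfolding proj_mat_def by auto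
qed

lemma proj_mat_unique:
  assumes "subspace U" "y \<in> U" "\<And>u. u \<in> U \<Longrightarrow> inner (x - y) u = 0"
  shows "proj_mat U *v x = y"
proof -
  define d where "d = proj_mat U *v x - y"
  have "d \<in> U" unfolding d_def using assms proj_mat_in by (intro subspace_diff) auto
  have "inner d d = inner (x - y) d - inner (x - proj_mat U *v x) d"
    by (simp add: d_def inner_diff_left)
  also have "\<dots> = 0" using assms \<open>d \<in> U\<close> proj_mat_orth by simp
  finally show ?thesis by (simp add: d_def)
qed

lemma proj_mat_id: "subspace U \<Longrightarrow> x \<in> U \<Longrightarrow> proj_mat U *v x = x"
  by (rule proj_mat_unique) auto

lemma proj_mat_0: "subspace U \<Longrightarrow> (\<And>u. u \<in> U \<Longrightarrow> inner x u = 0) \<Longrightarrow> proj_mat U *v x = 0"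
  by (rule proj_mat_unique) (auto simp: subspace_0)

lemma norm_proj_mat_pythagoras:
  assumes "subspace U"
  shows "(norm (proj_mat U *v x))\<^sup>2 + (norm (x - proj_mat U *v x))\<^sup>2 = (norm x)\<^sup>2"
  using proj_mat_orth[OF assms proj_mat_in[OF assms], of x x]
  by (simp add: power2_norm_eq_inner inner_diff_left inner_diff_right inner_commute)

lemma norm_proj_mat_le: "subspace U \<Longrightarrow> norm (proj_mat U *v x) \<le> norm x"
  using norm_proj_mat_pythagoras[of U x] by (smt (verit) norm_ge_zero power2_le_imp_le zero_le_power2)

lemma norm_proj_mat_compl_le: "subspace U \<Longrightarrow> norm (x - proj_mat U *v x) \<le> norm x"
  using norm_proj_mat_pythagoras[of U x] by (smt (verit) norm_ge_zero power2_le_imp_le zero_le_power2)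

text \<open>The vectors with bounded orbit form a subspace, which gives a pointwise bound on the
  span; applied to the finitely many projected basis vectors it becomes uniform. As \<open>X\<close>
  may be a union of subspaces, boundedness on each of them passes to their sum.\<close>

lemma bounded_on_span:
  fixes \<T> :: "(real^'n^'m) set" and X :: "(real^'n) set"
  assumes "\<And>x. x \<in> X \<Longrightarrow> \<exists>C. \<forall>T\<in>\<T>. norm (T *v x) \<le> C"
  shows "\<exists>C>0. \<forall>T\<in>\<T>. \<forall>x\<in>span X. norm (T *v x) \<le> C * norm x"
proof -
  have pt: "\<exists>C. \<forall>T\<in>\<T>. norm (T *v x) \<le> C" if "x \<in> span X" for x
    using that
  proof (induction rule: span_induct)
    case base
    show ?case
    proof (rule subspaceI, goal_cases)
      case (2 x y)
      then obtain C D where "\<forall>T\<in>\<T>. norm (T *v x) \<le> C" "\<forall>T\<in>\<T>. norm (T *v y) \<le> D" by auto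
      then have "\<forall>T\<in>\<T>. norm (T *v (x + y)) \<le> C + D"
        by (auto simp: mv_simps intro: order_trans[OF norm_triangle_ineq] add_mono)
      then show ?case by blast
    next
      case (3 c x)
      then obtain C where "\<forall>T\<in>\<T>. norm (T *v x) \<le> C" by auto
      then have "\<forall>T\<in>\<T>. norm (T *v (c *\<^sub>R x)) \<le> \<bar>c\<bar> * C"
        by (auto simp: mv_simps intro: mult_left_mono)
      then show ?case by blast
    qed auto
  qed (use assms in auto)
  let ?P = "proj_mat (span X)"
  have "\<forall>i. \<exists>C. \<forall>T\<in>\<T>. norm (T *v (?P *v axis i 1)) \<le> C"
    using pt proj_mat_in[OF subspace_span] by blast
  then obtain c where c: "\<And>i T. T \<in> \<T> \<Longrightarrow> norm (T *v (?P *v axis i 1)) \<le> c i"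
    by metis
  define C where "C = (\<Sum>i\<in>UNIV. \<bar>c i\<bar>) + 1"
  have "norm (T *v x) \<le> C * norm x" if "T \<in> \<T>" "x \<in> span X" for T x
  proof -
    have "T *v x = (T ** ?P) *v x"
      using that by (simp add: mv_simps proj_mat_id)
    also have "\<dots> = (\<Sum>i\<in>UNIV. (x $ i) *s column i (T ** ?P))"
      by (rule matrix_mult_sum)
    also have "norm \<dots> \<le> (\<Sum>i\<in>UNIV. \<bar>c i\<bar> * norm x)"
    proof (rule sum_norm_le)
      fix i
      have "norm ((x $ i) *s column i (T ** ?P)) = \<bar>x $ i\<bar> * norm (T *v (?P *v axis i 1))"
        unfolding scalar_mult_eq_scaleR matrix_vector_mult_basis[symmetric] by (simp add: matrix_vector_mul_assoc)
      also have "\<dots> \<le> norm x * \<bar>c i\<bar>"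
        using c[OF that(1), of i] by (intro mult_mono component_le_norm_cart) auto
      finally show "norm ((x $ i) *s column i (T ** ?P)) \<le> \<bar>c i\<bar> * norm x"
        by (simp add: mult.commute)
    qed
    also have "\<dots> \<le> C * norm x" by (simp add: C_def sum_distrib_right[symmetric] distrib_right)
    finally show ?thesis .
  qed
  moreover have "C > 0" unfolding C_def by (simp add: add_nonneg_pos sum_nonneg)
  ultimately show ?thesis by blast
qed

section \<open>Bounded matrix groups are orthogonalizable\<close>

text \<open>Gram-Schmidt for the inner product with matrix \<open>S\<close>, by induction over sets
  of indices; the vectors found are the columns of \<open>N\<close>.\<close>

lemma posdef_orthonormal_basis:
  fixes S :: "real^'n^'n"
  assumes sym: "transpose S = S" and pos: "\<And>x. x \<noteq> 0 \<Longrightarrow> inner x (S *v x) > 0"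
  shows "\<exists>N :: real^'n^'n. transpose N ** S ** N = mat 1"
proof -
  have comm: "inner x (S *v y) = inner y (S *v x)" for x y
    by (metis dot_lmul_matrix inner_commute sym transpose_matrix_vector)
  have "\<exists>v::'n \<Rightarrow> real^'n. \<forall>i\<in>J. \<forall>j\<in>J. inner (v i) (S *v v j) = (if i = j then 1 else 0)" for J :: "'n set"
    using finite[of J]
  proof (induction J rule: finite_induct)
    case (insert a J)
    then obtain v where v: "\<And>i j. i \<in> J \<Longrightarrow> j \<in> J \<Longrightarrow> inner (v i) (S *v v j) = (if i = j then 1 else 0)"
      by blast
    have "dim (v ` J) \<le> card J" using dim_le_card'[of "v ` J"] card_image_le[of J v] by simp
    also have "\<dots> < CARD('n)" using insert by (intro psubset_card_mono) auto
    finally have "span (v ` J) \<noteq> UNIV" by (metis dim_UNIV dim_span less_irrefl DIM_cart DIM_real mult.right_neutral)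
    then obtain z where z: "z \<notin> span (v ` J)" by auto
    define z' where "z' = z - (\<Sum>j\<in>J. inner z (S *v v j) *\<^sub>R v j)"
    have "(\<Sum>j\<in>J. inner z (S *v v j) *\<^sub>R v j) \<in> span (v ` J)"
      by (intro span_sum span_mul span_base) auto
    then have "z' \<noteq> 0" using z by (auto simp: z'_def)
    have orth: "inner z' (S *v v i) = 0" if "i \<in> J" for i
    proof -
      have "(\<Sum>j\<in>J. inner z (S *v v j) * inner (v j) (S *v v i)) = (\<Sum>j\<in>J. if j = i then inner z (S *v v i) else 0)"
        using v that by (intro sum.cong) auto
      then show ?thesis using that insert by (simp add: z'_def inner_diff_left inner_sum_left)
    qed
    define s where "s = sqrt (inner z' (S *v z'))"
    have s: "s > 0" "s * s = inner z' (S *v z')" using pos[OF \<open>z' \<noteq> 0\<close>] by (auto simp: s_def)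
    define w where "w = (\<lambda>i. if i = a then (1 / s) *\<^sub>R z' else v i)"
    have "inner (w i) (S *v w j) = (if i = j then 1 else 0)" if "i \<in> insert a J" "j \<in> insert a J" for i j
      using that insert v orth s comm[of "v i" z']
      by (auto simp: w_def mv_simps)
    then show ?case by blast
  qed simp
  from this[of UNIV] obtain v :: "'n \<Rightarrow> real^'n" where v: "\<And>i j. inner (v i) (S *v v j) = (if i = j then 1 else 0)"
    by auto
  define N :: "real^'n^'n" where "N = (\<chi> i j. v j $ i)"
  have N: "N *v axis j 1 = v j" for j
    by (simp add: N_def matrix_vector_mult_basis column_def vec_eq_iff)
  have "(transpose N ** S ** N) $ i $ j = mat 1 $ i $ j" for i j
  proof -
    have "(transpose N ** S ** N) $ i $ j = inner (axis i 1) ((transpose N ** S ** N) *v axis j 1)"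
      by (simp add: inner_axis' matrix_vector_mult_basis column_def)
    also have "\<dots> = inner (N *v axis i 1) (S *v (N *v axis j 1))"
      by (simp add: mv_simps) (metis dot_lmul_matrix transpose_matrix_vector transpose_transpose)
    finally show ?thesis by (simp add: N v mat_def)
  qed
  then show ?thesis by (intro exI[of _ N]) (simp add: vec_eq_iff)
qed

text \<open>An invariant inner product is obtained by minimization. The supremum of the Frobenius
  norm over an orbit is an invariant norm on forms; on a closed convex invariant set of forms
  bounded below it attains its minimum, and the parallelogram law makes the minimizer unique, hence
  invariant. A basis orthonormal for it conjugates \<open>K\<close> into the orthogonal
  group.\<close>

lemma bounded_group_orthogonalizable:
  fixes K :: "(real^'n^'n) set"
  assumes one: "mat 1 \<in> K" and mult: "\<And>k l. k \<in> K \<Longrightarrow> l \<in> K \<Longrightarrow> k ** l \<in> K"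
    and inv: "\<And>k. k \<in> K \<Longrightarrow> \<exists>l\<in>K. k ** l = mat 1"
    and bdd: "\<And>k. k \<in> K \<Longrightarrow> norm k \<le> C"
  obtains N N' :: "real^'n^'n" where "N ** N' = mat 1" "N' ** N = mat 1"
    "\<And>k. k \<in> K \<Longrightarrow> orthogonal_matrix (N' ** k ** N)"
proof -
  define act where "act = (\<lambda>(k :: real^'n^'n) (S :: real^'n^'n). transpose k ** S ** k)"
  have act_mult: "act k (act l S) = act (l ** k) S" for k l S
    by (simp add: act_def matrix_transpose_mul matrix_mul_assoc)
  have act_one: "act (mat 1) S = S" for S by (simp add: act_def transpose_mat)
  have act_lin: "act k (S + T) = act k S + act k T" "act k (S - T) = act k S - act k T"
    "act k (r *\<^sub>R S) = r *\<^sub>R act k S" for k S T r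
    by (simp_all add: act_def matrix_mult_scaleR_left matrix_mult_scaleR_right
        bounded_bilinear.add_left[OF bounded_bilinear_matrix_matrix_mult]
        bounded_bilinear.add_right[OF bounded_bilinear_matrix_matrix_mult]
        bounded_bilinear.diff_left[OF bounded_bilinear_matrix_matrix_mult]
        bounded_bilinear.diff_right[OF bounded_bilinear_matrix_matrix_mult])
  have inner_act: "inner x (act k S *v x) = inner (k *v x) (S *v (k *v x))" for x k S
    by (simp add: act_def mv_simps) (metis dot_lmul_matrix transpose_matrix_vector transpose_transpose)
  have Cpos: "C > 0"
    using bdd[OF one] norm_matrix_vector_mult_le[of "mat 1 :: real^'n^'n" "axis undefined 1"] by simp
  have act_le: "norm (act k S) \<le> C\<^sup>2 * norm S" if "k \<in> K" for k S
  proof -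
    have "norm (act k S) \<le> norm k * norm S * norm k"
      unfolding act_def
      by (metis (no_types, opaque_lifting) mult_right_mono norm_ge_zero norm_matrix_matrix_mult_le norm_transpose order_trans)
    also have "\<dots> \<le> C * norm S * C"
      using bdd[OF that] Cpos by (intro mult_mono) auto
    finally show ?thesis by (simp add: power2_eq_square mult_ac)
  qed
  have act_ge: "norm S \<le> C\<^sup>2 * norm (act k S)" if "k \<in> K" for k S
  proof -
    obtain l where l: "l \<in> K" "k ** l = mat 1" using inv \<open>k \<in> K\<close> by blast
    have "S = act l (act k S)" by (simp add: act_mult l act_one)
    then show ?thesis using act_le[OF l(1)] by metis
  qed
  define N where "N = (\<lambda>S. SUP k\<in>K. norm (act k S))"
  have bd: "bdd_above ((\<lambda>k. norm (act k S)) ` K)" for S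
    by (rule bdd_aboveI[of _ "C\<^sup>2 * norm S"]) (auto intro: act_le)
  have N_ge: "norm (act k S) \<le> N S" if "k \<in> K" for k S
    unfolding N_def using bd that by (rule cSUP_upper2) simp
  have N_le: "N S \<le> r" if "\<And>k. k \<in> K \<Longrightarrow> norm (act k S) \<le> r" for S r
    unfolding N_def using one that by (intro cSUP_least) auto
  have N_norm: "norm S \<le> N S" for S using N_ge[OF one, of S] by (simp add: act_one)
  have N_lip: "N S \<le> N T + C\<^sup>2 * norm (S - T)" for S T
  proof (rule N_le)
    fix k assume "k \<in> K"
    have "norm (act k S) \<le> norm (act k T) + norm (act k (S - T))"
      using norm_triangle_ineq[of "act k T" "act k (S - T)"] by (simp add: act_lin)
    then show "norm (act k S) \<le> N T + C\<^sup>2 * norm (S - T)"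
      using N_ge[OF \<open>k \<in> K\<close>, of T] act_le[OF \<open>k \<in> K\<close>, of "S - T"] by linarith
  qed
  have N_cont: "continuous_on X N" for X
  proof (rule continuous_onI)
    fix S \<epsilon> :: real and T :: "real^'n^'n" assume "\<epsilon> > 0"
    show "\<exists>d>0. \<forall>x'\<in>X. dist x' T < d \<longrightarrow> dist (N x') (N T) \<le> \<epsilon>"
    proof (intro exI[of _ "\<epsilon> / C\<^sup>2"] conjI ballI impI)
      fix x' assume "dist x' T < \<epsilon> / C\<^sup>2"
      then have "C\<^sup>2 * norm (x' - T) < \<epsilon>" using Cpos by (simp add: dist_norm pos_less_divide_eq mult.commute)
      then show "dist (N x') (N T) \<le> \<epsilon>"
        using N_lip[of x' T] N_lip[of T x'] by (auto simp: dist_real_def norm_minus_commute)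
    qed (use \<open>\<epsilon> > 0\<close> Cpos in auto)
  qed
  \<comment> \<open>The lower bound keeps the minimizer positive definite; imposing it along whole
    orbits makes \<open>D\<close> visibly invariant.\<close>
  define D where "D = {S. transpose S = S \<and> (\<forall>k\<in>K. \<forall>x. inner (k *v x) (S *v (k *v x)) \<ge> (norm x)\<^sup>2)}"
  have D_act: "act k S \<in> D" if "S \<in> D" "k \<in> K" for k S
  proof -
    have "transpose (act k S) = act k S" using that
      by (simp add: act_def D_def matrix_transpose_mul matrix_mul_assoc)
    moreover have "inner (l *v x) (act k S *v (l *v x)) \<ge> (norm x)\<^sup>2" if "l \<in> K" for l x
      using \<open>S \<in> D\<close> mult[OF \<open>k \<in> K\<close> \<open>l \<in> K\<close>] by (auto simp: inner_act D_def mv_simps)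
    ultimately show ?thesis by (auto simp: D_def)
  qed
  have D_mid: "(1/2) *\<^sub>R (S + T) \<in> D" if "S \<in> D" "T \<in> D" for S T
  proof -
    have "transpose ((1/2) *\<^sub>R (S + T)) = (1/2) *\<^sub>R (transpose S + transpose T)"
      by (simp add: transpose_def vec_eq_iff)
    moreover have half: "inner y (((1/2) *\<^sub>R (S + T)) *v y) = (inner y (S *v y) + inner y (T *v y)) / 2" for y
      by (simp add: scaleR_matrix_vector_assoc[symmetric] mv_simps inner_add_right)
    moreover have "(norm x)\<^sup>2 \<le> inner (k *v x) (((1/2) *\<^sub>R (S + T)) *v (k *v x))" if "k \<in> K" for k x
      unfolding half
    proof -
      have "(norm x)\<^sup>2 \<le> inner (k *v x) (S *v (k *v x))" "(norm x)\<^sup>2 \<le> inner (k *v x) (T *v (k *v x))"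
        using \<open>S \<in> D\<close> \<open>T \<in> D\<close> that by (auto simp: D_def)
      then show "(norm x)\<^sup>2 \<le> (inner (k *v x) (S *v (k *v x)) + inner (k *v x) (T *v (k *v x))) / 2" by simp
    qed
    ultimately show ?thesis using that by (simp add: D_def)
  qed
  have tr_cont: "continuous_on UNIV (transpose :: real^'n^'n \<Rightarrow> _)"
  proof (intro linear_continuous_on bounded_linear_intro[of _ 1])
    fix x :: "real^'n^'n" show "norm (transpose x) \<le> norm x * 1" by (simp add: norm_transpose)
  qed (auto simp: transpose_def vec_eq_iff)
  have "closed D"
  proof -
    have "D = {S. transpose S = S} \<inter> (\<Inter>k\<in>K. \<Inter>x. {S. (norm x)\<^sup>2 \<le> inner (k *v x) (S *v (k *v x))})"
      by (auto simp: D_def)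
    moreover have "closed {S :: real^'n^'n. transpose S = S}"
      by (rule closed_Collect_eq[OF tr_cont continuous_on_id])
    moreover have "closed {S :: real^'n^'n. (norm x)\<^sup>2 \<le> inner (k *v x) (S *v (k *v x))}" for k :: "real^'n^'n" and x
      by (intro closed_Collect_le continuous_intros
          bounded_bilinear.continuous_on[OF bounded_bilinear_matrix_vector_mult])
    ultimately show ?thesis by (simp add: closed_Int closed_INT)
  qed
  have "C\<^sup>2 *\<^sub>R mat 1 \<in> D"
  proof -
    have "(norm x)\<^sup>2 \<le> C\<^sup>2 * inner (k *v x) (k *v x)" if "k \<in> K" for k x
    proof -
      obtain l where l: "l \<in> K" "k ** l = mat 1" using inv \<open>k \<in> K\<close> by blast
      then have "l ** k = mat 1" by (simp add: matrix_left_right_inverse)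
      then have "norm x = norm (l *v (k *v x))" by (simp add: matrix_vector_mul_assoc)
      also have "\<dots> \<le> C * norm (k *v x)"
        using norm_matrix_vector_mult_le[of l "k *v x"] bdd[OF l(1)]
        by (meson mult_right_mono norm_ge_zero order_trans)
      finally have "(norm x)\<^sup>2 \<le> (C * norm (k *v x))\<^sup>2" by (intro power_mono) auto
      then show ?thesis by (simp add: power_mult_distrib power2_norm_eq_inner)
    qed
    moreover have "transpose (C\<^sup>2 *\<^sub>R mat 1 :: real^'n^'n) = C\<^sup>2 *\<^sub>R mat 1"
      by (auto simp: transpose_def vec_eq_iff mat_def)
    ultimately show ?thesis by (auto simp: D_def scaleR_matrix_vector_assoc[symmetric])
  qed
  \<comment> \<open>Minimization may be restricted to a compact ball, since the norm of a form is at
    most its value under \<open>N\<close>.\<close>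
  define L where "L = D \<inter> cball 0 (N (C\<^sup>2 *\<^sub>R mat 1))"
  have "compact L" unfolding L_def using \<open>closed D\<close> by (simp add: closed_Int_compact)
  moreover have L0: "C\<^sup>2 *\<^sub>R mat 1 \<in> L"
    using \<open>C\<^sup>2 *\<^sub>R mat 1 \<in> D\<close> N_norm[of "C\<^sup>2 *\<^sub>R mat 1"] by (simp add: L_def)
  ultimately obtain S where S: "S \<in> L" "\<And>T. T \<in> L \<Longrightarrow> N S \<le> N T"
    using continuous_attains_inf[OF _ _ N_cont, of L] by (metis empty_iff)
  have min: "N S \<le> N T" if "T \<in> D" for T
  proof (cases "T \<in> L")
    case False
    from S L0 have "N S \<le> N (C\<^sup>2 *\<^sub>R mat 1)" by blast
    also have "\<dots> \<le> norm T" using False that by (auto simp: L_def)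
    finally show ?thesis using N_norm[of T] by simp
  qed (use S in auto)
  have "S \<in> D" using S by (simp add: L_def)
  have inv_S: "act k S = S" if "k \<in> K" for k
  proof (rule ccontr)
    assume neq: "act k S \<noteq> S"
    define T where "T = act k S"
    \<comment> \<open>The gain from the parallelogram law: no orbit map shrinks the distance of
      \<open>S\<close> and \<open>T\<close> by more than the factor C^2, so the same amount is
      gained for every group element.\<close>
    define \<delta> where "\<delta> = (norm (S - T))\<^sup>2 / (4 * C^4)"
    have \<delta>: "\<delta> > 0" using neq Cpos by (auto simp: \<delta>_def T_def)
    define r where "r = N S"
    have NT: "norm (act l T) \<le> r" if "l \<in> K" for l
      unfolding r_def T_def act_mult using N_ge mult \<open>k \<in> K\<close> that by simp
    have "(norm (act l ((1/2) *\<^sub>R (S + T))))\<^sup>2 \<le> r\<^sup>2 - \<delta>" if "l \<in> K" for l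
    proof -
      have *: "(norm ((1/2) *\<^sub>R (a + b)))\<^sup>2 = ((norm a)\<^sup>2 + (norm b)\<^sup>2) / 2 - (norm (a - b))\<^sup>2 / 4" for a b :: "real^'n^'n"
        by (simp add: power2_norm_eq_inner inner_simps inner_commute field_simps)
      have "(norm (S - T))\<^sup>2 \<le> (C\<^sup>2 * norm (act l (S - T)))\<^sup>2"
        by (intro power_mono act_ge that) auto
      also have "\<dots> = C^4 * (norm (act l S - act l T))\<^sup>2" by (simp add: act_lin power_mult_distrib)
      finally have 1: "\<delta> \<le> (norm (act l S - act l T))\<^sup>2 / 4" using Cpos by (simp add: \<delta>_def field_simps)
      have 2: "(norm (act l S))\<^sup>2 \<le> r\<^sup>2" "(norm (act l T))\<^sup>2 \<le> r\<^sup>2"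
        using N_ge[OF that, of S] NT[OF that] by (auto simp: r_def intro!: power_mono)
      have "(a + b) / 2 - z / 4 \<le> R - d" if "d \<le> z / 4" "a \<le> R" "b \<le> R" for a b z R d :: real
        using that by argo
      from this[OF 1 2] show ?thesis unfolding act_lin *[of "act l S" "act l T"] .
    qed
    then have "N ((1/2) *\<^sub>R (S + T)) \<le> sqrt (r\<^sup>2 - \<delta>)"
      by (intro N_le) (simp add: real_le_rsqrt)
    moreover have "(1/2) *\<^sub>R (S + T) \<in> D"
      using \<open>S \<in> D\<close> D_act[OF \<open>S \<in> D\<close> \<open>k \<in> K\<close>] by (auto simp: T_def intro: D_mid)
    ultimately have "r \<le> sqrt (r\<^sup>2 - \<delta>)" using min r_def by fastforce
    moreover have "sqrt (r\<^sup>2 - \<delta>) < r"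
      using \<delta> N_norm[of S] by (smt (verit) norm_ge_zero r_def real_sqrt_less_iff real_sqrt_abs real_sqrt_pow2_iff)
    ultimately show False by simp
  qed
  have symS: "transpose S = S" using \<open>S \<in> D\<close> by (simp add: D_def)
  have posS: "inner x (S *v x) > 0" if "x \<noteq> 0" for x
  proof -
    have "(norm x)\<^sup>2 \<le> inner x (S *v x)" using \<open>S \<in> D\<close> one by (force simp: D_def)
    moreover have "(norm x)\<^sup>2 > 0" using that by simp
    ultimately show ?thesis by linarith
  qed
  obtain M :: "real^'n^'n" where M: "transpose M ** S ** M = mat 1"
    using posdef_orthonormal_basis[OF symS] posS by auto
  define M' where "M' = transpose M ** S"
  have M1: "M' ** M = mat 1" using M by (simp add: M'_def)
  then have M2: "M ** M' = mat 1" by (simp add: matrix_left_right_inverse)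
  have "orthogonal_matrix (M' ** k ** M)" if "k \<in> K" for k
  proof -
    have "transpose (M' ** k ** M) ** (M' ** k ** M) = transpose M ** transpose k ** S ** (M ** M') ** k ** M"
      by (simp add: M'_def matrix_transpose_mul matrix_mul_assoc symS)
    also have "\<dots> = transpose M ** act k S ** M" by (simp add: M2 act_def matrix_mul_assoc)
    also have "\<dots> = mat 1" by (simp add: inv_S that M)
    finally show ?thesis by (simp add: orthogonal_matrix)
  qed
  with M1 M2 show ?thesis by (intro that[of M M']) auto
qed

section \<open>Isometric actions on subspaces of dimension at most m\<close>

text \<open>In an orthonormal basis of \<open>E\<close> the action occupies the first
  \<open>dim E\<close> coordinates of m-space and is continued by the identity on the others; the
  first coordinates of a fixed point give a fixed point in \<open>E\<close>.\<close>

lemma property_FR_fixed_point: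
  fixes E :: "'v::euclidean_space set"
  assumes FR: "property_FR \<Gamma> m" and grp: "group \<Gamma>" and E: "subspace E" and dimE: "dim E \<le> m"
    and closed: "\<And>g x. g \<in> carrier \<Gamma> \<Longrightarrow> x \<in> E \<Longrightarrow> \<Phi> g x \<in> E"
    and one: "\<And>x. x \<in> E \<Longrightarrow> \<Phi> \<one>\<^bsub>\<Gamma>\<^esub> x = x"
    and mult: "\<And>g h x. g \<in> carrier \<Gamma> \<Longrightarrow> h \<in> carrier \<Gamma> \<Longrightarrow> x \<in> E \<Longrightarrow> \<Phi> (g \<otimes>\<^bsub>\<Gamma>\<^esub> h) x = \<Phi> g (\<Phi> h x)"
    and isom: "\<And>g x y. g \<in> carrier \<Gamma> \<Longrightarrow> x \<in> E \<Longrightarrow> y \<in> E \<Longrightarrow> norm (\<Phi> g x - \<Phi> g y) = norm (x - y)"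
  obtains x where "x \<in> E" "\<And>g. g \<in> carrier \<Gamma> \<Longrightarrow> \<Phi> g x = x"
proof -
  interpret group \<Gamma> by fact
  obtain B where B: "B \<subseteq> E" "pairwise orthogonal B" "\<And>x. x \<in> B \<Longrightarrow> norm x = 1"
    "independent B" "card B = dim E" "span B = E"
    using orthonormal_basis_subspace[OF E] by metis
  have fin: "finite B" using B(4) by (rule independent_imp_finite)
  define N where "N = dim E"
  obtain b where b: "bij_betw b {..<N} B"
    using ex_bij_betw_nat_finite[OF fin] B(5) by (auto simp: N_def atLeast0LessThan)
  have b_E: "b i \<in> E" if "i < N" for i using bij_betwE[OF b] B(1) that by auto
  have b_orth: "inner (b i) (b j) = (if i = j then 1 else 0)" if "i < N" "j < N" for i j
  proof -
    have "b i \<in> B" "b j \<in> B" using bij_betwE[OF b] that by auto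
    moreover have "i \<noteq> j \<Longrightarrow> b i \<noteq> b j"
      using inj_onD[OF bij_betw_imp_inj_on[OF b], of i j] that by auto
    ultimately show ?thesis using B(2,3) by (auto simp: pairwise_def orthogonal_def norm_eq_1)
  qed
  define c where "c = (\<lambda>x i. if i < N then inner x (b i) else 0)"
  define r where "r = (\<lambda>t. \<Sum>i<N. t i *\<^sub>R b i)"
  have r_E: "r t \<in> E" for t unfolding r_def using E b_E by (intro subspace_sum subspace_mul) auto
  have c_r: "c (r t) i = t i" if "i < N" for t i
  proof -
    have "c (r t) i = (\<Sum>j<N. t j * inner (b j) (b i))" using that by (simp add: c_def r_def inner_sum_left)
    also have "\<dots> = (\<Sum>j<N. if j = i then t i else 0)" using that by (intro sum.cong) (auto simp: b_orth)
    finally show ?thesis using that by simp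
  qed
  have norm_c: "(norm (r t))\<^sup>2 = (\<Sum>i<N. (t i)\<^sup>2)" for t
  proof -
    have "(norm (r t))\<^sup>2 = (\<Sum>i<N. t i * inner (b i) (r t))"
      by (simp add: power2_norm_eq_inner) (simp add: r_def inner_sum_left)
    also have "\<dots> = (\<Sum>i<N. t i * t i)"
    proof (intro sum.cong refl)
      fix i assume "i \<in> {..<N}"
      with c_r[of i t] show "t i * inner (b i) (r t) = t i * t i"
        by (simp add: c_def inner_commute)
    qed
    finally show ?thesis by (simp add: power2_eq_square)
  qed
  have r_c: "r (c x) = x" if "x \<in> E" for x
  proof -
    define d where "d = r (c x) - x"
    have dE: "d \<in> E" unfolding d_def using E r_E that by (intro subspace_diff)
    have "inner d (b i) = 0" if "i < N" for i
      using c_r[OF that, of "c x"] that by (simp add: c_def d_def inner_diff_left)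
    then have "inner d v = 0" if "v \<in> B" for v using b that by (metis bij_betw_imp_surj_on image_iff lessThan_iff)
    moreover have "d \<in> span B" using dE B(6) by simp
    ultimately have "inner d d = 0"
      by (metis orthogonal_def orthogonal_to_span)
    then show ?thesis by (simp add: d_def)
  qed
  have r_lin: "r t - r s = r (\<lambda>i. t i - s i)" for t s
    by (simp add: r_def sum_subtractf algebra_simps)
  define T where "T = topspace (Euclidean_space m)"
  have T: "t \<in> T \<longleftrightarrow> (\<forall>i\<ge>m. t i = 0)" for t by (simp add: T_def topspace_Euclidean_space)
  define f where "f = (\<lambda>g t i. if i < N then c (\<Phi> g (r t)) i else (t i :: real))"
  have r_f: "r (f g t) = \<Phi> g (r t)" if "g \<in> carrier \<Gamma>" for g t
  proof -
    have "r (f g t) = r (c (\<Phi> g (r t)))" by (simp add: r_def f_def)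
    then show ?thesis using r_c closed that r_E by simp
  qed
  have f_T: "f g t \<in> T" if "t \<in> T" for g t
    using that dimE by (auto simp: T f_def N_def)
  have f_mult: "f (g \<otimes>\<^bsub>\<Gamma>\<^esub> h) t = f g (f h t)" if "g \<in> carrier \<Gamma>" "h \<in> carrier \<Gamma>" for g h t
  proof
    fix i show "f (g \<otimes>\<^bsub>\<Gamma>\<^esub> h) t i = f g (f h t) i"
    proof (cases "i < N")
      case True
      then have "f g (f h t) i = c (\<Phi> g (r (f h t))) i" by (simp add: f_def)
      also have "\<dots> = f (g \<otimes>\<^bsub>\<Gamma>\<^esub> h) t i" using True that r_E by (simp add: r_f mult) (simp add: f_def mult r_E that)
      finally show ?thesis by simp
    qed (simp add: f_def)
  qed
  have f_one: "f \<one>\<^bsub>\<Gamma>\<^esub> t = t" for t by (auto simp: f_def one r_E c_r)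
  \<comment> \<open>Restricted to \<open>T\<close>, because the elements of \<open>BijGroup\<close>
    are extensional functions.\<close>
  define \<phi> where "\<phi> = (\<lambda>g. \<lambda>t\<in>T. f g t)"
  have \<phi>_Bij: "\<phi> g \<in> Bij T" if "g \<in> carrier \<Gamma>" for g
  proof -
    have "bij_betw (\<phi> g) T T"
      by (rule bij_betw_byWitness[where f'="f (inv\<^bsub>\<Gamma>\<^esub> g)"])
        (use that in \<open>auto simp: \<phi>_def f_T f_mult[symmetric] f_one\<close>)
    then show ?thesis by (simp add: Bij_def \<phi>_def)
  qed
  have "group_action \<Gamma> T \<phi>"
    unfolding group_action_def
  proof (intro group_hom.intro group_hom_axioms.intro grp group_BijGroup homI)
    fix g assume "g \<in> carrier \<Gamma>" then show "\<phi> g \<in> carrier (BijGroup T)"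
      by (simp add: BijGroup_def \<phi>_Bij)
  next
    fix g h assume gh: "g \<in> carrier \<Gamma>" "h \<in> carrier \<Gamma>"
    then show "\<phi> (g \<otimes>\<^bsub>\<Gamma>\<^esub> h) = \<phi> g \<otimes>\<^bsub>BijGroup T\<^esub> \<phi> h"
      by (auto simp: BijGroup_def \<phi>_Bij compose_def) (auto simp: \<phi>_def f_mult f_T)
  qed
  moreover have "L2_set (\<lambda>i. \<phi> g x i - \<phi> g y i) {..<m} = L2_set (\<lambda>i. x i - y i) {..<m}"
    if g: "g \<in> carrier \<Gamma>" and xy: "x \<in> T" "y \<in> T" for g x y
  proof -
    have split: "(\<Sum>i<m. h i) = (\<Sum>i<N. h i) + (\<Sum>i\<in>{N..<m}. h i)" for h :: "nat \<Rightarrow> real"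
    proof -
      have "sum h ({..<N} \<union> {N..<m}) = (\<Sum>i<N. h i) + (\<Sum>i\<in>{N..<m}. h i)"
        by (rule sum.union_disjoint) auto
      moreover have "{..<N} \<union> {N..<m} = {..<m}" using dimE by (auto simp: N_def)
      ultimately show ?thesis by simp
    qed
    have "(\<Sum>i<N. (f g x i - f g y i)\<^sup>2) = (norm (r (f g x) - r (f g y)))\<^sup>2"
      by (simp add: r_lin norm_c)
    also have "\<dots> = (norm (r x - r y))\<^sup>2" using g by (simp add: r_f isom r_E)
    also have "\<dots> = (\<Sum>i<N. (x i - y i)\<^sup>2)" by (simp add: r_lin norm_c)
    finally have "(\<Sum>i<m. (f g x i - f g y i)\<^sup>2) = (\<Sum>i<m. (x i - y i)\<^sup>2)"
      unfolding split by (simp add: f_def)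
    then show ?thesis using xy by (simp add: L2_set_def \<phi>_def)
  qed
  ultimately have "group_action \<Gamma> T \<phi> \<and> (\<forall>g\<in>carrier \<Gamma>. \<forall>x\<in>T. \<forall>y\<in>T.
      L2_set (\<lambda>i. \<phi> g x i - \<phi> g y i) {..<m} = L2_set (\<lambda>i. x i - y i) {..<m})"
    by simp
  from FR[unfolded property_FR_def, THEN spec, THEN mp, folded T_def, OF this]
  obtain t where t: "t \<in> T" "\<forall>g\<in>carrier \<Gamma>. \<phi> g t = t" by auto
  have "\<Phi> g (r t) = r t" if "g \<in> carrier \<Gamma>" for g
    using t that r_f[OF that, of t] by (simp add: \<phi>_def)
  with r_E show ?thesis by (rule that)
qed

section \<open>Extensions of bounded representations\<close>

text \<open>The Frobenius norm is computed from the lengths of the columns, which \<open>Q\<close>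
  preserves; transposition treats the factor on the right. Products of this kind are the linear
  parts of the isometric action on complements.\<close>

lemma norm_orthogonal_conj:
  fixes Q T R :: "real^'n^'n"
  assumes "orthogonal_matrix Q" "orthogonal_matrix R"
  shows "norm (Q ** T ** R) = norm T"
proof -
  have le: "norm (Q ** T) = norm T" if "orthogonal_matrix Q" for Q T :: "real^'n^'n"
  proof -
    have "norm (row i (transpose (Q ** T))) = norm (row i (transpose T))" for i
    proof -
      have "row i (transpose (Q ** T)) = Q *v row i (transpose T)"
        by (simp add: row_transpose) (metis matrix_vector_mul_assoc matrix_vector_mult_basis)
      then show ?thesis using that by (metis orthogonal_transformation orthogonal_transformation_matrix matrix_of_matrix_vector_mul matrix_vector_mul_linear)
    qed
    then have "norm (transpose (Q ** T)) = norm (transpose T)"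
      unfolding norm_vec_def[of "transpose _"] row_def by (simp add: vec_lambda_eta)
    then show ?thesis by (simp add: norm_transpose)
  qed
  have "norm (Q ** T ** R) = norm (transpose R ** transpose (Q ** T))"
    by (metis matrix_transpose_mul norm_transpose)
  also have "\<dots> = norm (Q ** T)" using assms by (simp add: le norm_transpose)
  finally show ?thesis using assms le by simp
qed

text \<open>The condition says that \<open>T\<close> vanishes on the orthogonal complement of
  \<open>W\<close> and has values in \<open>B\<close>, so these matrices are the linear maps from
  \<open>W\<close> to \<open>B\<close>. They are spanned by the rank one matrices
  \<open>out u v\<close> with \<open>u\<close> in a basis of \<open>B\<close> and \<open>v\<close>
  in one of \<open>W\<close>.\<close>

lemma dim_hom_le:
  fixes B W :: "(real^'n) set"
  assumes B: "subspace B" and W: "subspace W"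
  shows "dim {T :: real^'n^'n. \<forall>x. proj_mat B *v (T *v (proj_mat W *v x)) = T *v x} \<le> dim B * dim W"
proof -
  obtain b where b: "b \<subseteq> B" "independent b" "B \<subseteq> span b" "card b = dim B" using basis_exists by blast
  obtain w where w: "w \<subseteq> W" "pairwise orthogonal w" "\<And>x. x \<in> w \<Longrightarrow> norm x = 1"
    "independent w" "card w = dim W" "span w = W"
    using orthonormal_basis_subspace[OF W] by metis
  have fin: "finite b" "finite w" using b w by (auto intro: independent_imp_finite)
  define out where "out = (\<lambda>u v :: real^'n. (\<chi> i j. u $ i * v $ j) :: real^'n^'n)"
  have out: "out u v *v x = inner v x *\<^sub>R u" for u v x
    by (simp add: out_def matrix_vector_mult_def vec_eq_iff inner_vec_def sum_distrib_left mult_ac)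
  have out_lin: "linear (\<lambda>u. out u v)" for v
    by (intro linearI) (simp_all add: out_def vec_eq_iff algebra_simps)
  let ?S = "(\<lambda>(u,v). out u v) ` (b \<times> w)"
  have out_span: "out u v \<in> span ?S" if "u \<in> B" "v \<in> w" for u v
  proof -
    have "out u v \<in> (\<lambda>u. out u v) ` span b" using that b by auto
    also have "\<dots> = span ((\<lambda>u. out u v) ` b)" by (simp add: linear_span_image out_lin)
    also have "\<dots> \<subseteq> span ?S" using that by (intro span_mono) auto
    finally show ?thesis .
  qed
  have "T \<in> span ?S" if T: "\<forall>x. proj_mat B *v (T *v (proj_mat W *v x)) = T *v x" for T :: "real^'n^'n"
  proof -
    have TB: "T *v x \<in> B" for x using T proj_mat_in[OF B] by metis
    have eq: "T *v x = (\<Sum>v\<in>w. out (T *v v) v) *v x" for x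
    proof -
      have "proj_mat W *v x = (\<Sum>v\<in>w. inner v x *\<^sub>R v)"
      proof (rule proj_mat_unique[OF W])
        show "(\<Sum>v\<in>w. inner v x *\<^sub>R v) \<in> W" using w W by (intro subspace_sum subspace_mul) auto
        have "orthogonal (x - (\<Sum>v\<in>w. inner v x *\<^sub>R v)) u" if "u \<in> w" for u
        proof -
          have "(\<Sum>v\<in>w. inner v x * inner v u) = (\<Sum>v\<in>w. if v = u then inner u x else 0)"
            using w(2,3) that by (intro sum.cong) (auto simp: pairwise_def orthogonal_def norm_eq_1)
          then show ?thesis using that fin by (simp add: orthogonal_def inner_diff_left inner_sum_left inner_commute[of x u])
        qed
        then show "inner (x - (\<Sum>v\<in>w. inner v x *\<^sub>R v)) u = 0" if "u \<in> W" for u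
          using orthogonal_to_span[of u w] that w(6) by (auto simp: orthogonal_def)
      qed
      moreover have "T *v x = T *v (proj_mat W *v x)"
        using proj_mat_id[OF B TB[of "proj_mat W *v x"]] T[rule_format, of x] by metis
      ultimately have "T *v x = T *v (\<Sum>v\<in>w. inner v x *\<^sub>R v)" by simp
      also have "\<dots> = (\<Sum>v\<in>w. inner v x *\<^sub>R (T *v v))"
        by (simp add: linear_sum[OF matrix_vector_mul_linear] mv_simps)
      also have "\<dots> = (\<Sum>v\<in>w. out (T *v v) v *v x)" by (simp add: out)
      also have "\<dots> = (\<Sum>v\<in>w. out (T *v v) v) *v x"
        by (rule linear_sum[OF bounded_linear.linear[OF bounded_bilinear.bounded_linear_left[OF bounded_bilinear_matrix_vector_mult]], symmetric])
      finally show ?thesis .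
    qed
    have "T = (\<Sum>v\<in>w. out (T *v v) v)" unfolding matrix_eq by (intro allI eq)
    also have "\<dots> \<in> span ?S" using TB out_span by (intro span_sum) auto
    finally show ?thesis .
  qed
  then have "dim {T :: real^'n^'n. \<forall>x. proj_mat B *v (T *v (proj_mat W *v x)) = T *v x} \<le> card ?S"
    using fin by (intro dim_le_card) auto
  also have "\<dots> \<le> card (b \<times> w)" using fin by (intro card_image_le) auto
  finally show ?thesis using b w by (simp add: card_cartesian_product)
qed

text \<open>The columns are the images of unit vectors, and the sum of their lengths bounds the
  Frobenius norm.\<close>

lemma norm_matrix_le:
  fixes A :: "real^'n^'m"
  assumes "\<And>x. norm (A *v x) \<le> c * norm x"
  shows "norm A \<le> real CARD('n) * c"
proof -
  have "norm (transpose A) \<le> (\<Sum>j\<in>UNIV. norm (transpose A $ j))"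
    unfolding norm_vec_def[of "transpose A"] by (intro L2_set_le_sum) auto
  also have "\<dots> \<le> (\<Sum>j\<in>(UNIV :: 'n set). c)"
  proof (intro sum_mono)
    fix j :: 'n
    have "transpose A $ j = A *v axis j 1"
      by (simp add: matrix_vector_mult_basis transpose_def column_def)
    then show "norm (transpose A $ j) \<le> c" using assms[of "axis j 1"] by simp
  qed
  finally show ?thesis by (simp add: norm_transpose)
qed

text \<open>
  The complements of \<open>B\<close> in \<open>B + W\<close> are the graphs of maps \<open>W \<rightarrow> B\<close>; the group acts on them by affine
  isometries for a suitable norm, and a fixed graph is an invariant complement.
\<close>

lemma bounded_extension:
  fixes \<Gamma> :: "(real^'n^'n) monoid" and B W :: "(real^'n) set"
  assumes FR: "property_FR \<Gamma> m" and grp: "group \<Gamma>"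
    and mult: "\<And>g h. g \<otimes>\<^bsub>\<Gamma>\<^esub> h = g ** h" and one: "\<one>\<^bsub>\<Gamma>\<^esub> = mat 1"
    and B: "subspace B" and W: "subspace W"
    and orth: "\<And>b w. b \<in> B \<Longrightarrow> w \<in> W \<Longrightarrow> inner b w = 0"
    and dims: "dim B * dim W \<le> m"
    and invB: "\<And>g b. g \<in> carrier \<Gamma> \<Longrightarrow> b \<in> B \<Longrightarrow> g *v b \<in> B"
    and invW: "\<And>g w. g \<in> carrier \<Gamma> \<Longrightarrow> w \<in> W \<Longrightarrow> g *v w - proj_mat B *v (g *v w) \<in> W"
    and bddB: "\<And>g b. g \<in> carrier \<Gamma> \<Longrightarrow> b \<in> B \<Longrightarrow> norm (g *v b) \<le> C * norm b"
    and bddW: "\<And>g w. g \<in> carrier \<Gamma> \<Longrightarrow> w \<in> W \<Longrightarrow> norm (g *v w - proj_mat B *v (g *v w)) \<le> C * norm w"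
    and C: "C \<ge> 0"
  shows "\<exists>C>0. \<forall>g\<in>carrier \<Gamma>. \<forall>x\<in>span (B \<union> W). norm (g *v x) \<le> C * norm x"
proof -
  interpret group \<Gamma> by fact
  define P where "P = proj_mat B"
  define R where "R = proj_mat W"
  have PB: "P *v x \<in> B" for x unfolding P_def using B by (rule proj_mat_in)
  have RW: "R *v x \<in> W" for x unfolding R_def using W by (rule proj_mat_in)
  have P_id: "P *v x = x" if "x \<in> B" for x unfolding P_def using B that by (rule proj_mat_id)
  have R_id: "R *v x = x" if "x \<in> W" for x unfolding R_def using W that by (rule proj_mat_id)
  have P0: "P *v x = 0" if "x \<in> W" for x
    unfolding P_def using B that orth by (intro proj_mat_0) (auto simp: inner_commute)
  have R0: "R *v x = 0" if "x \<in> B" for x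
    unfolding R_def using W that orth by (intro proj_mat_0) auto
  note pr [simp] = P_id[OF PB] R_id[OF RW] P0[OF RW] R0[OF PB]
  have gB [simp]: "P *v (g *v (P *v x)) = g *v (P *v x)" "R *v (g *v (P *v x)) = 0" if "g \<in> carrier \<Gamma>" for g x
    using that PB by (auto intro: P_id R0 invB)
  have gW: "g *v (R *v x) = P *v (g *v (R *v x)) + R *v (g *v (R *v x))"
    and gW_eq: "g *v (R *v x) - P *v (g *v (R *v x)) = R *v (g *v (R *v x))" if "g \<in> carrier \<Gamma>" for g x
  proof -
    let ?y = "g *v (R *v x)"
    have "R *v (?y - P *v ?y) = ?y - P *v ?y"
      using invW[OF that RW] by (intro R_id) (simp add: P_def)
    then show "?y - P *v ?y = R *v ?y" by (simp add: mv_simps)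
    then show "?y = P *v ?y + R *v ?y" by (simp add: algebra_simps)
  qed
  have RgR [simp]: "R *v (g *v (R *v (h *v (R *v x)))) = R *v (g *v (h *v (R *v x)))"
    if "g \<in> carrier \<Gamma>" "h \<in> carrier \<Gamma>" for g h x
  proof -
    have "R *v (g *v (h *v (R *v x))) = R *v (g *v (P *v (h *v (R *v x)) + R *v (h *v (R *v x))))"
      using gW[OF that(2)] by metis
    then show ?thesis using that by (simp add: matrix_vector_right_distrib)
  qed
  have inv_mult: "g *v ((inv\<^bsub>\<Gamma>\<^esub> g) *v x) = x" "(inv\<^bsub>\<Gamma>\<^esub> g) *v (g *v x) = x" if "g \<in> carrier \<Gamma>" for g x
    using r_inv[OF that] l_inv[OF that] by (simp_all add: mult one matrix_vector_mul_assoc)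
  have mult_closed: "g ** h \<in> carrier \<Gamma>" if "g \<in> carrier \<Gamma>" "h \<in> carrier \<Gamma>" for g h
    using m_closed[OF that] by (simp add: mult)
  \<comment> \<open>The block diagonal part of \<open>g\<close>: the action on \<open>B\<close>, the
    induced action on \<open>W\<close> and the identity elsewhere. It is multiplicative and bounded
    by hypothesis, so it can be orthogonalized before \<open>g\<close> itself is known to be bounded
    on \<open>B + W\<close>.\<close>
  define k where "k = (\<lambda>g. g ** P + R ** g ** R + (mat 1 - P - R))"
  have k: "k g *v x = g *v (P *v x) + R *v (g *v (R *v x)) + (x - P *v x - R *v x)" for g x
    by (simp add: k_def mv_simps)
  have k_mult: "k g ** k h = k (g ** h)" if "g \<in> carrier \<Gamma>" "h \<in> carrier \<Gamma>" for g h
    unfolding matrix_eq using that by (simp add: k matrix_vector_mul_assoc[symmetric])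
      (simp add: mv_simps)
  have k_one: "k (mat 1) = mat 1" unfolding matrix_eq by (simp add: k)
  have norm_PR: "norm (P *v x) \<le> norm x" "norm (R *v x) \<le> norm x" for x
    using B W by (auto simp: P_def R_def norm_proj_mat_le)
  have Rg_le: "norm (R *v (g *v (R *v x))) \<le> C * norm x" if "g \<in> carrier \<Gamma>" for g x
  proof -
    have "norm (R *v (g *v (R *v x))) \<le> C * norm (R *v x)"
      using bddW[OF that RW[of x]] gW_eq[OF that] by (simp add: P_def)
    also have "\<dots> \<le> C * norm x" by (intro mult_left_mono norm_PR C)
    finally show ?thesis .
  qed
  have k_bdd: "norm (k g) \<le> real CARD('n) * (2 * C + 3)" if "g \<in> carrier \<Gamma>" for g
  proof (rule norm_matrix_le)
    fix x
    have "norm (g *v (P *v x)) \<le> C * norm (P *v x)" using bddB[OF that PB] .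
    also have "\<dots> \<le> C * norm x" by (intro mult_left_mono norm_PR C)
    finally have 1: "norm (g *v (P *v x)) \<le> C * norm x" .
    have "norm (k g *v x) \<le> C * norm x + C * norm x + (norm x + norm x + norm x)"
      unfolding k using 1 Rg_le[OF that, of x] norm_PR[of x]
      by (intro norm_triangle_le add_mono norm_triangle_le_diff) auto
    then show "norm (k g *v x) \<le> (2 * C + 3) * norm x" by (simp add: algebra_simps)
  qed
  obtain N N' :: "real^'n^'n" where N: "N ** N' = mat 1" "N' ** N = mat 1"
    and orthK: "\<And>g. g \<in> carrier \<Gamma> \<Longrightarrow> orthogonal_matrix (N' ** k g ** N)"
  proof (rule bounded_group_orthogonalizable[of "k ` carrier \<Gamma>"])
    show "mat 1 \<in> k ` carrier \<Gamma>" using k_one one_closed one by force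
    show "a ** b \<in> k ` carrier \<Gamma>" if "a \<in> k ` carrier \<Gamma>" "b \<in> k ` carrier \<Gamma>" for a b
      using that k_mult mult_closed by auto
    show "\<exists>l\<in>k ` carrier \<Gamma>. a ** l = mat 1" if a: "a \<in> k ` carrier \<Gamma>" for a
    proof -
      obtain g where g: "g \<in> carrier \<Gamma>" "a = k g" using a by auto
      then have "a ** k (inv\<^bsub>\<Gamma>\<^esub> g) = mat 1"
        using r_inv[OF g(1)] by (simp add: k_mult k_one mult one)
      with g show ?thesis by blast
    qed
    show "norm a \<le> real CARD('n) * (2 * C + 3)" if "a \<in> k ` carrier \<Gamma>" for a
      using that k_bdd by auto
  qed (use that in auto)
  \<comment> \<open>The linear maps from \<open>W\<close> to \<open>B\<close>, extended by
    zero.\<close>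
  define E where "E = {T. \<forall>x. P *v (T *v (R *v x)) = T *v x}"
  have subE: "subspace E"
    by (rule subspaceI) (auto simp: E_def mv_simps scaleR_matrix_vector_assoc[symmetric])
  have E_simps: "R *v (T *v x) = 0" "T *v (P *v x) = 0" "T *v (R *v x) = T *v x" "P *v (T *v x) = T *v x"
    if "T \<in> E" for T x
  proof -
    have T: "P *v (T *v (R *v x)) = T *v x" for x using that by (simp add: E_def)
    show "R *v (T *v x) = 0" using T R0[OF PB] by metis
    show "T *v (P *v x) = 0" using T[of "P *v x"] by simp
    show "T *v (R *v x) = T *v x" using T[of "R *v x"] T[of x] by simp
    then show "P *v (T *v x) = T *v x" using T[of x] by simp
  qed
  have TgP: "T *v (g *v (P *v x)) = 0" if "T \<in> E" "g \<in> carrier \<Gamma>" for T g x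
    using E_simps(2)[OF that(1), of "g *v (P *v x)"] that by simp
  have gT: "P *v (g *v (T *v x)) = g *v (T *v x)" "R *v (g *v (T *v x)) = 0" if "T \<in> E" "g \<in> carrier \<Gamma>" for T g x
    using gB[OF that(2), of "T *v x"] E_simps(4)[OF that(1)] by simp_all
  \<comment> \<open>\<open>g\<close> carries the graph of \<open>T\<close> to the graph of this map:
    the inverse of \<open>g\<close> followed by \<open>R\<close> finds the point of \<open>W\<close>
    that \<open>g\<close> moves over the given one, and subtracting \<open>R\<close> leaves the
    component in \<open>B\<close>.\<close>
  define \<Psi> where "\<Psi> = (\<lambda>g T. g ** (T + R) ** R ** (inv\<^bsub>\<Gamma>\<^esub> g) ** R - R)"
  have \<Psi>: "\<Psi> g T *v x = g *v (T *v (R *v ((inv\<^bsub>\<Gamma>\<^esub> g) *v (R *v x)))) + g *v (R *v ((inv\<^bsub>\<Gamma>\<^esub> g) *v (R *v x))) - R *v x" for g T x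
    by (simp add: \<Psi>_def mv_simps)
  have \<Psi>_E: "\<Psi> g T \<in> E" if "T \<in> E" "g \<in> carrier \<Gamma>" for g T
  proof -
    have "P *v (g *v (R *v ((inv\<^bsub>\<Gamma>\<^esub> g) *v (R *v x)))) = g *v (R *v ((inv\<^bsub>\<Gamma>\<^esub> g) *v (R *v x))) - R *v x" for x
      using gW_eq[OF that(2), of "(inv\<^bsub>\<Gamma>\<^esub> g) *v (R *v x)"] that
      by (simp add: inv_mult algebra_simps)
    then show ?thesis using that
      by (simp add: E_def \<Psi> gT mv_simps)
  qed
  have \<Psi>_one: "\<Psi> (mat 1) T = T" if "T \<in> E" for T
    unfolding matrix_eq using that inv_one by (simp add: \<Psi> one E_simps)
  have \<Psi>_mult: "\<Psi> (g ** h) T = \<Psi> g (\<Psi> h T)" if "T \<in> E" "g \<in> carrier \<Gamma>" "h \<in> carrier \<Gamma>" for g h T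
  proof -
    have "inv\<^bsub>\<Gamma>\<^esub> (g ** h) = (inv\<^bsub>\<Gamma>\<^esub> h) ** (inv\<^bsub>\<Gamma>\<^esub> g)"
      using inv_mult_group[OF that(2,3)] by (simp add: mult)
    then show ?thesis unfolding matrix_eq using that
      by (simp add: \<Psi> matrix_vector_mul_assoc[symmetric]) (simp add: mv_simps)
  qed
  \<comment> \<open>The action on complements is affine. Its linear part is given by the block
    diagonal parts, which become orthogonal after the change of basis \<open>c\<close>.\<close>
  have \<Psi>_diff: "\<Psi> g T - \<Psi> g S = k g ** (T - S) ** k (inv\<^bsub>\<Gamma>\<^esub> g)"
    if "T \<in> E" "S \<in> E" "g \<in> carrier \<Gamma>" for g T S
    unfolding matrix_eq using that
    by (simp add: \<Psi> k mv_simps) (simp add: E_simps TgP gT algebra_simps)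
  define c where "c = (\<lambda>T. N' ** T ** N)"
  define d where "d = (\<lambda>T. N ** T ** N')"
  have cd: "c (d T) = T" "d (c T) = T" for T
    unfolding c_def d_def
    by (metis N matrix_mul_assoc matrix_mul_lid matrix_mul_rid)+
  have lin_c: "linear c" unfolding c_def
    by (intro linearI) (simp_all add: matrix_add_ldistrib matrix_add_rdistrib matrix_mult_scaleR_left matrix_mult_scaleR_right)
  obtain X where X: "X \<in> c ` E" "\<And>g. g \<in> carrier \<Gamma> \<Longrightarrow> c (\<Psi> g (d X)) = X"
  proof (rule property_FR_fixed_point[OF FR grp, of "c ` E" "\<lambda>g X. c (\<Psi> g (d X))"])
    show "subspace (c ` E)" using lin_c subE by (rule linear_subspace_image)
    have "dim (c ` E) \<le> dim E" using lin_c by (rule dim_image_le)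
    also have "\<dots> \<le> dim B * dim W" unfolding E_def P_def R_def using B W by (rule dim_hom_le)
    finally show "dim (c ` E) \<le> m" using dims by simp
    show "c (\<Psi> g (d X)) \<in> c ` E" if "g \<in> carrier \<Gamma>" "X \<in> c ` E" for g X
      using that by (auto simp: cd \<Psi>_E)
    show "c (\<Psi> \<one>\<^bsub>\<Gamma>\<^esub> (d X)) = X" if "X \<in> c ` E" for X
      using that by (auto simp: cd \<Psi>_one one)
    show "c (\<Psi> (g \<otimes>\<^bsub>\<Gamma>\<^esub> h) (d X)) = c (\<Psi> g (d (c (\<Psi> h (d X)))))"
      if "g \<in> carrier \<Gamma>" "h \<in> carrier \<Gamma>" "X \<in> c ` E" for g h X
      using that by (auto simp: cd \<Psi>_mult mult)
    show "norm (c (\<Psi> g (d X)) - c (\<Psi> g (d Y))) = norm (X - Y)"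
      if g: "g \<in> carrier \<Gamma>" and XY: "X \<in> c ` E" "Y \<in> c ` E" for g X Y
    proof -
      obtain T S where TS: "T \<in> E" "S \<in> E" "X = c T" "Y = c S" using XY by auto
      have "c (\<Psi> g (d X)) - c (\<Psi> g (d Y)) = c (\<Psi> g T - \<Psi> g S)"
        by (simp add: TS cd linear_diff[OF lin_c])
      also have "\<dots> = N' ** k g ** (N ** N') ** (T - S) ** (N ** N') ** k (inv\<^bsub>\<Gamma>\<^esub> g) ** N"
        using TS g by (simp add: \<Psi>_diff c_def matrix_mul_assoc N)
      also have "\<dots> = (N' ** k g ** N) ** c (T - S) ** (N' ** k (inv\<^bsub>\<Gamma>\<^esub> g) ** N)"
        by (simp add: c_def matrix_mul_assoc)
      also have "norm \<dots> = norm (c (T - S))"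
        using g by (intro norm_orthogonal_conj orthK) auto
      finally show ?thesis by (simp add: TS linear_diff[OF lin_c])
    qed
  qed (use that in auto)
  define T where "T = d X"
  have TE: "T \<in> E" using X(1) by (auto simp: T_def cd)
  have fix_T: "\<Psi> g T = T" if "g \<in> carrier \<Gamma>" for g
    using X(2)[OF that] by (metis T_def cd(2))
  \<comment> \<open>On the graph of the fixed \<open>T\<close> the group acts as it does on
    \<open>W\<close>, hence boundedly.\<close>
  have graph: "g *v (T *v w + w) = T *v (R *v (g *v w)) + R *v (g *v w)" if "g \<in> carrier \<Gamma>" "w \<in> W" for g w
  proof -
    have "R *v ((inv\<^bsub>\<Gamma>\<^esub> g) *v (R *v (g *v (R *v w)))) = R *v w"
      unfolding RgR[OF inv_closed[OF that(1)] that(1)] inv_mult(2)[OF that(1)] by simp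
    then have *: "R *v ((inv\<^bsub>\<Gamma>\<^esub> g) *v (R *v (g *v w))) = w"
      unfolding R_id[OF that(2)] .
    have "T *v (R *v (g *v w)) = g *v (T *v w) + g *v w - R *v (g *v w)"
      using \<Psi>[of g T "R *v (g *v w)"] unfolding fix_T[OF that(1)] pr(2) * R_id[OF that(2)] .
    then show ?thesis by (simp add: mv_simps)
  qed
  have pt: "\<exists>D. \<forall>g\<in>carrier \<Gamma>. norm (g *v x) \<le> D" if "x \<in> B \<union> (\<lambda>w. T *v w + w) ` W" for x
    using that
  proof
    assume "x \<in> B" then show ?thesis using bddB by blast
  next
    assume "x \<in> (\<lambda>w. T *v w + w) ` W"
    then obtain w where w: "w \<in> W" "x = T *v w + w" by auto
    have "norm (g *v x) \<le> norm T * (C * norm w) + C * norm w" if "g \<in> carrier \<Gamma>" for g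
    proof -
      have 1: "norm (R *v (g *v w)) \<le> C * norm w" using Rg_le[OF that, of w] R_id[OF w(1)] by simp
      have "norm (T *v (R *v (g *v w))) \<le> norm T * (C * norm w)"
        by (rule order_trans[OF norm_matrix_vector_mult_le mult_left_mono[OF 1]]) simp
      with 1 show ?thesis unfolding w(2) graph[OF that w(1)]
        by (intro order_trans[OF norm_triangle_ineq] add_mono)
    qed
    then show ?thesis by blast
  qed
  have "span (B \<union> W) \<subseteq> span (B \<union> (\<lambda>w. T *v w + w) ` W)" (is "_ \<subseteq> span ?Y")
  proof (rule span_minimal)
    have "w \<in> span ?Y" if "w \<in> W" for w
    proof -
      have "T *v w \<in> B" using PB E_simps(4)[OF TE] by metis
      then have "(T *v w + w) - T *v w \<in> span ?Y" using that by (intro span_diff span_base) auto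
      then show ?thesis by simp
    qed
    then show "B \<union> W \<subseteq> span ?Y" by (auto intro: span_base)
  qed simp
  then show ?thesis using bounded_on_span[of ?Y "carrier \<Gamma>"] pt by blast
qed

section \<open>Groups of matrices acting modulo an invariant subspace\<close>

locale matrix_group =
  fixes G :: "(real^'n^'n) set"
  assumes one_mem: "mat 1 \<in> G"
    and mult_mem: "g \<in> G \<Longrightarrow> h \<in> G \<Longrightarrow> g ** h \<in> G"
    and ex_inverse: "g \<in> G \<Longrightarrow> \<exists>h\<in>G. g ** h = mat 1 \<and> h ** g = mat 1"

locale matrix_group_quotient = matrix_group G for G :: "(real^'n^'n) set" +
  fixes B :: "(real^'n) set"
  assumes subspace_B: "subspace B" and B_proper: "B \<noteq> UNIV"
    and B_invariant: "g \<in> G \<Longrightarrow> b \<in> B \<Longrightarrow> g *v b \<in> B"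
begin

text \<open>
  The quotient by \<open>B\<close> is identified with the orthogonal complement \<open>D\<close>, on which \<open>g\<close> acts by \<open>\<rho> g\<close>.
\<close>

definition Q :: "real^'n^'n" where "Q = mat 1 - proj_mat B"
definition D :: "(real^'n) set" where "D = {x. \<forall>b\<in>B. inner x b = 0}"
definition \<rho> :: "real^'n^'n \<Rightarrow> real^'n \<Rightarrow> real^'n" where "\<rho> g x = Q *v (g *v x)"

lemma Q_apply: "Q *v x = x - proj_mat B *v x"
  by (simp add: Q_def mv_simps)

lemma Q_in_D: "Q *v x \<in> D"
  using proj_mat_orth[OF subspace_B] by (auto simp: D_def Q_apply)

lemma Q_B: "b \<in> B \<Longrightarrow> Q *v b = 0"
  by (simp add: Q_apply proj_mat_id subspace_B)

lemma Q_eq_0_iff: "Q *v x = 0 \<longleftrightarrow> x \<in> B"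
  by (metis Q_B Q_apply proj_mat_in right_minus_eq subspace_B)

lemma Q_D: "x \<in> D \<Longrightarrow> Q *v x = x"
  unfolding Q_apply using proj_mat_0[OF subspace_B, of x] by (auto simp: D_def)

lemma Q_Q [simp]: "Q *v (Q *v x) = Q *v x"
  using Q_D Q_in_D by blast

lemma norm_Q_le: "norm (Q *v x) \<le> norm x"
  unfolding Q_apply using subspace_B by (rule norm_proj_mat_compl_le)

lemma subspace_D: "subspace D"
  by (rule subspaceI) (auto simp: D_def inner_add_left)

lemma Q_g_Q: assumes "g \<in> G" shows "Q *v (g *v (Q *v x)) = Q *v (g *v x)"
proof -
  have "Q *v (g *v (proj_mat B *v x)) = 0"
    using assms by (intro Q_B B_invariant proj_mat_in subspace_B)
  then show ?thesis by (simp add: Q_apply[of x] mv_simps)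
qed

lemma \<rho>_in_D: "\<rho> g x \<in> D" by (simp add: \<rho>_def Q_in_D)

lemma \<rho>_mult: "g \<in> G \<Longrightarrow> \<rho> (g ** h) x = \<rho> g (\<rho> h x)"
  by (simp add: \<rho>_def Q_g_Q matrix_vector_mul_assoc[symmetric])

lemma \<rho>_one: "x \<in> D \<Longrightarrow> \<rho> (mat 1) x = x"
  by (simp add: \<rho>_def Q_D)

lemma linear_\<rho>: "linear (\<rho> g)"
  unfolding \<rho>_def by (intro linearI) (simp_all add: mv_simps)

lemma \<rho>_inverse: "g \<in> G \<Longrightarrow> g ** h = mat 1 \<Longrightarrow> x \<in> D \<Longrightarrow> \<rho> g (\<rho> h x) = x"
  by (metis \<rho>_mult \<rho>_one)

lemma norm_\<rho>_le: "norm (\<rho> g x) \<le> norm g * norm x"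
  unfolding \<rho>_def using norm_Q_le norm_matrix_vector_mult_le order_trans by blast

lemma inj_on_\<rho>: assumes "g \<in> G" shows "inj_on (\<rho> g) D"
proof -
  obtain h where h: "h \<in> G" "h ** g = mat 1" using ex_inverse[OF assms] by blast
  show ?thesis by (rule inj_on_inverseI[of _ "\<rho> h"]) (rule \<rho>_inverse[OF h])
qed

lemma dim_\<rho>_image:
  assumes "g \<in> G" "subspace U" "U \<subseteq> D"
  shows "dim (\<rho> g ` U) = dim U"
proof (rule dim_image_eq)
  show "inj_on (\<rho> g) (span U)"
    using assms inj_on_subset[OF inj_on_\<rho>] by (metis span_eq_iff)
qed (rule linear_\<rho>)

lemma norm_Q_lower:
  assumes "g \<in> G"
  obtains \<kappa> where "\<kappa> > 0" "\<And>x. norm (Q *v (g *v x)) \<ge> \<kappa> * norm (Q *v x)"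
proof -
  obtain h where h: "h \<in> G" "h ** g = mat 1" using ex_inverse[OF assms] by blast
  have "norm (Q *v x) \<le> (norm h + 1) * norm (Q *v (g *v x))" for x
  proof -
    have "Q *v x = \<rho> h (Q *v (g *v x))"
      unfolding \<rho>_def Q_g_Q[OF h(1)] by (metis h(2) matrix_vector_mul_assoc matrix_vector_mul_lid)
    then have "norm (Q *v x) \<le> norm h * norm (Q *v (g *v x))" by (metis norm_\<rho>_le)
    then show ?thesis by (simp add: algebra_simps add_increasing)
  qed
  then have "norm (Q *v (g *v x)) \<ge> (1 / (norm h + 1)) * norm (Q *v x)" for x
    by (simp add: divide_simps add_nonneg_pos mult.commute add_nonneg_eq_0_iff)
  moreover have "1 / (norm h + 1) > 0" by (simp add: add_nonneg_pos)
  ultimately show ?thesis using that by blast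
qed

text \<open>For a subspace \<open>U\<close> a neighbourhood of \<open>U\<close> in the projective
  space of the quotient, pulled back to n-space: only the direction of the image in the quotient
  matters, and vectors of \<open>B\<close> belong to no cone. The strict inequality makes it open
  for every set \<open>U\<close>.\<close>

definition cone :: "(real^'n) set \<Rightarrow> real \<Rightarrow> (real^'n) set"
  where "cone U \<epsilon> = {x. \<exists>u\<in>U. norm (Q *v x - u) < \<epsilon> * norm (Q *v x)}"

lemma cone_borel [measurable, simp]: "cone U \<epsilon> \<in> sets borel"
proof -
  have "open {x. norm (Q *v x - u) < \<epsilon> * norm (Q *v x)}" for u
    by (intro open_Collect_less continuous_intros)
  then have "open (\<Union>u\<in>U. {x. norm (Q *v x - u) < \<epsilon> * norm (Q *v x)})" by blast
  moreover have "cone U \<epsilon> = (\<Union>u\<in>U. {x. norm (Q *v x - u) < \<epsilon> * norm (Q *v x)})" by (auto simp: cone_def)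
  ultimately show ?thesis by simp
qed

lemma cone_mono: "U \<subseteq> V \<Longrightarrow> \<epsilon> \<le> \<delta> \<Longrightarrow> cone U \<epsilon> \<subseteq> cone V \<delta>"
  unfolding cone_def by (force intro: order_less_le_trans mult_right_mono)

lemma cone_not_B: "x \<in> cone U \<epsilon> \<Longrightarrow> Q *v x \<noteq> 0"
  by (auto simp: cone_def)

text \<open>Compactness of the unit sphere: otherwise normalized images of points in ever thinner
  cones around both subspaces accumulate at a vector \<open>l\<close> of the intersection, while
  keeping the distance \<eta> from all of it.\<close>

lemma cone_Int:
  assumes U: "subspace U" and V: "subspace V" and \<eta>: "\<eta> > 0"
  shows "\<exists>\<epsilon>>0. cone U \<epsilon> \<inter> cone V \<epsilon> \<subseteq> cone (U \<inter> V) \<eta>"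
proof (rule ccontr)
  assume "\<not> ?thesis"
  then have "\<exists>x. x \<in> cone U (1 / Suc k) \<and> x \<in> cone V (1 / Suc k) \<and> x \<notin> cone (U \<inter> V) \<eta>" for k
    by (metis (no_types, lifting) Int_iff divide_pos_pos of_nat_0_less_iff subsetI zero_less_Suc zero_less_one)
  then obtain x where x: "\<And>k. x k \<in> cone U (1 / Suc k)" "\<And>k. x k \<in> cone V (1 / Suc k)" "\<And>k. x k \<notin> cone (U \<inter> V) \<eta>"
    by metis
  define n where "n = (\<lambda>k. norm (Q *v x k))"
  have n: "n k > 0" for k using cone_not_B[OF x(1)] by (simp add: n_def)
  define y where "y = (\<lambda>k. (1 / n k) *\<^sub>R (Q *v x k))"
  have "y k \<in> sphere 0 1" for k using n[of k] by (simp add: y_def) (simp add: n_def)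
  then obtain l r where l: "l \<in> sphere 0 1" "strict_mono r" "(y \<circ> r) \<longlonglongrightarrow> l"
    using compact_sphere unfolding compact_def by metis
  have lim: "l \<in> U" if U: "subspace U" and x: "\<And>k. x k \<in> cone U (1 / Suc k)" for U
  proof -
    have "\<exists>u\<in>U. norm (Q *v x k - u) < (1 / Suc k) * n k" for k
      using x[of k] by (simp add: cone_def n_def)
    then obtain u where u: "\<And>k. u k \<in> U" "\<And>k. norm (Q *v x k - u k) < (1 / Suc k) * n k" by metis
    define v where "v = (\<lambda>k. (1 / n k) *\<^sub>R u k)"
    have v: "norm (y k - v k) \<le> 1 / Suc k" for k
    proof -
      have "norm (y k - v k) = norm (Q *v x k - u k) / n k"
        using n[of k] by (simp add: y_def v_def scaleR_diff_right[symmetric])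
      also have "\<dots> \<le> 1 / Suc k" using u(2)[of k] n[of k] by (simp add: pos_divide_le_eq)
      finally show ?thesis .
    qed
    have "(\<lambda>k. y k - v k) \<longlonglongrightarrow> 0"
      by (rule Lim_null_comparison[OF _ LIMSEQ_Suc[OF lim_1_over_n]]) (use v in auto)
    then have "((\<lambda>k. y k - v k) \<circ> r) \<longlonglongrightarrow> 0" using l(2) by (rule LIMSEQ_subseq_LIMSEQ)
    from tendsto_diff[OF l(3) this] have "(\<lambda>k. v (r k)) \<longlonglongrightarrow> l" by (simp add: o_def)
    moreover have "v (r k) \<in> U" for k using u U by (simp add: v_def subspace_mul)
    ultimately show ?thesis using closed_subspace[OF U] by (meson closed_sequentially)
  qed
  have "l \<in> U \<inter> V" using lim[OF U x(1)] lim[OF V x(2)] by simp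
  have "norm (y k - l) \<ge> \<eta>" for k
  proof -
    have "n k *\<^sub>R l \<in> U \<inter> V" using \<open>l \<in> U \<inter> V\<close> U V by (simp add: subspace_mul)
    then have "norm (Q *v x k - n k *\<^sub>R l) \<ge> \<eta> * n k" using x(3)[of k] by (force simp: cone_def n_def)
    moreover have "Q *v x k - n k *\<^sub>R l = n k *\<^sub>R (y k - l)" using n[of k] by (simp add: y_def algebra_simps)
    ultimately show ?thesis using n[of k] by (simp add: mult.commute)
  qed
  then have "\<forall>k. \<eta> \<le> norm ((y \<circ> r) k - l)" by simp
  moreover have "(\<lambda>k. norm ((y \<circ> r) k - l)) \<longlonglongrightarrow> 0"
    using l(3) tendsto_norm_zero LIM_zero by blast
  ultimately have "\<eta> \<le> 0" by (meson LIMSEQ_le_const)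
  with \<eta> show False by simp
qed

end

section \<open>Almost invariant means and the lemma of Furstenberg\<close>

text \<open>Invariance is asked of some \<open>h\<close> close to each \<open>g\<close>, because
  almost invariance of the functions behind \<Lambda> is known for almost every group element.
  Additivity is finite, since countable additivity may be lost in the passage to a cluster
  point.\<close>

locale almost_invariant_mean = matrix_group G for G :: "(real^'n^'n) set" +
  fixes \<Lambda> :: "(real^'n) set \<Rightarrow> real"
  assumes \<Lambda>_nonneg: "\<Lambda> S \<ge> 0" and \<Lambda>_UNIV: "\<Lambda> UNIV = 1"
    and \<Lambda>_union: "S \<in> sets borel \<Longrightarrow> T \<in> sets borel \<Longrightarrow> S \<inter> T = {} \<Longrightarrow> \<Lambda> (S \<union> T) = \<Lambda> S + \<Lambda> T"
    and \<Lambda>_subspace: "subspace U \<Longrightarrow> U \<noteq> UNIV \<Longrightarrow> \<Lambda> U = 0"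
    and \<Lambda>_invariant: "g \<in> G \<Longrightarrow> \<tau> > 0 \<Longrightarrow>
      \<exists>h\<in>G. norm (h - g) < \<tau> \<and> (\<forall>S\<in>sets borel. \<Lambda> {x. h *v x \<in> S} = \<Lambda> S)"
begin

lemma \<Lambda>_mono: "S \<in> sets borel \<Longrightarrow> T \<in> sets borel \<Longrightarrow> S \<subseteq> T \<Longrightarrow> \<Lambda> S \<le> \<Lambda> T"
  using \<Lambda>_union[of S "T - S"] \<Lambda>_nonneg[of "T - S"] by (simp add: Un_absorb1)

lemma \<Lambda>_diff: "S \<in> sets borel \<Longrightarrow> T \<in> sets borel \<Longrightarrow> \<Lambda> (S - T) \<ge> \<Lambda> S - \<Lambda> T"
  using \<Lambda>_union[of "S \<inter> T" "S - T"] \<Lambda>_mono[of "S \<inter> T" T] by (simp add: Int_Diff_Un Int_Diff_disjoint)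

lemma \<Lambda>_union_Int: "S \<in> sets borel \<Longrightarrow> T \<in> sets borel \<Longrightarrow> \<Lambda> (S \<union> T) = \<Lambda> S + \<Lambda> T - \<Lambda> (S \<inter> T)"
  using \<Lambda>_union[of "T \<inter> S" "T - S"] \<Lambda>_union[of S "T - S"]
  by (simp add: Int_Diff_Un Int_Diff_disjoint Int_commute[of S T])

lemma \<Lambda>_union_le: "S \<in> sets borel \<Longrightarrow> T \<in> sets borel \<Longrightarrow> \<Lambda> (S \<union> T) \<le> \<Lambda> S + \<Lambda> T"
  using \<Lambda>_union_Int[of S T] \<Lambda>_nonneg[of "S \<inter> T"] by simp

lemma \<Lambda>_le_1: "S \<in> sets borel \<Longrightarrow> \<Lambda> S \<le> 1"
  using \<Lambda>_mono[of S UNIV] \<Lambda>_UNIV by simp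

lemma \<Lambda>_empty: "\<Lambda> {} = 0"
  using \<Lambda>_union[of "{}" "{}"] by simp

end

locale almost_invariant_mean_quotient = almost_invariant_mean G \<Lambda> + matrix_group_quotient G B
  for G :: "(real^'n^'n) set" and \<Lambda> B
begin

text \<open>The mean may charge every cone around \<open>U\<close> although the vectors over
  \<open>U\<close> form a null subspace; the infimum recovers this concentrated mass.\<close>

definition mass :: "(real^'n) set \<Rightarrow> real"
  where "mass U = (INF \<epsilon>\<in>{0<..}. \<Lambda> (cone U \<epsilon>))"

lemma mass_le: "\<epsilon> > 0 \<Longrightarrow> mass U \<le> \<Lambda> (cone U \<epsilon>)"
  unfolding mass_def by (intro cINF_lower bdd_belowI[of _ 0]) (auto simp: \<Lambda>_nonneg)

lemma mass_greatest: "(\<And>\<epsilon>. \<epsilon> > 0 \<Longrightarrow> c \<le> \<Lambda> (cone U \<epsilon>)) \<Longrightarrow> c \<le> mass U"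
  unfolding mass_def by (intro cINF_greatest) auto

lemma mass_lessD: "mass U < c \<Longrightarrow> \<exists>\<epsilon>>0. \<Lambda> (cone U \<epsilon>) < c"
  using mass_greatest[of c U] by force

lemma mass_nonneg: "mass U \<ge> 0"
  by (intro mass_greatest \<Lambda>_nonneg)

text \<open>Every vector outside \<open>B\<close> lies in every cone around \<open>D\<close>, and
  the proper subspace \<open>B\<close> is null.\<close>

lemma mass_D: "mass D \<ge> 1"
proof (rule mass_greatest)
  fix \<epsilon> :: real assume "\<epsilon> > 0"
  have "x \<in> cone D \<epsilon>" if "x \<notin> B" for x
    unfolding cone_def using \<open>\<epsilon> > 0\<close> that Q_in_D[of x] by (auto simp: Q_eq_0_iff intro!: bexI[of _ "Q *v x"])
  then have "UNIV - B \<subseteq> cone D \<epsilon>" by blast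
  then have "\<Lambda> (UNIV - B) \<le> \<Lambda> (cone D \<epsilon>)"
    using closed_subspace[OF subspace_B] by (intro \<Lambda>_mono) auto
  moreover have "\<Lambda> (UNIV - B) \<ge> 1"
    using \<Lambda>_diff[of UNIV B] closed_subspace[OF subspace_B] \<Lambda>_UNIV \<Lambda>_subspace[OF subspace_B B_proper] by simp
  ultimately show "1 \<le> \<Lambda> (cone D \<epsilon>)" by simp
qed

lemma mass_0: "mass {0} = 0"
  using mass_le[of 1 "{0}"] mass_nonneg[of "{0}"] by (simp add: cone_def \<Lambda>_empty)

text \<open>If \<open>g\<close> takes \<open>S\<close> close to \<open>R\<close> with room to spare,
  \<sigma> against \<open>\<epsilon> * l\<close>, then so does a nearby \<open>h\<close> that
  preserves \<Lambda>; thus \<open>S\<close> lies in a preimage having the same mean as the cone.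
  All uses of the invariance of \<Lambda> pass through this estimate.\<close>

lemma \<Lambda>_transport:
  assumes g: "g \<in> G" and S: "S \<in> sets borel" and \<epsilon>: "\<epsilon> > 0" and \<sigma>: "0 \<le> \<sigma>" "\<sigma> < \<epsilon> * l"
    and ne: "\<And>x. x \<in> S \<Longrightarrow> Q *v x \<noteq> 0"
    and lower: "\<And>x. x \<in> S \<Longrightarrow> norm (Q *v (g *v x)) \<ge> l * norm (Q *v x)"
    and near: "\<And>x. x \<in> S \<Longrightarrow> \<exists>r\<in>R. norm (Q *v (g *v x) - r) \<le> \<sigma> * norm (Q *v x)"
  shows "\<Lambda> S \<le> \<Lambda> (cone R \<epsilon>)"
proof -
  \<comment> \<open>Half of the spare room: replacing \<open>g\<close> by \<open>h\<close> costs
    \<tau> in the distance and \<tau> in the lower bound \<open>l\<close>, whence the factor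
    \<open>1 + \<epsilon>\<close>.\<close>
  define \<tau> where "\<tau> = (\<epsilon> * l - \<sigma>) / (2 * (1 + \<epsilon>))"
  have \<tau>: "\<tau> > 0" using \<epsilon> \<sigma> by (simp add: \<tau>_def)
  have "\<tau> * (1 + \<epsilon>) = (\<epsilon> * l - \<sigma>) / 2" using \<epsilon> by (simp add: \<tau>_def field_simps)
  then have "\<tau> * (1 + \<epsilon>) < \<epsilon> * l - \<sigma>" using \<sigma> by simp
  then have \<tau>2: "\<tau> + \<sigma> < \<epsilon> * (l - \<tau>)" by (simp add: algebra_simps)
  obtain h where h: "h \<in> G" "norm (h - g) < \<tau>" "\<And>S. S \<in> sets borel \<Longrightarrow> \<Lambda> {x. h *v x \<in> S} = \<Lambda> S"
    using \<Lambda>_invariant[OF g \<tau>] by blast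
  have "S \<subseteq> {x. h *v x \<in> cone R \<epsilon>}"
  proof
    fix x assume x: "x \<in> S"
    let ?n = "norm (Q *v x)"
    have n: "?n > 0" using ne[OF x] by simp
    have "Q *v (h *v x) - Q *v (g *v x) = Q *v ((h - g) *v (Q *v x))"
      using Q_g_Q[OF g, of x] Q_g_Q[OF h(1), of x] by (simp add: mv_simps)
    also have "norm \<dots> \<le> norm (h - g) * ?n"
      using norm_Q_le norm_matrix_vector_mult_le order_trans by blast
    also have "\<dots> \<le> \<tau> * ?n" using h(2) by (intro mult_right_mono) auto
    finally have d: "norm (Q *v (h *v x) - Q *v (g *v x)) \<le> \<tau> * ?n" .
    obtain r where r: "r \<in> R" "norm (Q *v (g *v x) - r) \<le> \<sigma> * ?n" using near[OF x] by blast
    have "norm (Q *v (h *v x) - r) \<le> (\<tau> + \<sigma>) * ?n"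
      using norm_triangle_ineq[of "Q *v (h *v x) - Q *v (g *v x)" "Q *v (g *v x) - r"] d r(2)
      by (simp add: algebra_simps)
    also have "\<dots> < \<epsilon> * (l - \<tau>) * ?n" using \<tau>2 n by (rule mult_strict_right_mono)
    also have "\<dots> \<le> \<epsilon> * norm (Q *v (h *v x))"
    proof -
      have "(l - \<tau>) * ?n \<le> norm (Q *v (h *v x))"
        using lower[OF x] d norm_triangle_ineq2[of "Q *v (g *v x)" "Q *v (h *v x)"]
        by (simp add: algebra_simps norm_minus_commute)
      then show ?thesis using \<epsilon> by simp
    qed
    finally show "x \<in> {x. h *v x \<in> cone R \<epsilon>}" using r(1) by (auto simp: cone_def)
  qed
  moreover have "{x. h *v x \<in> cone R \<epsilon>} \<in> sets borel"
  proof -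
    have "(\<lambda>x. h *v x) \<in> borel_measurable borel"
      by (intro borel_measurable_continuous_onI linear_continuous_on) auto
    from measurable_sets[OF this cone_borel[of R \<epsilon>]] show ?thesis by (simp add: vimage_def)
  qed
  ultimately have "\<Lambda> S \<le> \<Lambda> {x. h *v x \<in> cone R \<epsilon>}" using S by (intro \<Lambda>_mono)
  also have "\<dots> = \<Lambda> (cone R \<epsilon>)" by (intro h(3)) simp
  finally show ?thesis .
qed

text \<open>An invertible linear map takes a sufficiently thin cone around \<open>U\<close> into a
  given cone around the image of \<open>U\<close>.\<close>

lemma mass_\<rho>_le:
  assumes g: "g \<in> G"
  shows "mass U \<le> mass (\<rho> g ` U)"
proof (rule mass_greatest)
  fix \<epsilon> :: real assume \<epsilon>: "\<epsilon> > 0"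
  obtain \<kappa> where \<kappa>: "\<kappa> > 0" "\<And>x. norm (Q *v (g *v x)) \<ge> \<kappa> * norm (Q *v x)"
    using norm_Q_lower[OF g] by blast
  define e where "e = \<epsilon> * \<kappa> / (2 * (norm g + 1))"
  have e: "e > 0" using \<epsilon> \<kappa> by (simp add: e_def add_nonneg_pos)
  have "norm g * e < \<epsilon> * \<kappa>"
  proof -
    have "norm g * e \<le> (norm g + 1) * e" using e by simp
    also have "\<dots> = \<epsilon> * \<kappa> / 2" by (simp add: e_def field_simps add_nonneg_eq_0_iff)
    also have "\<dots> < \<epsilon> * \<kappa>" using \<epsilon> \<kappa> by simp
    finally show ?thesis .
  qed
  then have "\<Lambda> (cone U e) \<le> \<Lambda> (cone (\<rho> g ` U) \<epsilon>)"
  proof (intro \<Lambda>_transport[OF g _ \<epsilon>, of _ "norm g * e" \<kappa>])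
    fix x assume x: "x \<in> cone U e"
    then show "Q *v x \<noteq> 0" by (rule cone_not_B)
    from x obtain u where u: "u \<in> U" "norm (Q *v x - u) < e * norm (Q *v x)" by (auto simp: cone_def)
    have "Q *v (g *v x) - \<rho> g u = \<rho> g (Q *v x - u)"
      using Q_g_Q[OF g, of x] by (simp add: \<rho>_def mv_simps)
    also have "norm \<dots> \<le> norm g * (e * norm (Q *v x))"
      by (rule order_trans[OF norm_\<rho>_le]) (use u in \<open>auto intro: mult_left_mono\<close>)
    finally show "\<exists>r\<in>\<rho> g ` U. norm (Q *v (g *v x) - r) \<le> norm g * e * norm (Q *v x)"
      using u(1) by (auto simp: mult.assoc)
  qed (use \<kappa> e in auto)
  with mass_le[OF e] show "mass U \<le> \<Lambda> (cone (\<rho> g ` U) \<epsilon>)" using order_trans by blast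
qed

lemma mass_\<rho>:
  assumes g: "g \<in> G" and U: "U \<subseteq> D"
  shows "mass (\<rho> g ` U) = mass U"
proof (rule antisym)
  obtain h where h: "h \<in> G" "h ** g = mat 1" using ex_inverse[OF g] by blast
  have "\<rho> h ` \<rho> g ` U = U" using \<rho>_inverse[OF h] U by (force simp: image_image)
  with mass_\<rho>_le[OF h(1), of "\<rho> g ` U"] show "mass (\<rho> g ` U) \<le> mass U" by simp
qed (rule mass_\<rho>_le[OF g])

text \<open>Thin cones around two members meet inside a cone around their intersection, which has
  mass zero. The overlaps are therefore negligible, and the masses add up to at most the total mass
  one.\<close>

lemma card_mass_le:
  assumes fin: "finite F" and sub: "\<And>U. U \<in> F \<Longrightarrow> subspace U"
    and Int: "\<And>U V. U \<in> F \<Longrightarrow> V \<in> F \<Longrightarrow> U \<noteq> V \<Longrightarrow> mass (U \<inter> V) = 0"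
    and mass: "\<And>U. U \<in> F \<Longrightarrow> mass U \<ge> \<theta>"
  shows "real (card F) * \<theta> \<le> 1"
proof (rule ccontr)
  assume "\<not> ?thesis"
  then have gt: "card F * \<theta> > 1" by simp
  \<comment> \<open>All overlaps together cost at most \<open>(card F)\<^sup>2 * \<delta>\<close>,
    to be kept below the excess \<open>card F * \<theta> - 1\<close>; the summand 1 keeps the
    denominator positive.\<close>
  define \<delta> where "\<delta> = (card F * \<theta> - 1) / (2 * (card F)\<^sup>2 + 1)"
  have \<delta>: "\<delta> > 0" using gt unfolding \<delta>_def by (intro divide_pos_pos) (auto simp: add_pos_nonneg)
  have ev: "eventually (\<lambda>\<epsilon>. \<Lambda> (cone U \<epsilon> \<inter> cone V \<epsilon>) < \<delta>) (at_right 0)" if UV: "U \<in> F" "V \<in> F" "U \<noteq> V" for U V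
  proof -
    obtain \<eta> where \<eta>: "\<eta> > 0" "\<Lambda> (cone (U \<inter> V) \<eta>) < \<delta>" using mass_lessD[of "U \<inter> V" \<delta>] Int[OF UV] \<delta> by auto
    obtain \<epsilon> where \<epsilon>: "\<epsilon> > 0" "cone U \<epsilon> \<inter> cone V \<epsilon> \<subseteq> cone (U \<inter> V) \<eta>"
      using cone_Int[OF sub sub \<eta>(1)] UV by blast
    have "\<Lambda> (cone U e \<inter> cone V e) < \<delta>" if "0 < e" "e < \<epsilon>" for e
    proof -
      have "cone U e \<inter> cone V e \<subseteq> cone (U \<inter> V) \<eta>"
        using cone_mono[of U U e \<epsilon>] cone_mono[of V V e \<epsilon>] that \<epsilon>(2) by auto
      then have "\<Lambda> (cone U e \<inter> cone V e) \<le> \<Lambda> (cone (U \<inter> V) \<eta>)" by (intro \<Lambda>_mono) auto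
      with \<eta> show ?thesis by simp
    qed
    then show ?thesis using \<epsilon>(1) by (auto simp: eventually_at_right_field)
  qed
  have "eventually (\<lambda>\<epsilon>. \<forall>U\<in>F. \<forall>V\<in>F. U \<noteq> V \<longrightarrow> \<Lambda> (cone U \<epsilon> \<inter> cone V \<epsilon>) < \<delta>) (at_right 0)"
    using fin ev by (intro eventually_ball_finite ballI) (auto simp: eventually_mono)
  moreover have "eventually (\<lambda>\<epsilon>. \<epsilon> > (0::real)) (at_right 0)" by (simp add: eventually_at_right_less)
  ultimately have "eventually (\<lambda>\<epsilon>. \<epsilon> > 0 \<and> (\<forall>U\<in>F. \<forall>V\<in>F. U \<noteq> V \<longrightarrow> \<Lambda> (cone U \<epsilon> \<inter> cone V \<epsilon>) < \<delta>)) (at_right 0)"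
    by eventually_elim auto
  from eventually_happens'[OF trivial_limit_at_right_real this]
  obtain \<epsilon> where "\<epsilon> > 0 \<and> (\<forall>U\<in>F. \<forall>V\<in>F. U \<noteq> V \<longrightarrow> \<Lambda> (cone U \<epsilon> \<inter> cone V \<epsilon>) < \<delta>)" ..
  then have \<epsilon>: "\<epsilon> > 0" and pair: "\<And>U V. U \<in> F \<Longrightarrow> V \<in> F \<Longrightarrow> U \<noteq> V \<Longrightarrow> \<Lambda> (cone U \<epsilon> \<inter> cone V \<epsilon>) < \<delta>"
    by auto
  have union_le: "\<Lambda> (\<Union>i\<in>I. A i) \<le> card I * \<delta>" if "finite I" "\<And>i. i \<in> I \<Longrightarrow> A i \<in> sets borel \<and> \<Lambda> (A i) \<le> \<delta>"
    for I and A :: "(real^'n) set \<Rightarrow> (real^'n) set"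
    using that
  proof (induction I rule: finite_induct)
    case (insert i I)
    then have "\<Lambda> (A i \<union> (\<Union>i\<in>I. A i)) \<le> \<Lambda> (A i) + \<Lambda> (\<Union>i\<in>I. A i)"
      by (intro \<Lambda>_union_le) auto
    also have "\<dots> \<le> \<delta> + card I * \<delta>" using insert by (intro add_mono) auto
    finally show ?case using insert by (simp add: algebra_simps)
  qed (simp add: \<Lambda>_empty)
  have "F' \<subseteq> F \<Longrightarrow> \<Lambda> (\<Union>U\<in>F'. cone U \<epsilon>) \<ge> card F' * \<theta> - (card F')\<^sup>2 * \<delta>" if "finite F'" for F'
    using that
  proof (induction F' rule: finite_induct)
    case (insert V F')
    have "\<Lambda> (\<Union>U\<in>F'. cone U \<epsilon> \<inter> cone V \<epsilon>) \<le> card F' * \<delta>"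
      using insert by (intro union_le) (auto intro!: less_imp_le[OF pair])
    then have "\<Lambda> ((\<Union>U\<in>F'. cone U \<epsilon>) \<inter> cone V \<epsilon>) \<le> card F' * \<delta>" by (simp add: Int_commute)
    moreover have "\<Lambda> (cone V \<epsilon>) \<ge> \<theta>" using mass_le[OF \<epsilon>, of V] mass[of V] insert by auto
    moreover have "\<Lambda> (\<Union>U\<in>F'. cone U \<epsilon>) \<ge> card F' * \<theta> - (card F')\<^sup>2 * \<delta>" using insert by auto
    moreover have "\<Lambda> ((\<Union>U\<in>F'. cone U \<epsilon>) \<union> cone V \<epsilon>) = \<Lambda> (\<Union>U\<in>F'. cone U \<epsilon>) + \<Lambda> (cone V \<epsilon>) - \<Lambda> ((\<Union>U\<in>F'. cone U \<epsilon>) \<inter> cone V \<epsilon>)"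
      using insert by (intro \<Lambda>_union_Int) auto
    moreover have "(real (card F') + 1)\<^sup>2 * \<delta> \<ge> (card F')\<^sup>2 * \<delta> + card F' * \<delta>"
      using \<delta> by (simp add: power2_eq_square algebra_simps)
    ultimately show ?case using insert by (simp add: algebra_simps Un_commute)
  qed (simp add: \<Lambda>_empty)
  from this[OF fin] have "card F * \<theta> - (card F)\<^sup>2 * \<delta> \<le> 1"
    using \<Lambda>_le_1[of "\<Union>U\<in>F. cone U \<epsilon>"] fin by (simp add: sets.finite_UN)
  moreover have "(card F)\<^sup>2 * \<delta> < card F * \<theta> - 1"
  proof -
    have "(card F)\<^sup>2 * \<delta> \<le> (card F)\<^sup>2 * \<delta> + ((card F)\<^sup>2 * \<delta>)" using \<delta> by simp
    also have "\<dots> < (2 * (card F)\<^sup>2 + 1) * \<delta>" using \<delta> by (simp add: algebra_simps)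
    also have "\<dots> = card F * \<theta> - 1" by (simp add: \<delta>_def add_nonneg_eq_0_iff)
    finally show ?thesis by simp
  qed
  ultimately show False by simp
qed

text \<open>Removing the direction of the kernel vector \<open>v\<close> does not change the image
  and leaves a subspace of smaller dimension.\<close>

lemma (in -) dim_linear_image_less:
  fixes f :: "real^'n \<Rightarrow> real^'m"
  assumes f: "linear f" and U: "subspace U" and v: "v \<in> U" "v \<noteq> 0" "f v = 0"
  shows "dim (f ` U) < dim U"
proof -
  define U' where "U' = {u\<in>U. inner u v = 0}"
  have subU': "subspace U'" using U by (auto simp: U'_def subspace_def inner_add_left)
  have "f ` U \<subseteq> f ` U'"
  proof
    fix y assume "y \<in> f ` U"
    then obtain u where u: "u \<in> U" "y = f u" by auto
    define c where "c = inner u v / inner v v"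
    have "u - c *\<^sub>R v \<in> U'" using u v U
      by (auto simp: U'_def subspace_diff subspace_mul inner_diff_left c_def)
    moreover have "f (u - c *\<^sub>R v) = y" by (simp add: u v(3) linear_diff[OF f] linear_scale[OF f])
    ultimately show "y \<in> f ` U'" by (metis imageI)
  qed
  then have "dim (f ` U) \<le> dim (f ` U')" by (rule dim_subset)
  also have "\<dots> \<le> dim U'" using f by (rule dim_image_le)
  also have "\<dots> < dim U"
  proof (rule dim_psubset)
    have "v \<notin> U'" using v by (auto simp: U'_def)
    then have "U' \<subset> U" using v(1) unfolding U'_def by blast
    then show "span U' \<subset> span U" using U subU' by (simp add: span_eq_iff[THEN iffD2])
  qed
  finally show ?thesis .
qed

text \<open>
  A sequence of unbounded distortion has, after normalization, a singular limit \<open>T\<close>; it pushes the mass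
  near \<open>U\<close>, except what lies near the kernel of \<open>T\<close>, towards the range of \<open>T\<close>. Both have lower dimension.
\<close>

lemma stabilizer_conformally_bounded:
  assumes U: "subspace U" "U \<subseteq> D" and pos: "mass U > 0"
    and min: "\<And>V. subspace V \<Longrightarrow> V \<subseteq> D \<Longrightarrow> dim V < dim U \<Longrightarrow> mass V = 0"
  shows "\<exists>C>0. \<forall>g\<in>G. \<rho> g ` U = U \<longrightarrow> (\<forall>x\<in>U. \<forall>y\<in>U. norm (\<rho> g x) * norm y \<le> C * norm (\<rho> g y) * norm x)"
proof (rule ccontr)
  assume contr: "\<not> ?thesis"
  have "\<exists>g x y. g \<in> G \<and> \<rho> g ` U = U \<and> x \<in> U \<and> y \<in> U \<and>
    norm (\<rho> g x) * norm y > real (Suc i) * norm (\<rho> g y) * norm x" for i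
    using contr by (metis not_le of_nat_0_less_iff zero_less_Suc)
  then obtain g x y where gxy: "\<And>i. g i \<in> G" "\<And>i. \<rho> (g i) ` U = U" "\<And>i. x i \<in> U" "\<And>i. y i \<in> U"
    "\<And>i. norm (\<rho> (g i) (x i)) * norm (y i) > real (Suc i) * norm (\<rho> (g i) (y i)) * norm (x i)"
    by metis
  have pos': "norm (\<rho> (g i) (x i)) > 0" "norm (y i) > 0" "norm (x i) > 0" for i
  proof -
    have "norm (\<rho> (g i) (x i)) * norm (y i) > 0"
      using gxy(5)[of i] by (meson less_le_trans mult_nonneg_nonneg norm_ge_zero not_le of_nat_0_le_iff)
    then show "norm (\<rho> (g i) (x i)) > 0" "norm (y i) > 0"
      by (auto simp: zero_less_mult_iff)
    then show "norm (x i) > 0"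
      using linear_0[OF linear_\<rho>[of "g i"]] by force
  qed
  \<comment> \<open>Extended by zero on the complement of \<open>U\<close>, so that normalization
    and compactness take place among matrices.\<close>
  define A where "A = (\<lambda>i. Q ** g i ** proj_mat U)"
  have A: "A i *v u = \<rho> (g i) u" if "u \<in> U" for i u
    using U that by (simp add: A_def \<rho>_def mv_simps proj_mat_id)
  have A_in: "A i *v u \<in> U" for i u
  proof -
    have "A i *v u = \<rho> (g i) (proj_mat U *v u)" by (simp add: A_def \<rho>_def mv_simps)
    then show ?thesis using gxy(2)[of i] proj_mat_in[OF U(1), of u] by auto
  qed
  have A_proj: "A i *v (proj_mat U *v u) = A i *v u" for i u
    using U by (simp add: A_def mv_simps proj_mat_id proj_mat_in)
  define s where "s = (\<lambda>i. norm (A i))"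
  have s: "s i > 0" for i
  proof -
    have "norm (A i *v x i) > 0" using A[OF gxy(3)] pos'(1)[of i] by simp
    then have "A i \<noteq> 0" by auto
    then show ?thesis by (simp add: s_def)
  qed
  define Ti where "Ti = (\<lambda>i. (1 / s i) *\<^sub>R A i)"
  have Ti: "Ti i *v u = (1 / s i) *\<^sub>R (A i *v u)" for i u by (simp add: Ti_def scaleR_matrix_vector_assoc)
  define v where "v = (\<lambda>i. (1 / norm (y i)) *\<^sub>R y i)"
  have vU: "v i \<in> U" for i using gxy(4) U by (simp add: v_def subspace_mul)
  have v1: "norm (v i) = 1" for i using pos'(2)[of i] by (simp add: v_def)
  \<comment> \<open>The distortion inequality at index \<open>i\<close> says that the normalized map
    nearly annihilates the unit vector \<open>v i\<close>.\<close>
  have small: "norm (Ti i *v v i) \<le> 1 / real (Suc i)" for i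
  proof -
    have "norm (A i *v y i) * norm (x i) * real (Suc i) \<le> norm (A i *v x i) * norm (y i)"
      using gxy(5)[of i] A gxy(3,4) by (simp add: mult_ac)
    also have "\<dots> \<le> s i * norm (x i) * norm (y i)"
      using norm_matrix_vector_mult_le[of "A i" "x i"] by (simp add: s_def mult_right_mono)
    finally have "norm (A i *v y i) * real (Suc i) * norm (x i) \<le> s i * norm (y i) * norm (x i)"
      by (simp add: mult_ac)
    then have "norm (A i *v y i) * real (Suc i) \<le> s i * norm (y i)"
      using pos'(3)[of i] by simp
    then show ?thesis using s[of i] pos'(2)[of i]
      by (simp add: Ti v_def mv_simps divide_simps mult_ac)
  qed
  have "(Ti i, v i) \<in> sphere 0 1 \<times> sphere 0 1" for i
    using s[of i] v1 by (simp add: Ti_def s_def)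
  moreover have "compact (sphere (0::real^'n^'n) 1 \<times> sphere (0::real^'n) 1)"
    by (intro compact_Times compact_sphere)
  ultimately obtain l r where l: "l \<in> sphere (0::real^'n^'n) 1 \<times> sphere (0::real^'n) 1" "strict_mono r"
    "((\<lambda>i. (Ti i, v i)) \<circ> r) \<longlonglongrightarrow> l"
    unfolding compact_def by (metis (no_types, lifting))
  obtain T w where Tw: "l = (T, w)" by (cases l)
  have limT: "(\<lambda>i. Ti (r i)) \<longlonglongrightarrow> T" and limv: "(\<lambda>i. v (r i)) \<longlonglongrightarrow> w"
    using tendsto_fst[OF l(3)] tendsto_snd[OF l(3)] by (simp_all add: o_def Tw)
  have "norm T = 1" "norm w = 1" using l(1) by (auto simp: Tw)
  have lim_app: "(\<lambda>i. Ti (r i) *v u) \<longlonglongrightarrow> T *v u" for u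
    by (intro bounded_bilinear.tendsto[OF bounded_bilinear_matrix_vector_mult] limT tendsto_const)
  have wU: "w \<in> U" using closed_subspace[OF U(1)] vU limv by (meson closed_sequentially)
  have TU: "T *v u \<in> U" for u
  proof -
    have "Ti (r i) *v u \<in> U" for i using A_in U(1) by (simp add: Ti subspace_mul)
    then show ?thesis using closed_subspace[OF U(1)] lim_app by (meson closed_sequentially)
  qed
  have Tproj: "T *v (proj_mat U *v u) = T *v u" for u
    using LIMSEQ_unique[OF lim_app[of "proj_mat U *v u"]] lim_app[of u] by (simp add: Ti A_proj)
  have "T *v w = 0"
  proof -
    have "(\<lambda>i. Ti (r i) *v v (r i)) \<longlonglongrightarrow> T *v w"
      by (intro bounded_bilinear.tendsto[OF bounded_bilinear_matrix_vector_mult] limT limv)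
    moreover have "(\<lambda>i. Ti i *v v i) \<longlonglongrightarrow> 0"
      by (rule Lim_null_comparison[OF _ LIMSEQ_Suc[OF lim_1_over_n]]) (use small in auto)
    from LIMSEQ_subseq_LIMSEQ[OF this l(2)] have "(\<lambda>i. Ti (r i) *v v (r i)) \<longlonglongrightarrow> 0" by (simp add: o_def)
    ultimately show ?thesis by (rule LIMSEQ_unique)
  qed
  \<comment> \<open>The unit vector \<open>w\<close> is annihilated, so the range has smaller
    dimension than \<open>U\<close>; the kernel is proper because \<open>T\<close> has norm one. By
    minimality neither carries mass.\<close>
  define K where "K = {u\<in>U. T *v u = 0}"
  define R where "R = (*v) T ` U"
  have subK: "subspace K" using U(1) by (auto simp: K_def subspace_def mv_simps)
  have subR: "subspace R" unfolding R_def using U(1) by (intro linear_subspace_image) auto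
  have "dim R < dim U" unfolding R_def
    using U(1) wU \<open>T *v w = 0\<close> \<open>norm w = 1\<close> by (intro dim_linear_image_less[of _ U w]) auto
  then have massR: "mass R = 0" using subR TU U(2) by (intro min) (auto simp: R_def)
  have "dim K < dim U"
  proof (rule dim_psubset)
    have "K \<noteq> U"
    proof
      assume "K = U"
      have "T *v u = 0" for u
      proof -
        have "proj_mat U *v u \<in> K" using proj_mat_in[OF U(1), of u] \<open>K = U\<close> by simp
        then have "T *v (proj_mat U *v u) = 0" by (simp add: K_def)
        then show ?thesis using Tproj[of u] by simp
      qed
      then have "T = 0" by (simp add: matrix_eq)
      with \<open>norm T = 1\<close> show False by simp
    qed
    then have "K \<subset> U" by (auto simp: K_def)
    then show "span K \<subset> span U" using U(1) subK by (simp add: span_eq_iff[THEN iffD2])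
  qed
  then have massK: "mass K = 0" using subK U(2) by (intro min) (auto simp: K_def)
  define \<theta> where "\<theta> = mass U"
  obtain \<delta> where \<delta>: "\<delta> > 0" "\<Lambda> (cone R \<delta>) < \<theta> / 2" using mass_lessD[of R "\<theta> / 2"] massR pos \<theta>_def by auto
  obtain \<eta> where \<eta>: "\<eta> > 0" "\<Lambda> (cone K \<eta>) < \<theta> / 2" using mass_lessD[of K "\<theta> / 2"] massK pos \<theta>_def by auto
  \<comment> \<open>Away from a cone around the kernel \<open>T\<close> is bounded below, by
    compactness of that part of the unit sphere.\<close>
  obtain c where c: "c > 0" "\<And>u. u \<in> U \<Longrightarrow> (\<And>k. k \<in> K \<Longrightarrow> norm (u - k) \<ge> \<eta> / 2 * norm u) \<Longrightarrow> norm (T *v u) \<ge> c * norm u"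
  proof -
    define Z where "Z = {u\<in>U. norm u = 1 \<and> (\<forall>k\<in>K. norm (u - k) \<ge> \<eta> / 2)}"
    have "Z = U \<inter> sphere 0 1 \<inter> (\<Inter>k\<in>K. {u. \<eta> / 2 \<le> norm (u - k)})" by (auto simp: Z_def)
    moreover have "closed (\<Inter>k\<in>K. {u. \<eta> / 2 \<le> norm (u - k)})"
      by (intro closed_INT ballI closed_Collect_le continuous_intros)
    ultimately have "compact Z"
      using closed_subspace[OF U(1)] by (simp add: closed_Int_compact compact_Int_closed)
    have ex: "\<exists>c>0. \<forall>u\<in>Z. norm (T *v u) \<ge> c"
    proof (cases "Z = {}")
      case False
      then obtain z where z: "z \<in> Z" "\<And>u. u \<in> Z \<Longrightarrow> norm (T *v z) \<le> norm (T *v u)"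
        using continuous_attains_inf[OF \<open>compact Z\<close>, of "\<lambda>u. norm (T *v u)"]
        by (metis continuous_on_norm linear_continuous_on matrix_vector_mul_bounded_linear)
      have "T *v z \<noteq> 0"
      proof
        assume "T *v z = 0"
        then have "z \<in> K" using z(1) by (auto simp: Z_def K_def)
        then have "norm (z - z) \<ge> \<eta> / 2" using z(1) unfolding Z_def by blast
        with \<eta> show False by simp
      qed
      with z show ?thesis by (metis zero_less_norm_iff)
    qed (auto intro: exI[of _ 1])
    then obtain c where c: "c > 0" "\<And>u. u \<in> Z \<Longrightarrow> norm (T *v u) \<ge> c" by blast
    have "norm (T *v u) \<ge> c * norm u" if u: "u \<in> U" "\<And>k. k \<in> K \<Longrightarrow> norm (u - k) \<ge> \<eta> / 2 * norm u" for u
    proof (cases "u = 0")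
      case False
      define n where "n = norm u"
      have n: "n > 0" using False by (simp add: n_def)
      have "(1 / n) *\<^sub>R u \<in> Z"
      proof -
        have "norm ((1 / n) *\<^sub>R u - k) \<ge> \<eta> / 2" if "k \<in> K" for k
        proof -
          have "(1 / n) *\<^sub>R u - k = (1 / n) *\<^sub>R (u - n *\<^sub>R k)" using n by (simp add: algebra_simps)
          moreover have "norm (u - n *\<^sub>R k) \<ge> \<eta> / 2 * n" using u(2)[of "n *\<^sub>R k"] that subK by (simp add: subspace_mul n_def)
          ultimately show ?thesis using n by (simp add: divide_simps mult.commute)
        qed
        then show ?thesis using u(1) U(1) n by (simp add: Z_def subspace_mul) (simp add: n_def)
      qed
      from c(2)[OF this] have "norm (T *v u) / n \<ge> c" using n by (simp add: mv_simps)
      then show ?thesis using n by (simp add: pos_le_divide_eq n_def)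
    qed simp
    with c(1) show ?thesis using that by blast
  qed
  \<comment> \<open>Chosen so that the total error \<sigma> below, at most
    \<open>9 / 4 * (t * \<omega>)\<close>, gives at most \<open>9 / 16 * (t * c * \<delta>)\<close>
    when multiplied by \<open>1 + \<delta>\<close>; the transport estimate allows
    \<open>3 / 4 * (t * c * \<delta>)\<close>.\<close>
  define \<omega> where "\<omega> = \<delta> * c / (4 * (1 + \<delta>))"
  have \<omega>: "\<omega> > 0" "\<omega> * (1 + \<delta>) = \<delta> * c / 4" using \<delta> c(1) by (simp_all add: \<omega>_def field_simps)
  have "eventually (\<lambda>i. norm (Ti (r i) - T) < \<omega>) sequentially"
    using limT \<omega>(1) unfolding tendsto_iff dist_norm by blast
  then obtain i where i: "norm (Ti (r i) - T) < \<omega>"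
    using eventually_happens trivial_limit_sequentially by blast
  define h where "h = g (r i)"
  define t where "t = s (r i)"
  have h: "h \<in> G" and t: "t > 0" using gxy(1) s by (auto simp: h_def t_def)
  have hu: "norm (\<rho> h u - t *\<^sub>R (T *v u)) \<le> t * \<omega> * norm u" if "u \<in> U" for u
  proof -
    have "\<rho> h u - t *\<^sub>R (T *v u) = t *\<^sub>R ((Ti (r i) - T) *v u)"
      using A[OF that, of "r i"] t by (simp add: Ti mv_simps h_def scaleR_diff_right) (simp add: t_def)
    then have "norm (\<rho> h u - t *\<^sub>R (T *v u)) = t * norm ((Ti (r i) - T) *v u)" using t by simp
    also have "\<dots> \<le> t * (norm (Ti (r i) - T) * norm u)"
      using t by (intro mult_left_mono norm_matrix_vector_mult_le) auto
    also have "\<dots> \<le> t * (\<omega> * norm u)"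
      using t i by (intro mult_left_mono mult_right_mono) auto
    finally show ?thesis by (simp add: mult.assoc)
  qed
  \<comment> \<open>The three bounds keep the length of \<open>u\<close> comparable to that of
    \<open>Q *v x\<close>, keep \<open>u\<close> away from the kernel, and limit the relative error
    of replacing \<open>Q *v x\<close> by \<open>u\<close> under \<open>h\<close> to
    \<open>t * \<omega>\<close>.\<close>
  define e where "e = Min {1 / 4, \<eta> / 4, t * \<omega> / (norm h + 1)}"
  have e: "e > 0" "e \<le> 1 / 4" "e \<le> \<eta> / 4" "e \<le> t * \<omega> / (norm h + 1)"
  proof -
    show "e > 0" using \<eta> t \<omega> by (simp add: e_def add_nonneg_pos)
  qed (unfold e_def, (rule Min_le; simp)+)
  have he: "norm h * e \<le> t * \<omega>"
  proof -
    have "norm h * e \<le> (norm h + 1) * e" using e by simp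
    also have "\<dots> \<le> t * \<omega>" using e(4) by (simp add: pos_le_divide_eq add_nonneg_pos mult.commute)
    finally show ?thesis .
  qed
  define \<sigma> where "\<sigma> = norm h * e + 5 / 4 * (t * \<omega>)"
  have \<sigma>: "0 \<le> \<sigma>" "\<sigma> \<le> 9 / 4 * (t * \<omega>)" 
  proof -
    have "0 \<le> norm h * e" "0 \<le> t * \<omega>" using e(1) t \<omega>(1) by simp_all
    then show "0 \<le> \<sigma>" "\<sigma> \<le> 9 / 4 * (t * \<omega>)" using he unfolding \<sigma>_def by linarith+
  qed
  have "\<Lambda> (cone U e - cone K \<eta>) \<le> \<Lambda> (cone R \<delta>)"
  proof (rule \<Lambda>_transport[OF h _ \<delta>(1) \<sigma>(1), where l = "3 / 4 * (t * c) - \<sigma>"])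
    have "\<sigma> * (1 + \<delta>) \<le> 9 / 4 * (t * \<omega>) * (1 + \<delta>)" using \<sigma>(2) \<delta>(1) by (intro mult_right_mono) auto
    also have "\<dots> = 9 / 4 * t * (\<omega> * (1 + \<delta>))" by (simp only: mult_ac)
    also have "\<dots> = 9 / 16 * (t * c * \<delta>)" unfolding \<omega>(2) by simp
    also have "\<dots> < 3 / 4 * (t * c * \<delta>)" using t c \<delta> by simp
    finally show "\<sigma> < \<delta> * (3 / 4 * (t * c) - \<sigma>)" by (simp add: algebra_simps)
    show "cone U e - cone K \<eta> \<in> sets borel" by simp
    fix x assume x: "x \<in> cone U e - cone K \<eta>"
    then show "Q *v x \<noteq> 0" using cone_not_B by blast
    define n where "n = norm (Q *v x)"
    from x obtain u where u: "u \<in> U" "norm (Q *v x - u) < e * n" by (auto simp: cone_def n_def)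
    have n: "n > 0" using \<open>Q *v x \<noteq> 0\<close> by (simp add: n_def)
    have "e * n \<le> n / 4" using e(2) n by (metis mult.commute mult_left_mono less_imp_le mult.right_neutral times_divide_eq_right)
    then have u_bounds: "norm u \<ge> 3 / 4 * n" "norm u \<le> 5 / 4 * n"
      using u(2) norm_triangle_ineq2[of "Q *v x" u] norm_triangle_ineq2[of u "Q *v x"]
      by (auto simp: n_def norm_minus_commute)
    have Tu: "norm (T *v u) \<ge> c * norm u"
    proof (rule c(2)[OF u(1)])
      fix k assume k: "k \<in> K"
      then have "norm (Q *v x - k) \<ge> \<eta> * n" using x by (force simp: cone_def n_def)
      moreover have "norm (Q *v x - k) \<le> norm (Q *v x - u) + norm (u - k)"
        using norm_triangle_ineq[of "Q *v x - u" "u - k"] by simp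
      moreover have "e * n \<le> \<eta> / 4 * n" using e(3) n by (intro mult_right_mono) auto
      ultimately have "norm (u - k) \<ge> 3 / 4 * \<eta> * n" using u(2) by simp
      moreover have "\<eta> / 2 * norm u \<le> \<eta> / 2 * (5 / 4 * n)" using u_bounds \<eta> by (intro mult_left_mono) auto
      moreover have "\<eta> * n > 0" using \<eta> n by simp
      ultimately show "\<eta> / 2 * norm u \<le> norm (u - k)" by simp
    qed
    have "Q *v (h *v x) - \<rho> h u = \<rho> h (Q *v x - u)"
      using Q_g_Q[OF h, of x] by (simp add: \<rho>_def mv_simps)
    then have "norm (Q *v (h *v x) - \<rho> h u) \<le> norm h * norm (Q *v x - u)" by (metis norm_\<rho>_le)
    also have "\<dots> \<le> norm h * (e * n)" using u(2) by (intro mult_left_mono) auto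
    finally have 1: "norm (Q *v (h *v x) - \<rho> h u) \<le> norm h * (e * n)" .
    have 2: "norm (\<rho> h u - t *\<^sub>R (T *v u)) \<le> t * \<omega> * (5 / 4 * n)"
      by (rule order_trans[OF hu[OF u(1)]]) (use u_bounds t \<omega> in \<open>auto intro: mult_left_mono\<close>)
    have 3: "norm (Q *v (h *v x) - t *\<^sub>R (T *v u)) \<le> \<sigma> * n"
      using norm_triangle_ineq[of "Q *v (h *v x) - \<rho> h u" "\<rho> h u - t *\<^sub>R (T *v u)"] 1 2
      by (simp add: \<sigma>_def algebra_simps)
    have "t *\<^sub>R (T *v u) \<in> R" using u(1) subR by (auto simp: R_def intro!: subspace_mul)
    with 3 show "\<exists>r\<in>R. norm (Q *v (h *v x) - r) \<le> \<sigma> * norm (Q *v x)" by (auto simp: n_def)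
    have "t * (c * (3 / 4 * n)) \<le> t * norm (T *v u)"
      using Tu u_bounds(1) t c(1) by (intro mult_left_mono) (auto intro: order_trans[OF mult_left_mono])
    moreover have "t * norm (T *v u) \<le> norm (Q *v (h *v x)) + norm (Q *v (h *v x) - t *\<^sub>R (T *v u))"
      using norm_triangle_ineq2[of "t *\<^sub>R (T *v u)" "Q *v (h *v x)"] t by (simp add: norm_minus_commute)
    ultimately show "(3 / 4 * (t * c) - \<sigma>) * norm (Q *v x) \<le> norm (Q *v (h *v x))"
      using 3 by (simp add: n_def[symmetric] algebra_simps)
  qed
  \<comment> \<open>Near \<open>U\<close> there is mass at least \<theta>, near the kernel less than
    half of it; more than half is moved close to the range, where less than half is
    available.\<close>
  moreover have "\<Lambda> (cone U e - cone K \<eta>) \<ge> \<Lambda> (cone U e) - \<Lambda> (cone K \<eta>)" by (intro \<Lambda>_diff) auto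
  moreover have "\<Lambda> (cone U e) \<ge> \<theta>" unfolding \<theta>_def using e(1) by (rule mass_le)
  ultimately show False using \<delta>(2) \<eta>(2) by simp
qed

text \<open>Distinct subspaces of the minimal dimension meet in a smaller one, hence without mass,
  so \<open>card_mass_le\<close> limits the number of those with a given positive mass. Prescribing
  the exact mass of one of them makes the family invariant, by \<open>mass_\<rho>\<close>.\<close>

lemma ex_invariant_family:
  obtains I where "finite I" "I \<noteq> {}"
    "\<And>U. U \<in> I \<Longrightarrow> subspace U" "\<And>U. U \<in> I \<Longrightarrow> U \<subseteq> D" "\<And>U. U \<in> I \<Longrightarrow> U \<noteq> {0}"
    "\<And>g U. g \<in> G \<Longrightarrow> U \<in> I \<Longrightarrow> \<rho> g ` U \<in> I"
    "\<And>U. U \<in> I \<Longrightarrow> \<exists>C>0. \<forall>g\<in>G. \<rho> g ` U = U \<longrightarrow>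
      (\<forall>x\<in>U. \<forall>y\<in>U. norm (\<rho> g x) * norm y \<le> C * norm (\<rho> g y) * norm x)"
proof -
  define d where "d = (LEAST d. \<exists>U. subspace U \<and> U \<subseteq> D \<and> mass U > 0 \<and> dim U = d)"
  have "\<exists>d U. subspace U \<and> U \<subseteq> D \<and> mass U > 0 \<and> dim U = d"
    using subspace_D mass_D by (intro exI[of _ "dim D"] exI[of _ D]) auto
  from LeastI_ex[OF this] obtain U0 where U0: "subspace U0" "U0 \<subseteq> D" "mass U0 > 0" "dim U0 = d"
    by (auto simp: d_def)
  have min: "mass V = 0" if "subspace V" "V \<subseteq> D" "dim V < d" for V
    using not_less_Least[of "dim V" "\<lambda>d. \<exists>U. subspace U \<and> U \<subseteq> D \<and> mass U > 0 \<and> dim U = d"] that mass_nonneg[of V]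
    unfolding d_def[symmetric] by (metis less_eq_real_def)
  define I where "I = {U. subspace U \<and> U \<subseteq> D \<and> mass U = mass U0 \<and> dim U = d}"
  have fin: "finite I"
  proof (rule ccontr)
    assume "infinite I"
    obtain N :: nat where N: "real N * mass U0 > 1" using U0(3) reals_Archimedean3 by blast
    obtain F where F: "finite F" "card F = N" "F \<subseteq> I" using infinite_arbitrarily_large[OF \<open>infinite I\<close>] by blast
    have "real (card F) * mass U0 \<le> 1"
    proof (rule card_mass_le[OF F(1)])
      show "mass (U \<inter> V) = 0" if "U \<in> F" "V \<in> F" "U \<noteq> V" for U V
      proof (rule min)
        have UV: "subspace U" "subspace V" "U \<subseteq> D" "dim U = d" "dim V = d" using that F(3) by (auto simp: I_def)
        then show sub: "subspace (U \<inter> V)" by (intro subspace_inter)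
        show "U \<inter> V \<subseteq> D" using UV by auto
        show "dim (U \<inter> V) < d"
        proof (rule ccontr)
          assume "\<not> dim (U \<inter> V) < d"
          then have "U \<inter> V = U" "U \<inter> V = V"
            using subspace_dim_equal[OF sub UV(1) Int_lower1] subspace_dim_equal[OF sub UV(2) Int_lower2] UV(4,5)
            by (simp_all add: not_less)
          with \<open>U \<noteq> V\<close> show False by simp
        qed
      qed
    qed (use F(3) in \<open>auto simp: I_def\<close>)
    with N F(2) show False by simp
  qed
  have ne: "I \<noteq> {}" using U0 by (auto simp: I_def)
  have nz: "U \<noteq> {0}" if "U \<in> I" for U using that U0(3) mass_0 by (auto simp: I_def)
  have inv: "\<rho> g ` U \<in> I" if "g \<in> G" "U \<in> I" for g U
    using that \<rho>_in_D by (auto simp: I_def mass_\<rho> dim_\<rho>_image linear_subspace_image[OF linear_\<rho>])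
  have conf: "\<exists>C>0. \<forall>g\<in>G. \<rho> g ` U = U \<longrightarrow>
      (\<forall>x\<in>U. \<forall>y\<in>U. norm (\<rho> g x) * norm y \<le> C * norm (\<rho> g y) * norm x)" if "U \<in> I" for U
    using that U0(3) by (intro stabilizer_conformally_bounded) (auto simp: I_def min)
  have sub: "subspace U" "U \<subseteq> D" if "U \<in> I" for U using that by (auto simp: I_def)
  show ?thesis by (rule that[OF fin ne sub nz inv conf])
qed

end

section \<open>Characters of conformally bounded subspaces\<close>

text \<open>The matrix is diagonal in an orthogonal basis that extends one of \<open>U\<close>. The
  formula relates determinants on \<open>U\<close> to powers of a scaling factor.\<close>

lemma det_scale_subspace:
  fixes U :: "(real^'n) set"
  assumes U: "subspace U"
  shows "det (s *\<^sub>R proj_mat U + (mat 1 - proj_mat U)) = s ^ dim U"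
proof -
  obtain b where b: "b \<subseteq> U" "pairwise orthogonal b" "\<And>x. x \<in> b \<Longrightarrow> norm x = 1"
    "independent b" "card b = dim U" "span b = U"
    using orthonormal_basis_subspace[OF U] by metis
  obtain V where V: "V \<inter> insert 0 b = {}" "pairwise orthogonal (b \<union> V)" "span (b \<union> V) = span (b \<union> UNIV)"
    using orthogonal_extension_strong[OF b(2)] by blast
  have "0 \<notin> b \<union> V" using V(1) b(3) by force
  then have ind: "independent (b \<union> V)" using V(2) by (intro pairwise_orthogonal_independent)
  then have fin: "finite (b \<union> V)" by (rule independent_imp_finite)
  have "card (b \<union> V) = dim (b \<union> V)" using ind by (simp add: dim_eq_card_independent)
  also have "\<dots> = dim (span (b \<union> V))" by simp
  also have "\<dots> = CARD('n)" unfolding V(3) by simp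
  finally obtain f :: "'n \<Rightarrow> real^'n" where f: "bij_betw f UNIV (b \<union> V)"
    using fin by (metis finite_same_card_bij finite)
  have f_in: "f j \<in> b \<union> V" for j using f by (auto simp: bij_betw_def)
  have f_orth: "inner (f i) (f j) = 0" if "i \<noteq> j" for i j
    using that f_in V(2) f unfolding bij_betw_def inj_on_def pairwise_def orthogonal_def by (metis UNIV_I)
  define M :: "real^'n^'n" where "M = (\<chi> i j. f j $ i)"
  have M: "M *v axis j 1 = f j" for j
    by (simp add: M_def matrix_vector_mult_basis column_def vec_eq_iff)
  have "\<exists>N. N ** M = mat 1"
    unfolding matrix_left_invertible_independent_columns
  proof (intro allI impI)
    fix c i assume sum0: "(\<Sum>i\<in>UNIV. c i *s column i M) = 0"
    have "column i M = f i" for i by (simp add: M_def column_def vec_eq_iff)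
    with sum0 have "inner (\<Sum>i\<in>UNIV. c i *\<^sub>R f i) (f i) = 0" by (simp add: scalar_mult_eq_scaleR)
    then have "(\<Sum>j\<in>UNIV. c j * inner (f j) (f i)) = 0" by (simp add: inner_sum_left)
    moreover have "(\<Sum>j\<in>UNIV. c j * inner (f j) (f i)) = (\<Sum>j\<in>UNIV. if j = i then c i * inner (f i) (f i) else 0)"
      by (intro sum.cong) (auto simp: f_orth)
    ultimately have "c i * inner (f i) (f i) = 0" by simp
    moreover have "f i \<noteq> 0" using f_in[of i] \<open>0 \<notin> b \<union> V\<close> by metis
    ultimately show "c i = 0" by simp
  qed
  then have detM: "det M \<noteq> 0" using invertible_left_inverse invertible_det_nz by blast
  define d where "d = (\<lambda>j. if f j \<in> b then s else 1)"
  define \<Delta> :: "real^'n^'n" where "\<Delta> = (\<chi> i j. if i = j then d j else 0)"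
  let ?A = "s *\<^sub>R proj_mat U + (mat 1 - proj_mat U)"
  have Af: "?A *v f j = d j *\<^sub>R f j" for j
  proof (cases "f j \<in> b")
    case True
    then have "proj_mat U *v f j = f j" using b U by (intro proj_mat_id) auto
    then show ?thesis using True by (simp add: mv_simps scaleR_matrix_vector_assoc[symmetric] d_def)
  next
    case False
    have "proj_mat U *v f j = 0"
    proof (rule proj_mat_0[OF U])
      fix u assume "u \<in> U"
      then have "u \<in> span b" using b by simp
      moreover have "orthogonal (f j) v" if "v \<in> b" for v
        using V(2) f_in[of j] that False unfolding pairwise_def by (metis UnI1)
      ultimately show "inner (f j) u = 0" using orthogonal_to_span by (metis orthogonal_def)
    qed
    then show ?thesis using False by (simp add: mv_simps scaleR_matrix_vector_assoc[symmetric] d_def)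
  qed
  have "?A ** M = M ** \<Delta>"
  proof -
    have "(?A ** M) *v axis j 1 = (M ** \<Delta>) *v axis j 1" for j
    proof -
      have "\<Delta> *v axis j 1 = d j *\<^sub>R axis j 1"
        unfolding matrix_vector_mult_basis by (auto simp: \<Delta>_def column_def vec_eq_iff axis_def)
      then show ?thesis by (simp add: matrix_vector_mul_assoc[symmetric] M Af matrix_vector_mult_scaleR)
    qed
    then have "column j (?A ** M) = column j (M ** \<Delta>)" for j by (simp add: matrix_vector_mult_basis)
    then show ?thesis by (simp add: column_def vec_eq_iff)
  qed
  then have "det ?A * det M = det M * det \<Delta>" by (metis det_mul)
  then have "det ?A = det \<Delta>" using detM by simp
  also have "\<dots> = (\<Prod>j\<in>UNIV. d j)" by (subst det_diagonal) (auto simp: \<Delta>_def)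
  also have "\<dots> = s ^ card {j. f j \<in> b}" unfolding d_def by (simp add: prod.If_cases)
  also have "card {j. f j \<in> b} = card b"
  proof -
    have "bij_betw f {j. f j \<in> b} b" using f unfolding bij_betw_def
      by (auto simp: inj_on_def)
    then show ?thesis by (rule bij_betw_same_card)
  qed
  finally show ?thesis by (simp add: b(5))
qed

lemma abs_det_bounded:
  obtains K where "K > 0" "\<And>A :: real^'n^'n. norm A \<le> r \<Longrightarrow> \<bar>det A\<bar> \<le> K"
proof -
  have "continuous_on (cball 0 r) (det :: real^'n^'n \<Rightarrow> real)"
    unfolding det_def by (intro continuous_intros)
  then have "compact (det ` cball (0 :: real^'n^'n) r)" by (intro compact_continuous_image) auto
  then obtain K where "\<And>x. x \<in> det ` cball (0 :: real^'n^'n) r \<Longrightarrow> norm x \<le> K"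
    using compact_imp_bounded bounded_iff by metis
  then have "\<bar>det A\<bar> \<le> \<bar>K\<bar> + 1" if "norm A \<le> r" for A :: "real^'n^'n"
    using that by (force simp: dist_norm)
  then show ?thesis by (intro that[of "\<bar>K\<bar> + 1"]) auto
qed

section \<open>Inverses, powers and homomorphisms into the reals\<close>

context matrix_group
begin

lemma matrix_inv_mem: "g \<in> G \<Longrightarrow> matrix_inv g \<in> G"
  and matrix_inv_right: "g \<in> G \<Longrightarrow> g ** matrix_inv g = mat 1"
  and matrix_inv_left: "g \<in> G \<Longrightarrow> matrix_inv g ** g = mat 1"
proof -
  assume g: "g \<in> G"
  obtain h where h: "h \<in> G" "g ** h = mat 1" "h ** g = mat 1" using ex_inverse[OF g] by blast
  then have "\<exists>h. g ** h = mat 1 \<and> h ** g = mat 1" by blast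
  from someI_ex[OF this] show 1: "g ** matrix_inv g = mat 1" and 2: "matrix_inv g ** g = mat 1"
    unfolding matrix_inv_def by auto
  have "matrix_inv g = h"
    using h(3) 1 by (metis matrix_mul_assoc matrix_mul_lid matrix_mul_rid)
  with h show "matrix_inv g \<in> G" by simp
qed

lemma matrix_inv_unique: "g \<in> G \<Longrightarrow> g ** h = mat 1 \<Longrightarrow> h = matrix_inv g"
  by (metis matrix_inv_left matrix_mul_assoc matrix_mul_lid matrix_mul_rid)

end

primrec mat_power :: "real^'n^'n \<Rightarrow> nat \<Rightarrow> real^'n^'n"
  where "mat_power g 0 = mat 1" | "mat_power g (Suc k) = g ** mat_power g k"

lemma (in matrix_group) mat_power_mem: "g \<in> G \<Longrightarrow> mat_power g k \<in> G"
  by (induction k) (auto intro: one_mem mult_mem)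

lemma (in matrix_group) mat_power_inverse: "g \<in> G \<Longrightarrow> mat_power (matrix_inv g) k ** mat_power g k = mat 1"
proof (induction k)
  case (Suc k)
  have comm: "mat_power h k ** h = h ** mat_power h k" for h :: "real^'n^'n"
    by (induction k) (simp_all add: matrix_mul_assoc[symmetric])
  have "mat_power (matrix_inv g) (Suc k) ** mat_power g (Suc k)
    = mat_power (matrix_inv g) k ** (matrix_inv g ** g) ** mat_power g k"
    by (simp add: comm[of "matrix_inv g", symmetric] matrix_mul_assoc)
  then show ?case using Suc by (simp add: matrix_inv_left)
qed simp

text \<open>The value at a power is a multiple of the value at the element, so no value is positive;
  the value at the inverse is the opposite one.\<close>

lemma (in matrix_group) hom_bounded_above_zero:
  assumes hom: "\<And>g h. g \<in> G \<Longrightarrow> h \<in> G \<Longrightarrow> \<psi> (g ** h) = \<psi> g + (\<psi> h :: real)"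
    and bdd: "\<And>g. g \<in> G \<Longrightarrow> \<psi> g \<le> K" and g: "g \<in> G"
  shows "\<psi> g = 0"
proof -
  have one: "\<psi> (mat 1) = 0" using hom[OF one_mem one_mem] by simp
  have pow: "\<psi> (mat_power h k) = k * \<psi> h" if "h \<in> G" for h k
    by (induction k) (auto simp: one hom that mat_power_mem algebra_simps)
  have le: "\<psi> h \<le> 0" if "h \<in> G" for h
  proof (rule ccontr)
    assume "\<not> \<psi> h \<le> 0"
    then have "\<psi> h > 0" by simp
    from reals_Archimedean3[OF this] obtain k :: nat where "K < k * \<psi> h" by blast
    with bdd[OF mat_power_mem[OF that, of k]] show False by (simp add: pow that)
  qed
  have "\<psi> g + \<psi> (matrix_inv g) = 0" using hom[OF g matrix_inv_mem[OF g]] one matrix_inv_right[OF g] by simp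
  with le[OF g] le[OF matrix_inv_mem[OF g]] show ?thesis by simp
qed

text \<open>From here the mean acts only through the family it produced: finite, permuted by the
  group, and with stabilizers of bounded distortion.\<close>

locale conformal_family = matrix_group_quotient G B for G :: "(real^'n^'n) set" and B +
  fixes I :: "(real^'n) set set"
  assumes fin_I: "finite I" and I_ne: "I \<noteq> {}"
    and sub_I: "\<And>U. U \<in> I \<Longrightarrow> subspace U" and I_D: "\<And>U. U \<in> I \<Longrightarrow> U \<subseteq> D" and I_nz: "\<And>U. U \<in> I \<Longrightarrow> U \<noteq> {0}"
    and I_inv: "\<And>g U. g \<in> G \<Longrightarrow> U \<in> I \<Longrightarrow> \<rho> g ` U \<in> I"
    and I_conf: "\<And>U. U \<in> I \<Longrightarrow> \<exists>C>0. \<forall>g\<in>G. \<rho> g ` U = U \<longrightarrow>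
      (\<forall>x\<in>U. \<forall>y\<in>U. norm (\<rho> g x) * norm y \<le> C * norm (\<rho> g y) * norm x)"
begin

text \<open>The kernel of the permutation action on the finite family, thus normal and of finite
  index.\<close>

definition G0 where "G0 = {g\<in>G. \<forall>U\<in>I. \<rho> g ` U = U}"

lemma G0_G: "g \<in> G0 \<Longrightarrow> g \<in> G" by (simp add: G0_def)

lemma \<rho>_mult_image: "g \<in> G \<Longrightarrow> \<rho> (g ** h) ` U = \<rho> g ` \<rho> h ` U"
  by (simp add: image_image \<rho>_mult)

lemma \<rho>_inv_image: "g \<in> G \<Longrightarrow> U \<subseteq> D \<Longrightarrow> \<rho> (matrix_inv g) ` \<rho> g ` U = U"
  "g \<in> G \<Longrightarrow> U \<subseteq> D \<Longrightarrow> \<rho> g ` \<rho> (matrix_inv g) ` U = U"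
  by (force simp: image_image intro!: image_cong[where g="\<lambda>x. x", simplified] \<rho>_inverse matrix_inv_left matrix_inv_right matrix_inv_mem)+

sublocale G0: matrix_group G0
proof
  show "mat 1 \<in> G0" using one_mem I_D by (force simp: G0_def \<rho>_one subset_iff image_iff)
  show "g ** h \<in> G0" if "g \<in> G0" "h \<in> G0" for g h
    using that by (auto simp: G0_def mult_mem \<rho>_mult_image)
  show "\<exists>h\<in>G0. g ** h = mat 1 \<and> h ** g = mat 1" if g: "g \<in> G0" for g
  proof (intro bexI[of _ "matrix_inv g"] conjI)
    have "\<rho> (matrix_inv g) ` U = U" if "U \<in> I" for U
      using \<rho>_inv_image(1)[OF G0_G[OF g] I_D[OF that]] g that by (simp add: G0_def)
    then show "matrix_inv g \<in> G0" using g by (auto simp: G0_def matrix_inv_mem)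
  qed (use g in \<open>auto simp: G0_def matrix_inv_left matrix_inv_right\<close>)
qed

lemma conj_mem: "\<gamma> \<in> G \<Longrightarrow> g \<in> G0 \<Longrightarrow> \<gamma> ** g ** matrix_inv \<gamma> \<in> G0"
proof -
  assume \<gamma>: "\<gamma> \<in> G" and g: "g \<in> G0"
  have "\<rho> (\<gamma> ** g ** matrix_inv \<gamma>) ` U = U" if U: "U \<in> I" for U
  proof -
    have "\<rho> (\<gamma> ** g ** matrix_inv \<gamma>) ` U = \<rho> \<gamma> ` \<rho> g ` \<rho> (matrix_inv \<gamma>) ` U"
      using \<gamma> G0_G[OF g] by (simp add: \<rho>_mult_image mult_mem matrix_inv_mem matrix_mul_assoc[symmetric])
    also have "\<rho> g ` \<rho> (matrix_inv \<gamma>) ` U = \<rho> (matrix_inv \<gamma>) ` U"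
      using g I_inv[OF matrix_inv_mem[OF \<gamma>] U] by (simp add: G0_def)
    also have "\<rho> \<gamma> ` \<rho> (matrix_inv \<gamma>) ` U = U" using \<rho>_inv_image(2)[OF \<gamma> I_D[OF U]] .
    finally show ?thesis .
  qed
  then show ?thesis using \<gamma> G0_G[OF g] by (simp add: G0_def mult_mem matrix_inv_mem)
qed

text \<open>Up to a bounded error the logarithm of the factor by which \<open>g\<close> scales
  lengths on \<open>U\<close>. Taking it from the determinant of \<open>\<rho> g\<close> on
  \<open>U\<close>, completed by the identity on the orthogonal complement, makes it an exact
  homomorphism. Owing to the value 0 outside \<open>G0\<close>, characters that agree on
  \<open>G0\<close> are equal as functions.\<close>

definition chr :: "(real^'n) set \<Rightarrow> real^'n^'n \<Rightarrow> real"
  where "chr U g = (if g \<in> G0 then ln \<bar>det (Q ** g ** proj_mat U + (mat 1 - proj_mat U))\<bar> / dim U else 0)"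

context
  fixes U assumes U: "U \<in> I"
begin

private definition EU :: "real^'n^'n \<Rightarrow> real^'n^'n" where "EU g = Q ** g ** proj_mat U + (mat 1 - proj_mat U)"

private lemma EU: "EU g *v x = \<rho> g (proj_mat U *v x) + (x - proj_mat U *v x)"
  by (simp add: EU_def \<rho>_def mv_simps)

private lemma \<rho>_U: "g \<in> G0 \<Longrightarrow> u \<in> U \<Longrightarrow> \<rho> g u \<in> U"
  using U by (auto simp: G0_def)

private lemma EU_mult: "g \<in> G0 \<Longrightarrow> h \<in> G0 \<Longrightarrow> EU (g ** h) = EU g ** EU h"
  unfolding matrix_eq
  by (auto simp: EU matrix_vector_mul_assoc[symmetric] \<rho>_mult G0_G mv_simps proj_mat_id sub_I[OF U] proj_mat_in \<rho>_U)

private lemma EU_det_nz: "g \<in> G0 \<Longrightarrow> det (EU g) \<noteq> 0"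
proof -
  assume g: "g \<in> G0"
  have "EU (mat 1) = mat 1" unfolding matrix_eq
    using \<rho>_one I_D[OF U] proj_mat_in[OF sub_I[OF U]] by (auto simp: EU subset_iff)
  then have "EU g ** EU (matrix_inv g) = mat 1"
    using g by (simp add: EU_mult[symmetric] G0.matrix_inv_mem G0.matrix_inv_right)
  then have "det (EU g) * det (EU (matrix_inv g)) = 1" by (metis det_mul det_I)
  then show ?thesis by auto
qed

lemma chr_mult: "g \<in> G0 \<Longrightarrow> h \<in> G0 \<Longrightarrow> chr U (g ** h) = chr U g + chr U h"
  using EU_det_nz[of g] EU_det_nz[of h]
  by (simp add: chr_def G0.mult_mem EU_def[symmetric] EU_mult det_mul abs_mult ln_mult add_divide_distrib)

lemma dim_pos: "dim U > 0"
  using I_nz[OF U] subspace_0[OF sub_I[OF U]] by (auto simp: gr0_conv_Suc[symmetric] intro!: gr0I)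

text \<open>Bounded distortion makes \<open>\<rho> g\<close> on \<open>U\<close> the product of a
  scale \<open>s\<close> and a map with bounded inverse. The determinant of that inverse is bounded,
  so \<open>s ^ dim U\<close> is at most a constant times the determinant of \<open>\<rho> g\<close>
  on \<open>U\<close> in absolute value, which bounds \<open>s\<close> by a constant times
  \<open>exp (chr U g)\<close>.\<close>

lemma chr_upper: "\<exists>C>0. \<forall>g\<in>G0. \<forall>u\<in>U. norm (\<rho> g u) \<le> C * exp (chr U g) * norm u"
proof -
  obtain C where C: "C > 0" and C': "\<forall>g\<in>G. \<rho> g ` U = U \<longrightarrow>
      (\<forall>x\<in>U. \<forall>y\<in>U. norm (\<rho> g x) * norm y \<le> C * norm (\<rho> g y) * norm x)"
    using I_conf[OF U] by (elim exE conjE)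
  have conf: "norm (\<rho> g x) * norm y \<le> C * norm (\<rho> g y) * norm x" if "g \<in> G0" "x \<in> U" "y \<in> U" for g x y
  proof -
    have "g \<in> G" "\<rho> g ` U = U" using that(1) U by (simp_all add: G0_def)
    then show ?thesis using C' that by simp
  qed
  obtain u1 where u1: "u1 \<in> U" "u1 \<noteq> 0" using I_nz[OF U] subspace_0[OF sub_I[OF U]] by blast
  define u0 where "u0 = (1 / norm u1) *\<^sub>R u1"
  have u0: "u0 \<in> U" "norm u0 = 1" using u1 sub_I[OF U] by (auto simp: u0_def subspace_mul)
  obtain K where K: "K > 0" "\<And>A :: real^'n^'n. norm A \<le> real CARD('n) * (C + 1) \<Longrightarrow> \<bar>det A\<bar> \<le> K"
    using abs_det_bounded by blast
  define d where "d = dim U"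
  have d: "d > 0" using dim_pos by (simp add: d_def)
  have "norm (\<rho> g u) \<le> C * exp (ln K / d) * exp (chr U g) * norm u" if g: "g \<in> G0" and u: "u \<in> U" for g u
  proof -
    define s where "s = norm (\<rho> g u0)"
    let ?h = "matrix_inv g"
    have h: "?h \<in> G0" using g by (rule G0.matrix_inv_mem)
    have inv: "\<rho> g (\<rho> ?h v) = v" "\<rho> ?h (\<rho> g v) = v" if "v \<in> U" for v
      using \<rho>_inverse G0_G[OF g] G0_G[OF h] I_D[OF U] that matrix_inv_left matrix_inv_right by (auto simp: subset_iff)
    have "s \<noteq> 0"
    proof
      assume "s = 0"
      then have "u0 = 0" using inv(2)[OF u0(1)] linear_0[OF linear_\<rho>] by (simp add: s_def)
      with u0 show False by simp
    qed
    then have s: "s > 0" by (simp add: s_def)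
    have lower: "s * norm (\<rho> ?h v) \<le> C * norm v" if "v \<in> U" for v
      using conf[OF g u0(1) \<rho>_U[OF h that]] inv(1)[OF that] u0(2) by (simp add: s_def)
    \<comment> \<open>The rescaled inverse on \<open>U\<close> and the identity on the complement;
      its norm is bounded independently of \<open>g\<close>.\<close>
    define F where "F = s *\<^sub>R (Q ** ?h ** proj_mat U) + (mat 1 - proj_mat U)"
    have "F = EU ?h ** (s *\<^sub>R proj_mat U + (mat 1 - proj_mat U))"
      unfolding matrix_eq
      by (simp add: F_def EU matrix_vector_mul_assoc[symmetric] mv_simps scaleR_matrix_vector_assoc[symmetric]
          proj_mat_id sub_I[OF U] proj_mat_in linear_scale[OF linear_\<rho>] linear_diff[OF linear_\<rho>] linear_add[OF linear_\<rho>])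
        (simp add: \<rho>_def)
    then have detF: "det F = det (EU ?h) * s ^ d"
      by (simp add: det_mul det_scale_subspace sub_I[OF U] d_def)
    have "norm F \<le> real CARD('n) * (C + 1)"
    proof (rule norm_matrix_le)
      fix x
      let ?p = "proj_mat U *v x"
      have "F *v x = s *\<^sub>R \<rho> ?h ?p + (x - ?p)"
        by (simp add: F_def \<rho>_def mv_simps scaleR_matrix_vector_assoc[symmetric])
      also have "norm \<dots> \<le> s * norm (\<rho> ?h ?p) + norm (x - ?p)"
        using norm_triangle_ineq[of "s *\<^sub>R \<rho> ?h ?p" "x - ?p"] s by simp
      also have "\<dots> \<le> C * norm ?p + norm x"
        using lower[OF proj_mat_in[OF sub_I[OF U]]] norm_proj_mat_compl_le[OF sub_I[OF U]] by (intro add_mono)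
      also have "\<dots> \<le> (C + 1) * norm x"
        using norm_proj_mat_le[OF sub_I[OF U], of x] C by (simp add: algebra_simps)
      finally show "norm (F *v x) \<le> (C + 1) * norm x" .
    qed
    then have le: "\<bar>det (EU ?h)\<bar> * s ^ d \<le> K" using K(2)[of F] s by (simp add: detF abs_mult)
    have chrh: "chr U ?h = - chr U g"
      using chr_mult[OF g h] chr_mult[OF G0.one_mem G0.one_mem] by (simp add: G0.matrix_inv_right g)
    have "ln (\<bar>det (EU ?h)\<bar> * s ^ d) \<le> ln K"
      using le s EU_det_nz[OF h] K(1) by (intro ln_mono) auto
    moreover have "ln (\<bar>det (EU ?h)\<bar> * s ^ d) = d * chr U ?h + d * ln s"
      using s EU_det_nz[OF h] d h by (simp add: ln_mult ln_realpow chr_def EU_def[symmetric] d_def[symmetric])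
    ultimately have "d * ln s \<le> ln K + d * chr U g" by (simp add: chrh)
    then have "ln s \<le> ln K / d + chr U g" using d by (simp add: field_simps)
    then have "s \<le> exp (ln K / d + chr U g)" using s by (simp add: ln_ge_iff[symmetric] flip: ln_le_cancel_iff)
    then have s_le: "s \<le> exp (ln K / d) * exp (chr U g)" by (simp add: exp_add)
    have "norm (\<rho> g u) \<le> C * s * norm u" using conf[OF g u u0(1)] u0(2) by (simp add: s_def)
    also have "\<dots> \<le> C * (exp (ln K / d) * exp (chr U g)) * norm u"
      using s_le C by (intro mult_right_mono mult_left_mono) auto
    finally show ?thesis by (simp add: mult.assoc)
  qed
  moreover have "C * exp (ln K / d) > 0" using C by simp
  ultimately show ?thesis by blast
qed

end

lemma chr_one: "U \<in> I \<Longrightarrow> chr U (mat 1) = 0"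
  using chr_mult[OF _ G0.one_mem G0.one_mem] by simp

lemma chr_inv: "U \<in> I \<Longrightarrow> g \<in> G0 \<Longrightarrow> chr U (matrix_inv g) = - chr U g"
  using chr_mult[of U g "matrix_inv g"] by (simp add: G0.matrix_inv_mem G0.matrix_inv_right chr_one)

lemma chr_power: "U \<in> I \<Longrightarrow> g \<in> G0 \<Longrightarrow> chr U (mat_power g k) = k * chr U g"
  by (induction k) (auto simp: chr_one chr_mult G0.mat_power_mem algebra_simps)

text \<open>Conjugation by \<gamma> changes norms by at most the factors
  \<open>norm \<gamma>\<close> and \<open>norm (matrix_inv \<gamma>)\<close>, so the difference of
  the two characters is bounded above on \<open>G0\<close>; being a homomorphism, it
  vanishes.\<close>

lemma chr_conj:
  assumes \<gamma>: "\<gamma> \<in> G" and U: "U \<in> I" and g: "g \<in> G0"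
  shows "chr (\<rho> \<gamma> ` U) (\<gamma> ** g ** matrix_inv \<gamma>) = chr U g"
proof -
  let ?c = "\<lambda>g. \<gamma> ** g ** matrix_inv \<gamma>"
  let ?V = "\<rho> \<gamma> ` U"
  have V: "?V \<in> I" using I_inv[OF \<gamma> U] .
  have c_mult: "?c (g ** h) = ?c g ** ?c h" for g h
  proof -
    have "?c g ** ?c h = \<gamma> ** g ** (matrix_inv \<gamma> ** \<gamma>) ** h ** matrix_inv \<gamma>"
      by (simp only: matrix_mul_assoc)
    then show ?thesis by (simp add: matrix_inv_left[OF \<gamma>] matrix_mul_assoc)
  qed
  define \<psi> where "\<psi> = (\<lambda>g. chr U g - chr ?V (?c g))"
  obtain C1 where C1: "C1 > 0" "\<And>g u. g \<in> G0 \<Longrightarrow> u \<in> U \<Longrightarrow> norm (\<rho> g u) \<le> C1 * exp (chr U g) * norm u"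
    using chr_upper[OF U] by blast
  obtain C2 where C2: "C2 > 0" "\<And>g u. g \<in> G0 \<Longrightarrow> u \<in> ?V \<Longrightarrow> norm (\<rho> g u) \<le> C2 * exp (chr ?V g) * norm u"
    using chr_upper[OF V] by blast
  obtain u where u: "u \<in> U" "u \<noteq> 0" using I_nz[OF U] subspace_0[OF sub_I[OF U]] by blast
  define N where "N = C1 * (norm (matrix_inv \<gamma>) * (C2 * norm \<gamma>))"
  have "\<psi> g \<le> ln N" if g: "g \<in> G0" for g
  proof -
    let ?h = "matrix_inv g" and ?i = "matrix_inv \<gamma>"
    have uD: "u \<in> D" using u I_D[OF U] by auto
    have h: "?h \<in> G0" using g by (rule G0.matrix_inv_mem)
    have gu: "\<rho> g u \<in> U" using g U u by (auto simp: G0_def)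
    have "u = \<rho> ?h (\<rho> g u)" using \<rho>_inverse[OF G0_G[OF h] _ uD] matrix_inv_left G0_G[OF g] by simp
    then have "norm u \<le> C1 * exp (chr U ?h) * norm (\<rho> g u)" using C1(2)[OF h gu] by simp
    also have "\<rho> g u = \<rho> ?i (\<rho> (?c g) (\<rho> \<gamma> u))"
    proof -
      have "\<rho> ?i (\<rho> (?c g) (\<rho> \<gamma> u)) = \<rho> (?i ** (?c g ** \<gamma>)) u"
        using \<gamma> G0_G[OF g] by (simp add: \<rho>_mult mult_mem matrix_inv_mem)
      also have "?i ** (?c g ** \<gamma>) = (?i ** \<gamma>) ** g ** (?i ** \<gamma>)" by (simp only: matrix_mul_assoc)
      also have "\<dots> = g" by (simp add: matrix_inv_left[OF \<gamma>])
      finally show ?thesis by simp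
    qed
    also have "norm \<dots> \<le> norm ?i * (C2 * exp (chr ?V (?c g)) * norm (\<rho> \<gamma> u))"
      by (rule order_trans[OF norm_\<rho>_le mult_left_mono[OF C2(2)]]) (use u conj_mem[OF \<gamma> g] in auto)
    also have "\<dots> \<le> norm ?i * (C2 * exp (chr ?V (?c g)) * (norm \<gamma> * norm u))"
      using C2(1) by (intro mult_left_mono norm_\<rho>_le) auto
    finally have "norm u \<le> C1 * exp (chr U ?h) * (norm ?i * (C2 * exp (chr ?V (?c g)) * (norm \<gamma> * norm u)))"
      using C1(1) by (simp add: mult_left_mono)
    also have "\<dots> = N * exp (- \<psi> g) * norm u"
      by (simp add: N_def \<psi>_def chr_inv[OF U g] exp_diff exp_minus field_simps)
    finally have 1: "1 \<le> N * exp (- \<psi> g)" using u by simp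
    then have "exp (\<psi> g) \<le> N" by (simp add: exp_minus field_simps)
    then show ?thesis by (metis exp_gt_zero ln_exp ln_le_cancel_iff order_less_le_trans)
  qed
  moreover have "\<psi> (g ** h) = \<psi> g + \<psi> h" if "g \<in> G0" "h \<in> G0" for g h
    using that conj_mem[OF \<gamma>] by (simp add: \<psi>_def c_mult chr_mult[OF U] chr_mult[OF V])
  ultimately have "\<psi> g = 0" using G0.hom_bounded_above_zero[of \<psi> "ln N"] g by blast
  then show ?thesis by (simp add: \<psi>_def)
qed

lemma \<rho>_power_inverse: "g \<in> G0 \<Longrightarrow> x \<in> D \<Longrightarrow> \<rho> (mat_power (matrix_inv g) k) (\<rho> (mat_power g k) x) = x"
  by (intro \<rho>_inverse G0_G G0.mat_power_mem G0.matrix_inv_mem G0.mat_power_inverse)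

text \<open>
  Subspaces with distinct characters are independent: separate two characters by an element \<open>g\<close>, divide a
  relation by the fastest growth rate under the powers of \<open>g\<close>, and let the exponent tend to infinity.
\<close>

lemma distinct_characters_independent:
  assumes "F \<subseteq> I" and "\<And>U V. U \<in> F \<Longrightarrow> V \<in> F \<Longrightarrow> chr U = chr V \<Longrightarrow> U = V"
    and "\<And>U. U \<in> F \<Longrightarrow> w U \<in> U" and "(\<Sum>U\<in>F. w U) = 0"
  shows "\<forall>U\<in>F. w U = 0"
proof -
  have "finite F" using assms(1) fin_I finite_subset by blast
  then show ?thesis using assms
  proof (induction F arbitrary: w rule: finite_psubset_induct)
    case (psubset F)
    show ?case
    proof (cases "\<exists>U V. U \<in> F \<and> V \<in> F \<and> U \<noteq> V")
      case False
      then have "F = {} \<or> (\<exists>U. F = {U})" by blast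
      then show ?thesis using psubset.prems(4) by auto
    next
      case True
      then obtain U V where UV: "U \<in> F" "V \<in> F" "U \<noteq> V" by blast
      with psubset.prems(2) have "chr U \<noteq> chr V" by blast
      then obtain g where g: "chr U g \<noteq> chr V g" by auto
      then have gG0: "g \<in> G0" by (metis chr_def)
      \<comment> \<open>The fastest growth rate. As \<open>g\<close> distinguishes \<open>U\<close>
        from \<open>V\<close>, the members growing at this rate do not exhaust \<open>F\<close>; nor
        do the others, the maximum being attained.\<close>
      define M where "M = Max ((\<lambda>W. chr W g) ` F)"
      have M: "chr W g \<le> M" if "W \<in> F" for W using that psubset.hyps by (simp add: M_def)
      have "M \<in> (\<lambda>W. chr W g) ` F" unfolding M_def using psubset.hyps UV by (intro Max_in) auto
      then obtain W0 where W0: "W0 \<in> F" "chr W0 g = M" by auto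
      define F1 where "F1 = {W\<in>F. chr W g = M}"
      define F2 where "F2 = {W\<in>F. chr W g \<noteq> M}"
      have F12: "F = F1 \<union> F2" "F1 \<inter> F2 = {}" by (auto simp: F1_def F2_def)
      have fin12: "finite F1" "finite F2" using psubset.hyps by (auto simp: F1_def F2_def)
      have "\<not> (U \<in> F1 \<and> V \<in> F1)" using g by (auto simp: F1_def)
      moreover have "F1 \<subseteq> F" by (auto simp: F1_def)
      ultimately have "F1 \<subset> F" using UV by blast
      have "F2 \<subset> F" using W0 by (auto simp: F2_def)
      define v where "v = (\<Sum>W\<in>F1. w W)"
      define z where "z = (\<Sum>W\<in>F2. w W)"
      have vz: "v + z = 0" using psubset.prems(4) F12 fin12 by (simp add: v_def z_def sum.union_disjoint)
      have FI: "W \<in> I" if "W \<in> F" for W using psubset.prems(1) that by auto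
      define C where "C = (\<lambda>W. SOME C. C > 0 \<and> (\<forall>g\<in>G0. \<forall>u\<in>W. norm (\<rho> g u) \<le> C * exp (chr W g) * norm u))"
      have C: "C W > 0 \<and> (\<forall>g\<in>G0. \<forall>u\<in>W. norm (\<rho> g u) \<le> C W * exp (chr W g) * norm u)" if "W \<in> I" for W
        unfolding C_def using chr_upper[OF that] by (rule someI_ex[unfolded Bex_def])
      let ?h = "matrix_inv g"
      have h: "?h \<in> G0" using gG0 by (rule G0.matrix_inv_mem)
      \<comment> \<open>Powers of the inverse, rescaled to compensate the rate \<open>M\<close>;
        \<open>chr_upper\<close> bounds them on every member of \<open>F1\<close>, hence on the
        span.\<close>
      define \<T> where "\<T> = range (\<lambda>k. exp (k * M) *\<^sub>R (Q ** mat_power ?h k))"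
      have "\<exists>D. \<forall>T\<in>\<T>. norm (T *v x) \<le> D" if "x \<in> \<Union>F1" for x
      proof -
        from that obtain W where W: "W \<in> F1" "x \<in> W" by auto
        then have WI: "W \<in> I" using FI by (auto simp: F1_def)
        have "norm ((exp (k * M) *\<^sub>R (Q ** mat_power ?h k)) *v x) \<le> C W * norm x" for k :: nat
        proof -
          have "norm (\<rho> (mat_power ?h k) x) \<le> C W * exp (chr W (mat_power ?h k)) * norm x"
            using C[OF WI] W(2) G0.mat_power_mem[OF h] by blast
          also have "chr W (mat_power ?h k) = - (k * M)"
            using WI W h gG0 by (simp add: chr_power chr_inv F1_def)
          finally have "exp (k * M) * norm (\<rho> (mat_power ?h k) x) \<le> exp (k * M) * (C W * exp (- (k * M)) * norm x)"
            by (intro mult_left_mono) auto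
          also have "\<dots> = C W * norm x" by (simp add: exp_minus field_simps)
          finally show ?thesis
            by (simp add: scaleR_matrix_vector_assoc[symmetric] \<rho>_def matrix_vector_mul_assoc)
        qed
        then show ?thesis by (auto simp: \<T>_def)
      qed
      then obtain K where K: "K > 0" "\<forall>T\<in>\<T>. \<forall>x\<in>span (\<Union>F1). norm (T *v x) \<le> K * norm x"
        using bounded_on_span[of "\<Union>F1" \<T>] by blast
      have wW: "w W \<in> W" if "W \<in> F" for W using psubset.prems(3) that .
      have vD: "v \<in> D" unfolding v_def using wW I_D FI by (intro subspace_sum subspace_D) (auto simp: F1_def)
      \<comment> \<open>Moving \<open>v\<close> forward by the k-th power of \<open>g\<close> and
        back again costs a constant times \<open>exp (- (k * M))\<close>. The forward image is also
        that of \<open>- z\<close>, whose parts grow at smaller rates.\<close>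
      have le: "norm v \<le> K * (\<Sum>W\<in>F2. C W * norm (w W) * exp (chr W g - M) ^ k)" for k
      proof -
        have "\<rho> (mat_power g k) v = (\<Sum>W\<in>F1. \<rho> (mat_power g k) (w W))"
          by (simp add: v_def linear_sum[OF linear_\<rho>])
        also have "\<dots> \<in> span (\<Union>F1)"
        proof (intro span_sum span_base UnionI)
          fix W assume W: "W \<in> F1"
          have "\<rho> (mat_power g k) ` W = W"
            using G0.mat_power_mem[OF gG0, of k] FI W by (auto simp: G0_def F1_def)
          then show "\<rho> (mat_power g k) (w W) \<in> W" using wW W by (auto simp: F1_def)
        qed
        finally have "norm ((exp (k * M) *\<^sub>R (Q ** mat_power ?h k)) *v \<rho> (mat_power g k) v) \<le> K * norm (\<rho> (mat_power g k) v)"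
          using K(2) by (auto simp: \<T>_def)
        moreover have "(Q ** mat_power ?h k) *v \<rho> (mat_power g k) v = v"
          using \<rho>_power_inverse[OF gG0 vD, of k] by (simp add: \<rho>_def[of "mat_power ?h k"] matrix_vector_mul_assoc)
        ultimately have "exp (k * M) * norm v \<le> K * norm (\<rho> (mat_power g k) v)"
          by (simp add: scaleR_matrix_vector_assoc[symmetric])
        also have "v = - z" using vz by (simp add: eq_neg_iff_add_eq_0)
        also have "norm (\<rho> (mat_power g k) (- z)) = norm (\<Sum>W\<in>F2. \<rho> (mat_power g k) (w W))"
          by (simp add: z_def linear_neg[OF linear_\<rho>] linear_sum[OF linear_\<rho>])
        also have "\<dots> \<le> (\<Sum>W\<in>F2. C W * exp (k * chr W g) * norm (w W))"
        proof (rule sum_norm_le)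
          fix W assume W: "W \<in> F2"
          then have WI: "W \<in> I" using FI by (auto simp: F2_def)
          show "norm (\<rho> (mat_power g k) (w W)) \<le> C W * exp (k * chr W g) * norm (w W)"
            using C[OF WI] wW[of W] W G0.mat_power_mem[OF gG0, of k] chr_power[OF WI gG0, of k] by (auto simp: F2_def)
        qed
        finally have "exp (k * M) * norm v \<le> K * (\<Sum>W\<in>F2. C W * exp (k * chr W g) * norm (w W))"
          using K(1) \<open>v = - z\<close> by simp
        then have "norm v \<le> exp (- (k * M)) * (K * (\<Sum>W\<in>F2. C W * exp (k * chr W g) * norm (w W)))"
          by (simp add: exp_minus field_simps)
        also have "\<dots> = K * (\<Sum>W\<in>F2. exp (- (k * M)) * (C W * exp (k * chr W g) * norm (w W)))"
          by (simp only: sum_distrib_left mult.left_commute)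
        also have "(\<Sum>W\<in>F2. exp (- (k * M)) * (C W * exp (k * chr W g) * norm (w W)))
            = (\<Sum>W\<in>F2. C W * norm (w W) * exp (chr W g - M) ^ k)"
        proof (rule sum.cong[OF refl])
          fix W
          have "exp (chr W g - M) ^ k = exp (- (k * M)) * exp (k * chr W g)"
            by (simp add: exp_of_nat_mult[symmetric] exp_add[symmetric] algebra_simps)
          then show "exp (- (k * M)) * (C W * exp (k * chr W g) * norm (w W)) = C W * norm (w W) * exp (chr W g - M) ^ k"
            by simp
        qed
        finally show ?thesis .
      qed
      have "(\<lambda>k. K * (\<Sum>W\<in>F2. C W * norm (w W) * exp (chr W g - M) ^ k)) \<longlonglongrightarrow> K * (\<Sum>W\<in>F2. C W * norm (w W) * 0)"
      proof (intro tendsto_mult tendsto_sum tendsto_const LIMSEQ_realpow_zero)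
        fix W assume "W \<in> F2"
        then have "chr W g < M" using M[of W] by (auto simp: F2_def)
        then show "exp (chr W g - M) < 1" by simp
      qed auto
      then have "norm v \<le> K * (\<Sum>W\<in>F2. C W * norm (w W) * 0)" using le by (intro LIMSEQ_le_const) auto
      then have "v = 0" by simp
      with vz have "z = 0" by simp
      have "\<forall>W\<in>F1. w W = 0"
        using psubset.IH[OF \<open>F1 \<subset> F\<close>, of w] psubset.prems \<open>v = 0\<close> by (auto simp: v_def F1_def)
      moreover have "\<forall>W\<in>F2. w W = 0"
        using psubset.IH[OF \<open>F2 \<subset> F\<close>, of w] psubset.prems \<open>z = 0\<close> by (auto simp: z_def F2_def)
      ultimately show ?thesis using F12 by auto
    qed
  qed
qed

text \<open>One member is picked for each character and a nonzero vector in each; these vectors are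
  independent by \<open>distinct_characters_independent\<close>.\<close>

lemma card_characters: "card (chr ` I) \<le> CARD('n)"
proof -
  define r where "r = (\<lambda>c. SOME U. U \<in> I \<and> chr U = c)"
  have r: "r c \<in> I" "chr (r c) = c" if "c \<in> chr ` I" for c
    using that someI_ex[of "\<lambda>U. U \<in> I \<and> chr U = c"] by (auto simp: r_def)
  define F where "F = r ` chr ` I"
  have FI: "F \<subseteq> I" using r by (auto simp: F_def)
  have F_inj: "U = V" if "U \<in> F" "V \<in> F" "chr U = chr V" for U V
    using that r by (auto simp: F_def)
  have "\<forall>U\<in>I. \<exists>u\<in>U. u \<noteq> 0" using I_nz sub_I subspace_0 by blast
  then obtain u where u: "\<And>U. U \<in> I \<Longrightarrow> u U \<in> U" "\<And>U. U \<in> I \<Longrightarrow> u U \<noteq> 0" by metis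
  have fin: "finite F" using fin_I by (simp add: F_def)
  have key: "\<forall>U\<in>F. a U *\<^sub>R u U = 0" if "(\<Sum>U\<in>F. a U *\<^sub>R u U) = 0" for a
    using FI F_inj that u(1) sub_I by (intro distinct_characters_independent) (auto intro!: subspace_mul)
  have inj: "inj_on u F"
  proof (rule inj_onI, rule ccontr)
    fix U V assume UV: "U \<in> F" "V \<in> F" "u U = u V" "U \<noteq> V"
    define a :: "(real^'n) set \<Rightarrow> real" where "a = (\<lambda>W. (if W = U then 1 else 0) - (if W = V then 1 else 0))"
    have "(\<Sum>W\<in>F. a W *\<^sub>R u W) = (\<Sum>W\<in>F. if W = U then u U else 0) - (\<Sum>W\<in>F. if W = V then u V else 0)"
      unfolding sum_subtractf[symmetric] by (intro sum.cong) (auto simp: a_def)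
    also have "\<dots> = 0" using UV fin by simp
    finally have "a U *\<^sub>R u U = 0" using key UV(1) by blast
    with UV u(2)[of U] FI show False by (auto simp: a_def)
  qed
  have "independent (u ` F)"
  proof (rule independent_if_scalars_zero)
    fix f x assume f: "(\<Sum>x\<in>u ` F. f x *\<^sub>R x) = 0" and x: "x \<in> u ` F"
    then have "(\<Sum>U\<in>F. f (u U) *\<^sub>R u U) = 0" using inj by (simp add: sum.reindex)
    from key[OF this] show "f x = 0" using x u(2) FI by auto
  qed (use fin in simp)
  then have "card (u ` F) \<le> CARD('n)" using independent_card_le by fastforce
  moreover have "card (u ` F) = card F" using inj by (rule card_image)
  moreover have "card F = card (chr ` I)"
    unfolding F_def by (intro card_image inj_on_inverseI[of _ chr] r(2))
  ultimately show ?thesis by simp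
qed

end

section \<open>Vanishing of the characters\<close>

lemma (in matrix_group) matrix_inv_mult:
  assumes "g \<in> G" "h \<in> G"
  shows "matrix_inv (g ** h) = matrix_inv h ** matrix_inv g"
proof (rule matrix_inv_unique[symmetric])
  have "g ** h ** (matrix_inv h ** matrix_inv g) = g ** (h ** matrix_inv h) ** matrix_inv g"
    by (simp only: matrix_mul_assoc)
  then show "g ** h ** (matrix_inv h ** matrix_inv g) = mat 1"
    using assms by (simp add: matrix_inv_right)
qed (use assms in \<open>simp add: mult_mem\<close>)

section \<open>Cosets of \<open>G0\<close>, the transfer and the affine action on n-space\<close>

context conformal_family
begin

text \<open>Restricted to \<open>I\<close>, so that only finitely many functions occur. They stand
  for the cosets of \<open>G0\<close>, and \<open>sec\<close> picks a representative of
  each.\<close>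

definition perm where "perm g = (\<lambda>U\<in>I. \<rho> g ` U)"
definition perms where "perms = perm ` G"
definition perm_act where "perm_act g p = (\<lambda>U\<in>I. \<rho> g ` p U)"
definition sec where "sec p = (SOME g. g \<in> G \<and> perm g = p)"
text \<open>Comparison of \<open>g ** sec p\<close> with the representative of its coset:
  \<open>g ** sec p = rem g p ** sec (perm_act g p)\<close>, with \<open>rem g p\<close> in the
  kernel \<open>G0\<close>.\<close>

definition rem where "rem g p = g ** sec p ** matrix_inv (sec (perm_act g p))"

lemma finite_perms: "finite perms"
proof (rule finite_subset)
  show "perms \<subseteq> (\<Pi>\<^sub>E U\<in>I. I)" by (auto simp: perms_def perm_def I_inv)
qed (simp add: finite_PiE fin_I)

lemma perms_ne: "perms \<noteq> {}" using one_mem by (auto simp: perms_def)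

lemma sec: "p \<in> perms \<Longrightarrow> sec p \<in> G \<and> perm (sec p) = p"
  unfolding perms_def sec_def by (rule someI_ex) auto

lemma perm_act_perm: "g \<in> G \<Longrightarrow> perm_act g (perm h) = perm (g ** h)"
  by (auto simp: perm_act_def perm_def \<rho>_mult_image fun_eq_iff)

lemma perm_act_mem: "g \<in> G \<Longrightarrow> p \<in> perms \<Longrightarrow> perm_act g p \<in> perms"
  by (auto simp: perms_def perm_act_perm mult_mem)

lemma perm_act_mult: "g \<in> G \<Longrightarrow> h \<in> G \<Longrightarrow> p \<in> perms \<Longrightarrow> perm_act (g ** h) p = perm_act g (perm_act h p)"
  by (auto simp: perms_def perm_act_perm mult_mem matrix_mul_assoc)

lemma perm_act_G0: "g \<in> G0 \<Longrightarrow> p \<in> perms \<Longrightarrow> perm_act g p = p"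
proof
  fix U assume g: "g \<in> G0" and "p \<in> perms"
  then obtain h where h: "h \<in> G" "p = perm h" by (auto simp: perms_def)
  show "perm_act g p U = p U"
  proof (cases "U \<in> I")
    case True
    then have "\<rho> g ` \<rho> h ` U = \<rho> h ` U" using g I_inv[OF h(1)] by (simp add: G0_def)
    then show ?thesis using True by (simp add: h(2) perm_act_def perm_def)
  qed (simp add: h(2) perm_act_def perm_def)
qed

lemma same_perm_G0:
  assumes a: "a \<in> G" and b: "b \<in> G" and ab: "perm a = perm b"
  shows "a ** matrix_inv b \<in> G0"
proof -
  have "\<rho> (a ** matrix_inv b) ` U = U" if U: "U \<in> I" for U
  proof -
    let ?V = "\<rho> (matrix_inv b) ` U"
    have V: "?V \<in> I" using I_inv[OF matrix_inv_mem[OF b] U] .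
    have "\<rho> (a ** matrix_inv b) ` U = \<rho> a ` ?V" using a by (rule \<rho>_mult_image)
    also have "\<dots> = \<rho> b ` ?V" using fun_cong[OF ab, of ?V] V by (simp add: perm_def)
    also have "\<dots> = U" using \<rho>_inv_image(2)[OF b I_D[OF U]] .
    finally show ?thesis .
  qed
  then show ?thesis using a b by (simp add: G0_def mult_mem matrix_inv_mem)
qed

lemma rem_mem: "g \<in> G \<Longrightarrow> p \<in> perms \<Longrightarrow> rem g p \<in> G0"
  unfolding rem_def
proof (rule same_perm_G0)
  assume "g \<in> G" "p \<in> perms"
  then show "g ** sec p \<in> G" "sec (perm_act g p) \<in> G" "perm (g ** sec p) = perm (sec (perm_act g p))"
    using sec[of p] sec[of "perm_act g p"] perm_act_mem[of g p] by (auto simp: mult_mem perm_act_perm[symmetric])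
qed

text \<open>Moving \<open>g\<close> past \<open>rem h p\<close> conjugates that factor, which a
  character then sees through \<open>twist\<close>; what remains is \<open>rem g\<close> at the
  translated coset.\<close>

lemma rem_mult:
  assumes g: "g \<in> G" and h: "h \<in> G" and p: "p \<in> perms"
  shows "rem (g ** h) p = (g ** rem h p ** matrix_inv g) ** rem g (perm_act h p)"
proof -
  let ?s = "sec (perm_act h p)"
  have s: "?s \<in> G" using sec perm_act_mem[OF h p] by blast
  have "(g ** rem h p ** matrix_inv g) ** rem g (perm_act h p)
    = g ** h ** sec p ** (matrix_inv ?s ** (matrix_inv g ** g) ** ?s) ** matrix_inv (sec (perm_act g (perm_act h p)))"
    by (simp only: rem_def matrix_mul_assoc)
  also have "matrix_inv ?s ** (matrix_inv g ** g) ** ?s = mat 1"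
    using g s by (simp add: matrix_inv_left)
  finally show ?thesis using perm_act_mult[OF g h p] by (simp add: rem_def)
qed

text \<open>The right action of the group on characters by conjugation; by \<open>chr_conj\<close>
  it permutes those of the family. The default 0 outside \<open>G0\<close> matches that of
  \<open>chr\<close>.\<close>

definition twist where "twist g c = (\<lambda>h. if h \<in> G0 then c (g ** h ** matrix_inv g) else (0::real))"

lemma twist_mem:
  assumes g: "g \<in> G" and c: "c \<in> chr ` I"
  shows "twist g c \<in> chr ` I"
proof -
  obtain V where V: "V \<in> I" "c = chr V" using c by auto
  let ?U = "\<rho> (matrix_inv g) ` V"
  have U: "?U \<in> I" using I_inv[OF matrix_inv_mem[OF g] V(1)] .
  have gU: "\<rho> g ` ?U = V" using \<rho>_inv_image(2)[OF g I_D[OF V(1)]] .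
  have "twist g c = chr ?U"
  proof
    fix h show "twist g c h = chr ?U h"
      using chr_conj[OF g U, of h] by (simp add: twist_def gU V(2)) (simp add: chr_def)
  qed
  then show ?thesis using U by simp
qed

lemma twist_mult:
  assumes "g \<in> G" "h \<in> G"
  shows "twist (g ** h) c = twist h (twist g c)"
  using assms by (auto simp: twist_def matrix_inv_mult matrix_mul_assoc conj_mem fun_eq_iff)

lemma char_mult: "c \<in> chr ` I \<Longrightarrow> g \<in> G0 \<Longrightarrow> h \<in> G0 \<Longrightarrow> c (g ** h) = c g + c h"
  using chr_mult by auto

lemma char_outside: "c \<in> chr ` I \<Longrightarrow> g \<notin> G0 \<Longrightarrow> c g = 0"
  by (auto simp: chr_def)

lemma twist_G0:
  assumes c: "c \<in> chr ` I" and g: "g \<in> G0"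
  shows "twist g c = c"
proof
  fix h show "twist g c h = c h"
  proof (cases "h \<in> G0")
    case True
    have "c g + c (matrix_inv g) = c (mat 1)"
      using char_mult[OF c g G0.matrix_inv_mem[OF g]] by (simp add: G0.matrix_inv_right[OF g])
    moreover have "c (mat 1) = 0" using char_mult[OF c G0.one_mem G0.one_mem] by simp
    ultimately show ?thesis
      using True g c by (simp add: twist_def char_mult G0.mult_mem G0.matrix_inv_mem)
  qed (use c in \<open>simp add: twist_def char_outside\<close>)
qed

text \<open>
  The transfer: averaging over the cosets of \<open>G0\<close> extends the equivariant family of characters on \<open>G0\<close>
  to a cocycle on the whole group.
\<close>

definition cocycle where "cocycle g c = (\<Sum>p\<in>perms. c (rem g p)) / card perms"

text \<open>Apply \<open>c\<close> to \<open>rem_mult\<close> and sum over the cosets, which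
  translation by \<open>h\<close> permutes.\<close>

lemma cocycle_mult:
  assumes g: "g \<in> G" and h: "h \<in> G" and c: "c \<in> chr ` I"
  shows "cocycle (g ** h) c = cocycle h (twist g c) + cocycle g c"
proof -
  have inv_act: "perm_act (matrix_inv h) (perm_act h p) = p" "perm_act h (perm_act (matrix_inv h) p) = p"
    if "p \<in> perms" for p
    using perm_act_mult[OF matrix_inv_mem[OF h] h that] perm_act_mult[OF h matrix_inv_mem[OF h] that]
      perm_act_G0[OF G0.one_mem that] h by (simp_all add: matrix_inv_left matrix_inv_right)
  have "bij_betw (perm_act h) perms perms"
    by (rule bij_betw_byWitness[where f'="perm_act (matrix_inv h)"])
      (auto simp: inv_act perm_act_mem h matrix_inv_mem)
  then have re: "(\<Sum>p\<in>perms. c (rem g (perm_act h p))) = (\<Sum>p\<in>perms. c (rem g p))"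
    by (rule sum.reindex_bij_betw)
  have "c (rem (g ** h) p) = twist g c (rem h p) + c (rem g (perm_act h p))" if p: "p \<in> perms" for p
    unfolding rem_mult[OF g h p]
    using c char_mult conj_mem[OF g rem_mem[OF h p]] rem_mem[OF g perm_act_mem[OF h p]] rem_mem[OF h p]
    by (simp add: twist_def)
  then have "(\<Sum>p\<in>perms. c (rem (g ** h) p)) = (\<Sum>p\<in>perms. twist g c (rem h p)) + (\<Sum>p\<in>perms. c (rem g p))"
    by (simp add: sum.distrib re)
  then show ?thesis by (simp add: cocycle_def add_divide_distrib)
qed

text \<open>An element of \<open>G0\<close> fixes every coset and is its own remainder, so the
  average returns the character.\<close>

lemma cocycle_G0:
  assumes g: "g \<in> G0"
  shows "cocycle g c = c g"
proof -
  have "rem g p = g" if "p \<in> perms" for p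
    using sec[OF that] g matrix_mul_assoc[of g "sec p"]
    by (simp add: rem_def perm_act_G0[OF g that] matrix_mul_assoc[symmetric] matrix_inv_right)
  then show ?thesis using perms_ne finite_perms by (simp add: cocycle_def)
qed

text \<open>The characters are placed among the n coordinates by an injection \<open>e\<close>. The
  group permutes these coordinates through \<open>twist\<close> and translates by the cocycle,
  leaving the other coordinates fixed. Elements of \<open>G0\<close> permute nothing, so at a fixed
  point their translation, which is the value of the character, is zero.\<close>

lemma chr_trivial:
  fixes \<Gamma> :: "(real^'n^'n) monoid"
  assumes FR: "property_FR \<Gamma> m" and grp: "group \<Gamma>"
    and mult: "\<And>g h. g \<otimes>\<^bsub>\<Gamma>\<^esub> h = g ** h" and one: "\<one>\<^bsub>\<Gamma>\<^esub> = mat 1" and carrier: "carrier \<Gamma> = G"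
    and m: "CARD('n) \<le> m" and U: "U \<in> I" and g: "g \<in> G0"
  shows "chr U g = 0"
proof -
  let ?X = "chr ` I"
  obtain e :: "(real^'n^'n \<Rightarrow> real) \<Rightarrow> 'n" where e: "inj_on e ?X"
    using card_characters fin_I by (metis card_le_inj finite_imageI finite subset_UNIV)
  define e' where "e' = inv_into ?X e"
  have e' [simp]: "e' (e c) = c" if "c \<in> ?X" for c using e that by (simp add: e'_def)
  define \<pi> where "\<pi> = (\<lambda>g i. if i \<in> e ` ?X then e (twist g (e' i)) else i)"
  have \<pi>_e: "\<pi> g (e c) = e (twist g c)" if "c \<in> ?X" for g c using that by (simp add: \<pi>_def)
  have \<pi>_o: "\<pi> g i = i" if "i \<notin> e ` ?X" for g i using that by (simp add: \<pi>_def)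
  have \<pi>_mult: "\<pi> (g ** h) i = \<pi> h (\<pi> g i)" if "g \<in> G" "h \<in> G" for g h i
  proof (cases "i \<in> e ` ?X")
    case True
    then obtain c where c: "c \<in> ?X" "i = e c" by auto
    show ?thesis unfolding c(2) \<pi>_e[OF c(1)] \<pi>_e[OF twist_mem[OF that(1) c(1)]] twist_mult[OF that] ..
  qed (simp add: \<pi>_o)
  have \<pi>_one: "\<pi> (mat 1) i = i" for i
  proof (cases "i \<in> e ` ?X")
    case True
    then obtain c where c: "c \<in> ?X" "i = e c" by auto
    show ?thesis unfolding c(2) \<pi>_e[OF c(1)] twist_G0[OF c(1) G0.one_mem] ..
  qed (simp add: \<pi>_o)
  have \<pi>_bij: "bij (\<pi> g)" if "g \<in> G" for g
    by (rule o_bij[of "\<pi> (matrix_inv g)"])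
      (use that in \<open>auto simp: fun_eq_iff \<pi>_mult[symmetric] \<pi>_one matrix_inv_mem matrix_inv_left matrix_inv_right\<close>)
  define \<beta> where "\<beta> = (\<lambda>g i. if i \<in> e ` ?X then cocycle g (e' i) else 0)"
  have \<beta>_e: "\<beta> g (e c) = cocycle g c" if "c \<in> ?X" for g c using that by (simp add: \<beta>_def)
  have \<beta>_mult: "\<beta> (g ** h) i = \<beta> h (\<pi> g i) + \<beta> g i" if "g \<in> G" "h \<in> G" for g h i
  proof (cases "i \<in> e ` ?X")
    case True
    then obtain c where c: "c \<in> ?X" "i = e c" by auto
    show ?thesis
      unfolding c(2) \<pi>_e[OF c(1)] \<beta>_e[OF c(1)] \<beta>_e[OF twist_mem[OF that(1) c(1)]] cocycle_mult[OF that c(1)] ..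
  qed (simp add: \<pi>_o \<beta>_def)
  have \<beta>_one: "\<beta> (mat 1) i = 0" for i using \<beta>_mult[OF one_mem one_mem, of i] by (simp add: \<pi>_one)
  \<comment> \<open>Pulling back along the right action \<pi> on indices gives a left action on
    vectors.\<close>
  define \<Phi> :: "real^'n^'n \<Rightarrow> real^'n \<Rightarrow> real^'n" where "\<Phi> = (\<lambda>g t. \<chi> i. t $ \<pi> g i + \<beta> g i)"
  obtain t where t: "\<And>g. g \<in> carrier \<Gamma> \<Longrightarrow> \<Phi> g t = t"
  proof (rule property_FR_fixed_point[OF FR grp, of UNIV \<Phi>])
    show "dim (UNIV :: (real^'n) set) \<le> m" using m by simp
    show "\<Phi> \<one>\<^bsub>\<Gamma>\<^esub> x = x" for x by (simp add: one \<Phi>_def \<pi>_one \<beta>_one)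
    show "\<Phi> (g \<otimes>\<^bsub>\<Gamma>\<^esub> h) x = \<Phi> g (\<Phi> h x)" if "g \<in> carrier \<Gamma>" "h \<in> carrier \<Gamma>" for g h x
      using that by (simp add: \<Phi>_def vec_eq_iff mult carrier \<pi>_mult \<beta>_mult)
    show "norm (\<Phi> g x - \<Phi> g y) = norm (x - y)" if "g \<in> carrier \<Gamma>" for g x y
    proof -
      have "(\<Sum>i\<in>UNIV. (norm ((x - y) $ \<pi> g i))\<^sup>2) = (\<Sum>i\<in>UNIV. (norm ((x - y) $ i))\<^sup>2)"
        using that by (intro sum.reindex_bij_betw \<pi>_bij) (simp add: carrier)
      then show ?thesis by (simp add: norm_vec_def L2_set_def \<Phi>_def)
    qed
  qed auto
  have c: "chr U \<in> ?X" using U by simp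
  have "\<Phi> g t $ e (chr U) = t $ e (chr U)" using t G0_G[OF g] by (simp add: carrier)
  then show ?thesis
    by (simp add: \<Phi>_def \<pi>_e[OF c] \<beta>_e[OF c] twist_G0[OF c g] cocycle_G0[OF g])
qed

text \<open>Every \<open>g\<close> is an element of \<open>G0\<close> times one of finitely many
  representatives. With trivial characters \<open>chr_upper\<close> bounds the first factor on each
  member, and \<open>bounded_on_span\<close> passes to the span.\<close>

lemma bounded_on_span_family:
  assumes trivial: "\<And>U g. U \<in> I \<Longrightarrow> g \<in> G0 \<Longrightarrow> chr U g = 0"
  shows "\<exists>C>0. \<forall>g\<in>G. \<forall>x\<in>span (\<Union>I). norm (\<rho> g x) \<le> C * norm x"
proof -
  have "\<exists>C. \<forall>T\<in>(\<lambda>g. Q ** g) ` G. norm (T *v x) \<le> C" if "x \<in> \<Union>I" for x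
  proof -
    from that obtain U where U: "U \<in> I" "x \<in> U" by auto
    have xD: "x \<in> D" using U I_D by auto
    have "\<forall>V\<in>I. \<exists>C. \<forall>g\<in>G0. \<forall>u\<in>V. norm (\<rho> g u) \<le> C * norm u \<and> C > 0"
      using chr_upper trivial by (metis exp_zero mult.right_neutral)
    then obtain C where C: "\<And>V g u. V \<in> I \<Longrightarrow> g \<in> G0 \<Longrightarrow> u \<in> V \<Longrightarrow> norm (\<rho> g u) \<le> C V * norm u \<and> C V > 0"
      by metis
    have "norm (\<rho> g x) \<le> (\<Sum>V\<in>I. \<bar>C V\<bar>) * ((\<Sum>p\<in>perms. norm (sec p)) * norm x)" if g: "g \<in> G" for g
    proof -
      define p where "p = perm g"
      have p: "p \<in> perms" using g by (simp add: p_def perms_def)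
      have s: "sec p \<in> G" "perm (sec p) = p" using sec[OF p] by auto
      let ?k = "g ** matrix_inv (sec p)"
      have k: "?k \<in> G0" using same_perm_G0[OF g s(1)] s(2) by (simp add: p_def)
      define V where "V = \<rho> (sec p) ` U"
      have V: "V \<in> I" using I_inv[OF s(1) U(1)] by (simp add: V_def)
      have "?k ** sec p = g" using s(1) by (simp add: matrix_mul_assoc[symmetric] matrix_inv_left)
      then have "\<rho> g x = \<rho> ?k (\<rho> (sec p) x)" using \<rho>_mult[OF G0_G[OF k], of "sec p" x] by simp
      then have "norm (\<rho> g x) \<le> C V * norm (\<rho> (sec p) x)" using C[OF V k, of "\<rho> (sec p) x"] U(2) by (simp add: V_def)
      also have "\<dots> \<le> (\<Sum>V\<in>I. \<bar>C V\<bar>) * norm (\<rho> (sec p) x)"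
      proof (intro mult_right_mono)
        have "C V \<le> \<bar>C V\<bar>" by simp
        also have "\<dots> \<le> (\<Sum>V\<in>I. \<bar>C V\<bar>)" using V fin_I by (intro member_le_sum) auto
        finally show "C V \<le> (\<Sum>V\<in>I. \<bar>C V\<bar>)" .
      qed simp
      also have "\<dots> \<le> (\<Sum>V\<in>I. \<bar>C V\<bar>) * ((\<Sum>p\<in>perms. norm (sec p)) * norm x)"
      proof (intro mult_left_mono sum_nonneg)
        have "norm (sec p) \<le> (\<Sum>p\<in>perms. norm (sec p))"
          using p finite_perms by (intro member_le_sum) auto
        then show "norm (\<rho> (sec p) x) \<le> (\<Sum>p\<in>perms. norm (sec p)) * norm x"
          by (rule order_trans[OF norm_\<rho>_le mult_right_mono]) simp
      qed simp
      finally show ?thesis .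
    qed
    then show ?thesis by (auto simp: \<rho>_def matrix_vector_mul_assoc)
  qed
  from bounded_on_span[of "\<Union>I" "(\<lambda>g. Q ** g) ` G", OF this] show ?thesis by (simp add: \<rho>_def matrix_vector_mul_assoc)
qed

end

section \<open>Almost invariant means and property FR force boundedness\<close>

context almost_invariant_mean
begin

lemma bounded_step:
  fixes \<Gamma> :: "(real^'n^'n) monoid"
  assumes FR: "property_FR \<Gamma> m" and grp: "group \<Gamma>"
    and mult: "\<And>g h. g \<otimes>\<^bsub>\<Gamma>\<^esub> h = g ** h" and one: "\<one>\<^bsub>\<Gamma>\<^esub> = mat 1" and carrier: "carrier \<Gamma> = G"
    and n: "CARD('n) \<ge> 2" and m: "m = CARD('n) * (CARD('n) + 1) div 2 - 1"
    and B: "subspace B" "B \<noteq> UNIV" "\<And>g b. g \<in> G \<Longrightarrow> b \<in> B \<Longrightarrow> g *v b \<in> B"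
    and bdd: "\<And>g b. g \<in> G \<Longrightarrow> b \<in> B \<Longrightarrow> norm (g *v b) \<le> C * norm b" and C: "C \<ge> 0"
  shows "\<exists>B'. subspace B' \<and> dim B < dim B' \<and> (\<forall>g\<in>G. \<forall>b\<in>B'. g *v b \<in> B') \<and>
    (\<exists>C\<ge>0. \<forall>g\<in>G. \<forall>b\<in>B'. norm (g *v b) \<le> C * norm b)"
proof -
  interpret almost_invariant_mean_quotient G \<Lambda> B
    by unfold_locales (use B in auto)
  obtain I where I: "finite I" "I \<noteq> {}"
    "\<And>U. U \<in> I \<Longrightarrow> subspace U" "\<And>U. U \<in> I \<Longrightarrow> U \<subseteq> D" "\<And>U. U \<in> I \<Longrightarrow> U \<noteq> {0}"
    "\<And>g U. g \<in> G \<Longrightarrow> U \<in> I \<Longrightarrow> \<rho> g ` U \<in> I"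
    "\<And>U. U \<in> I \<Longrightarrow> \<exists>C>0. \<forall>g\<in>G. \<rho> g ` U = U \<longrightarrow>
      (\<forall>x\<in>U. \<forall>y\<in>U. norm (\<rho> g x) * norm y \<le> C * norm (\<rho> g y) * norm x)"
    by (rule ex_invariant_family) (rule that, assumption+)
  interpret conformal_family G B I
    by unfold_locales (use I in auto)
  let ?n = "CARD('n)"
  \<comment> \<open>The action on characters lives on n-space; n \<le> n(n+1)/2 - 1 holds from n = 2
    on, with equality there.\<close>
  have nm: "?n \<le> m"
  proof -
    have "2 * ?n + 2 \<le> ?n * (?n + 1)"
    proof -
      obtain k where "?n = k + 2" using n by (metis add.commute le_Suc_ex)
      then show ?thesis by simp
    qed
    then show ?thesis by (simp add: m)
  qed
  define W where "W = span (\<Union>I)"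
  have W: "subspace W" by (simp add: W_def)
  have WD: "W \<subseteq> D" unfolding W_def using I_D subspace_D by (intro span_minimal) auto
  have orth: "inner b w = 0" if "b \<in> B" "w \<in> W" for b w
    using that WD by (auto simp: D_def inner_commute)
  obtain K where K: "K > 0" "\<And>g x. g \<in> G \<Longrightarrow> x \<in> W \<Longrightarrow> norm (\<rho> g x) \<le> K * norm x"
    using bounded_on_span_family[OF chr_trivial[OF FR grp mult one carrier nm]] unfolding W_def by blast
  have \<rho>W: "\<rho> g w \<in> W" if "g \<in> G" "w \<in> W" for g w
  proof -
    have "\<rho> g w \<in> \<rho> g ` span (\<Union>I)" using that by (simp add: W_def)
    also have "\<dots> = span (\<rho> g ` \<Union>I)" by (simp add: linear_span_image[OF linear_\<rho>])
    also have "\<dots> \<subseteq> span (\<Union>I)" using I_inv[OF that(1)] by (intro span_mono) auto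
    finally show ?thesis by (simp add: W_def)
  qed
  have \<rho>_eq: "g *v w - proj_mat B *v (g *v w) = \<rho> g w" for g w by (simp add: \<rho>_def Q_apply)
  have dim_sum: "dim (B \<union> W) = dim B + dim W" using orth by (rule dim_orthogonal_sum)
  have le_n: "dim B + dim W \<le> ?n" using dim_subset_UNIV[of "B \<union> W"] by (simp add: dim_sum)
  \<comment> \<open>The product of two dimensions with sum at most n is at most n^2/4, by the
    inequality of the means; n \<ge> 2 absorbs the subtracted 1.\<close>
  have dims: "dim B * dim W \<le> m"
  proof -
    have "4 * (dim B * dim W) \<le> (dim B + dim W) * (dim B + dim W)"
    proof -
      have le: "4 * (a * (a + k)) \<le> (a + (a + k)) * (a + (a + k))" for a k :: nat
        by (simp add: algebra_simps)
      show ?thesis using le[of "dim B" "dim W - dim B"] le[of "dim W" "dim B - dim W"]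
        by (cases "dim B \<le> dim W") (simp_all add: mult.commute add.commute)
    qed
    also have "\<dots> \<le> ?n * ?n" using le_n by (intro mult_mono) auto
    finally have "4 * (dim B * dim W) \<le> ?n * ?n" .
    moreover have "4 \<le> ?n * ?n" using mult_mono[OF n n] by simp
    ultimately have "2 * (dim B * dim W + 1) \<le> ?n * (?n + 1)" by simp
    then show ?thesis by (simp add: m)
  qed
  define C' where "C' = max C K"
  have C': "C \<le> C'" "K \<le> C'" "C' \<ge> 0" using C by (auto simp: C'_def)
  have "\<exists>C>0. \<forall>g\<in>carrier \<Gamma>. \<forall>x\<in>span (B \<union> W). norm (g *v x) \<le> C * norm x"
  proof (rule bounded_extension[OF FR grp mult one B(1) W orth dims, of C'])
    show "g *v w - proj_mat B *v (g *v w) \<in> W" if "g \<in> carrier \<Gamma>" "w \<in> W" for g w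
      using that by (simp add: \<rho>_eq \<rho>W carrier)
    show "norm (g *v b) \<le> C' * norm b" if "g \<in> carrier \<Gamma>" "b \<in> B" for g b
      using order_trans[OF bdd[of g b] mult_right_mono[OF C'(1) norm_ge_zero]] that by (simp add: carrier)
    show "norm (g *v w - proj_mat B *v (g *v w)) \<le> C' * norm w" if "g \<in> carrier \<Gamma>" "w \<in> W" for g w
      using order_trans[OF K(2)[of g w] mult_right_mono[OF C'(2) norm_ge_zero]] that by (simp add: \<rho>_eq carrier)
  qed (use B carrier C' in auto)
  then obtain C1 where C1: "C1 > 0" "\<forall>g\<in>G. \<forall>x\<in>span (B \<union> W). norm (g *v x) \<le> C1 * norm x"
    unfolding carrier by blast
  have "g *v x \<in> span (B \<union> W)" if g: "g \<in> G" and x: "x \<in> span (B \<union> W)" for g x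
  proof -
    have "(*v) g ` (B \<union> W) \<subseteq> span (B \<union> W)"
    proof clarify
      fix y assume y: "y \<in> B \<union> W"
      have "g *v y = proj_mat B *v (g *v y) + \<rho> g y" by (simp add: \<rho>_def Q_apply)
      moreover have "\<rho> g y \<in> span (B \<union> W)"
      proof (cases "y \<in> B")
        case True
        then have "\<rho> g y = 0" using B(3)[OF g] by (simp add: \<rho>_def Q_B)
        then show ?thesis by (simp add: span_zero)
      qed (use y \<rho>W[OF g] in \<open>auto intro: span_base\<close>)
      moreover have "proj_mat B *v (g *v y) \<in> span (B \<union> W)"
        using proj_mat_in[OF B(1)] by (intro span_base) auto
      ultimately show "g *v y \<in> span (B \<union> W)" by (metis span_add)
    qed
    moreover have "g *v x \<in> span ((*v) g ` (B \<union> W))"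
      using x by (simp add: linear_span_image)
    ultimately show ?thesis by (metis span_minimal subsetD subspace_span)
  qed
  moreover have "dim B < dim (span (B \<union> W))"
  proof -
    obtain U where U: "U \<in> I" using I_ne by blast
    then have "U \<subseteq> W" unfolding W_def by (metis Union_upper order_trans span_superset)
    moreover have "dim U > 0" using dim_pos[OF U] .
    ultimately have "dim W > 0" using dim_subset[of U W] by linarith
    then show ?thesis by (simp add: dim_sum)
  qed
  ultimately show ?thesis using C1 by (intro exI[of _ "span (B \<union> W)"]) (auto intro: less_imp_le)
qed

theorem bounded_of_property_FR:
  fixes \<Gamma> :: "(real^'n^'n) monoid"
  assumes FR: "property_FR \<Gamma> (CARD('n) * (CARD('n) + 1) div 2 - 1)" and grp: "group \<Gamma>"
    and mult: "\<And>g h. g \<otimes>\<^bsub>\<Gamma>\<^esub> h = g ** h" and one: "\<one>\<^bsub>\<Gamma>\<^esub> = mat 1" and carrier: "carrier \<Gamma> = G"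
    and n: "CARD('n) \<ge> 2"
  shows "bounded G"
proof -
  define \<B> where "\<B> = {B :: (real^'n) set. subspace B \<and> (\<forall>g\<in>G. \<forall>b\<in>B. g *v b \<in> B) \<and>
    (\<exists>C\<ge>0. \<forall>g\<in>G. \<forall>b\<in>B. norm (g *v b) \<le> C * norm b)}"
  have "{0} \<in> \<B>" by (auto simp: \<B>_def subspace_single_0 intro: exI[of _ 0])
  moreover have "dim B < Suc (CARD('n))" if "B \<in> \<B>" for B using dim_subset_UNIV[of B] by simp
  ultimately obtain B where B: "B \<in> \<B>" "\<And>B'. B' \<in> \<B> \<Longrightarrow> dim B' \<le> dim B"
    using ex_has_greatest_nat[of "\<lambda>B. B \<in> \<B>" "{0}" dim "Suc CARD('n)"] by blast
  have "B = UNIV"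
  proof (rule ccontr)
    assume ne: "B \<noteq> UNIV"
    obtain C where C: "C \<ge> 0" "\<And>g b. g \<in> G \<Longrightarrow> b \<in> B \<Longrightarrow> norm (g *v b) \<le> C * norm b"
      using B(1) by (auto simp: \<B>_def)
    have "\<exists>B'\<in>\<B>. dim B < dim B'"
      using bounded_step[OF FR grp mult one carrier n refl _ ne _ C(2) C(1)] B(1) by (auto simp: \<B>_def)
    with B(2) show False by (meson not_le)
  qed
  then obtain C where "\<And>g x. g \<in> G \<Longrightarrow> norm (g *v x) \<le> C * norm x" using B(1) by (auto simp: \<B>_def)
  then have "\<And>g. g \<in> G \<Longrightarrow> norm g \<le> real CARD('n) * C" by (intro norm_matrix_le)
  then show ?thesis unfolding bounded_iff by blast
qed

end

section \<open>Linear maps and Lebesgue measure\<close>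

lemma measure_shear_image:
  fixes m n :: "'n::finite" and S :: "(real^'n) set"
  assumes "m \<noteq> n" and S: "S \<in> lmeasurable"
  defines "h \<equiv> \<lambda>x::real^'n. \<chi> i. if i = m then x $ m + x $ n else x $ i"
  shows "h ` S \<in> lmeasurable \<and> measure lebesgue (h ` S) = measure lebesgue S"
proof -
  have lin: "linear h" unfolding h_def by (intro linearI) (auto simp: vec_eq_iff algebra_simps)
  have "measure lebesgue (h ` cbox a b) = 1 * measure lebesgue (cbox a b)" for a b
  proof (cases "cbox a b = {}")
    case False
    \<comment> \<open>A translation brings the lower bound in coordinate \<open>n\<close> to 0, as
      \<open>measure_shear_interval\<close> requires. By linearity of \<open>h\<close> the image is
      merely translated as well.\<close>
    define t :: "real^'n" where "t = axis n (- a $ n)"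
    have box: "cbox a b = (+) (- t) ` cbox (t + a) (t + b)" 
      using cbox_translation[of "- t" "t + a" "t + b"] by (simp add: add.assoc[symmetric])
    then have "h ` cbox a b = (+) (h (- t)) ` h ` cbox (t + a) (t + b)"
      by (simp add: image_image linear_add[OF lin] linear_diff[OF lin] linear_neg[OF lin])
    then have "measure lebesgue (h ` cbox a b) = measure lebesgue (h ` cbox (t + a) (t + b))"
      by (metis measure_translation)
    also have "\<dots> = measure lebesgue (cbox (t + a) (t + b))"
      unfolding h_def using False box assms(1) by (intro measure_shear_interval) (auto simp: t_def)
    also have "\<dots> = measure lebesgue (cbox a b)" using box by (metis measure_translation)
    finally show ?thesis by simp
  qed simp
  from measure_linear_sufficient[OF lin S this] show ?thesis by (simp only: mult_1)
qed

text \<open>Every linear map is composed of elementary ones, and the property \<open>P\<close> is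
  stable under composition because determinants multiply.\<close>

lemma measure_matrix_image:
  fixes A :: "real^'n^'n"
  assumes "S \<in> lmeasurable"
  shows "(*v) A ` S \<in> lmeasurable \<and> measure lebesgue ((*v) A ` S) = \<bar>det A\<bar> * measure lebesgue S"
proof -
  define P where "P = (\<lambda>f :: real^'n \<Rightarrow> real^'n. linear f \<and>
    (\<forall>S\<in>lmeasurable. f ` S \<in> lmeasurable \<and> measure lebesgue (f ` S) = \<bar>det (matrix f)\<bar> * measure lebesgue S))"
  have comp: "P (f \<circ> g)" if "P f" "P g" for f g
  proof -
    have f: "linear f" "\<And>S. S \<in> lmeasurable \<Longrightarrow> f ` S \<in> lmeasurable \<and> measure lebesgue (f ` S) = \<bar>det (matrix f)\<bar> * measure lebesgue S"
      and g: "linear g" "\<And>S. S \<in> lmeasurable \<Longrightarrow> g ` S \<in> lmeasurable \<and> measure lebesgue (g ` S) = \<bar>det (matrix g)\<bar> * measure lebesgue S"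
      using that by (auto simp: P_def)
    have "linear (f \<circ> g)" using linear_compose[OF g(1) f(1)] .
    moreover have "det (matrix (f \<circ> g)) = det (matrix f) * det (matrix g)"
      by (simp add: matrix_compose[OF g(1) f(1)] det_mul)
    ultimately show ?thesis unfolding P_def image_comp[symmetric] using f(2) g(2) by (simp add: abs_mult)
  qed
  have const: "P (\<lambda>x. \<chi> i. c i * x $ i)" for c
    unfolding P_def
  proof (intro conjI ballI)
    show "linear (\<lambda>x::real^'n. \<chi> i. c i * x $ i)"
      by (intro linearI) (simp_all add: vec_eq_iff algebra_simps)
    have "det (matrix (\<lambda>x::real^'n. \<chi> i. c i * x $ i)) = prod c UNIV"
      by (subst det_diagonal) (auto simp: matrix_def axis_def)
    then show "measure lebesgue ((\<lambda>x. \<chi> i. c i * x $ i) ` S) = \<bar>det (matrix (\<lambda>x::real^'n. \<chi> i. c i * x $ i))\<bar> * measure lebesgue S"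
      if "S \<in> lmeasurable" for S using measure_stretch[OF that, of c] by simp
  qed (simp add: measurable_stretch)
  define h where "h = (\<lambda>(m :: 'n) (n :: 'n) x :: real^'n. (\<chi> i. if i = m then x $ m + x $ n else x $ i) :: real^'n)"
  have shear: "P (h m n)" if mn: "m \<noteq> n" for m n :: 'n
  proof -
    have "matrix (h m n) = (\<chi> k. if k = m then row m (mat 1) + 1 *s row n (mat 1) else row k (mat 1))"
      by (auto simp: matrix_def vec_eq_iff row_def mat_def axis_def h_def)
    then have "det (matrix (h m n)) = 1" using det_row_operation[OF mn, of "mat 1" 1] by simp
    moreover have "linear (h m n)" by (intro linearI) (auto simp: vec_eq_iff h_def algebra_simps)
    moreover have "\<forall>S\<in>lmeasurable. h m n ` S \<in> lmeasurable \<and> measure lebesgue (h m n ` S) = measure lebesgue S"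
      unfolding h_def by (intro ballI measure_shear_image mn)
    ultimately show ?thesis unfolding P_def by simp
  qed
  have "P ((*v) A)"
  proof (rule induct_linear_elementary[where P = P and f = "(*v) A"])
    fix f :: "real^'n \<Rightarrow> real^'n" and i assume f: "linear f" and "\<And>x. f x $ i = 0"
    then have "\<not> surj f" by (metis one_neq_zero surjD vec_component)
    then have "\<not> inj f" using f linear_injective_imp_surjective by blast
    then have "det (matrix f) = 0" using det_nz_iff_inj[OF f] by blast
    moreover have "negligible (f ` S)" for S using f \<open>\<not> inj f\<close> by (rule negligible_linear_singular_image)
    ultimately show "P f" using f by (simp add: P_def negligible_imp_measure0 negligible_imp_measurable)
  next
    fix m n :: 'n assume mn: "m \<noteq> n"
    \<comment> \<open>The transposition of two coordinates as a product of shears and sign changes,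
      the inner bracket being an inverse shear; so no separate measure computation arises.\<close>
    let ?c = "\<lambda>m (x::real^'n). (\<chi> i. (if i = m then - 1 else 1) * x $ i)"
    have "(\<lambda>x::real^'n. \<chi> i. x $ Transposition.transpose m n i) = ?c n \<circ> h m n \<circ> (?c m \<circ> h n m \<circ> ?c m) \<circ> h m n"
      using mn by (auto simp: fun_eq_iff vec_eq_iff h_def Transposition.transpose_def)
    moreover have "P (?c n \<circ> h m n \<circ> (?c m \<circ> h n m \<circ> ?c m) \<circ> h m n)"
      by (intro comp const shear mn mn[symmetric])
    ultimately show "P (\<lambda>x. \<chi> i. x $ Transposition.transpose m n i)" by (simp only:)
  qed (use comp const shear in \<open>auto simp: h_def\<close>)
  then show ?thesis using assms by (simp add: P_def)
qed

text \<open>Boxes suffice, and the preimage of a box is its image under the inverse matrix, which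
  has determinant of absolute value one too.\<close>

lemma distr_lborel_matrix:
  fixes A :: "real^'n^'n"
  assumes "\<bar>det A\<bar> = 1"
  shows "distr lborel borel ((*v) A) = lborel"
proof (rule lborel_eqI[symmetric])
  fix l u :: "real^'n" assume lu: "\<And>b. b \<in> Basis \<Longrightarrow> l \<bullet> b \<le> u \<bullet> b"
  have "invertible A" using assms by (auto simp: invertible_det_nz)
  then obtain A' where A': "A ** A' = mat 1" "A' ** A = mat 1" by (auto simp: invertible_def)
  have "\<bar>det A\<bar> * \<bar>det A'\<bar> = 1" by (metis A'(1) abs_mult abs_one det_I det_mul)
  then have detA': "\<bar>det A'\<bar> = 1" using assms by simp
  have meas: "(*v) A \<in> borel_measurable borel"
    by (intro borel_measurable_continuous_onI linear_continuous_on) auto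
  have img: "(*v) A -` box l u = (*v) A' ` box l u"
  proof (rule subset_antisym; rule subsetI)
    fix x assume "x \<in> (*v) A -` box l u"
    moreover have "x = A' *v (A *v x)" by (simp add: matrix_vector_mul_assoc A')
    ultimately show "x \<in> (*v) A' ` box l u" by blast
  qed (auto simp: matrix_vector_mul_assoc A')
  have box: "box l u \<in> lmeasurable" by (rule lmeasurable_box)
  have 1: "(*v) A' ` box l u \<in> lmeasurable" "measure lebesgue ((*v) A' ` box l u) = measure lebesgue (box l u)"
    using measure_matrix_image[OF box, of A'] detA' by auto
  have "emeasure (distr lborel borel ((*v) A)) (box l u) = emeasure lborel ((*v) A' ` box l u)"
    using meas by (subst emeasure_distr) (auto simp: img)
  also have "\<dots> = emeasure lebesgue ((*v) A' ` box l u)"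
    using measurable_sets[OF meas, of "box l u"] by (simp add: img)
  also have "\<dots> = ennreal (measure lebesgue (box l u))" using 1 by (simp add: emeasure_eq_measure2)
  also have "\<dots> = emeasure lborel (box l u)" using box by (simp add: emeasure_eq_measure2[symmetric])
  also have "\<dots> = (\<Prod>b\<in>Basis. (u - l) \<bullet> b)" using lu by (rule emeasure_lborel_box)
  finally show "emeasure (distr lborel borel ((*v) A)) (box l u) = (\<Prod>b\<in>Basis. (u - l) \<bullet> b)" .
qed simp

section \<open>The operator norm\<close>

lemma op_norm: "norm (A *v x) \<le> op_norm A * norm x"
  unfolding op_norm_def by (rule onorm[OF matrix_vector_mul_bounded_linear])

lemma op_norm_nonneg: "op_norm A \<ge> 0"
  unfolding op_norm_def by (rule onorm_pos_le[OF matrix_vector_mul_bounded_linear])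

lemma op_norm_mult: "op_norm (A ** B) \<le> op_norm A * op_norm B"
proof -
  have "(*v) (A ** B) = (*v) A \<circ> (*v) B" by (auto simp: matrix_vector_mul_assoc)
  then show ?thesis unfolding op_norm_def by (simp add: onorm_compose)
qed

lemma op_norm_le_norm: "op_norm A \<le> norm A"
  unfolding op_norm_def by (rule onorm_le) (rule norm_matrix_vector_mult_le)

lemma op_norm_continuous: "continuous_on X (op_norm :: real^'n^'n \<Rightarrow> real)"
proof (rule continuous_onI)
  fix e :: real and A :: "real^'n^'n" assume "e > 0"
  have le: "op_norm A \<le> op_norm B + norm (A - B)" for A B :: "real^'n^'n"
  proof -
    have "(\<lambda>x. A *v x) = (\<lambda>x. B *v x + (A - B) *v x)" by (simp add: mv_simps)
    then have "op_norm A \<le> op_norm B + op_norm (A - B)"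
      unfolding op_norm_def by (metis onorm_triangle matrix_vector_mul_bounded_linear)
    with op_norm_le_norm[of "A - B"] show ?thesis by simp
  qed
  show "\<exists>d>0. \<forall>x'\<in>X. dist x' A < d \<longrightarrow> dist (op_norm x') (op_norm A) \<le> e"
  proof (intro exI[of _ e] conjI ballI impI)
    fix B assume "dist B A < e"
    then show "dist (op_norm B) (op_norm A) \<le> e"
      using le[of A B] le[of B A] by (auto simp: dist_norm norm_minus_commute)
  qed fact
qed

text \<open>A volume preserving map cannot send the unit ball into a smaller ball. All logarithms of
  operator norms below are therefore nonnegative.\<close>

lemma op_norm_ge_1:
  fixes A :: "real^'n^'n"
  assumes "\<bar>det A\<bar> = 1"
  shows "op_norm A \<ge> 1"
proof (rule ccontr)
  assume "\<not> ?thesis"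
  then have lt: "op_norm A < 1" by simp
  have sub: "(*v) A ` ball 0 1 \<subseteq> ball 0 (op_norm A + (1 - op_norm A) / 2)"
  proof
    fix y assume "y \<in> (*v) A ` ball 0 1"
    then obtain x where x: "norm x < 1" "y = A *v x" by auto
    have "norm y \<le> op_norm A * 1" using op_norm[of A x] x mult_left_mono[OF less_imp_le[OF x(1)] op_norm_nonneg, of A] by simp
    moreover have "op_norm A < op_norm A + (1 - op_norm A) / 2" using lt by argo
    ultimately show "y \<in> ball 0 (op_norm A + (1 - op_norm A) / 2)" unfolding mem_ball_0 by linarith
  qed
  define r where "r = op_norm A + (1 - op_norm A) / 2"
  have r: "0 \<le> r" "r < 1" using lt op_norm_nonneg[of A] unfolding r_def by argo+
  have img: "(*v) A ` ball 0 1 \<in> lmeasurable" "measure lebesgue ((*v) A ` ball 0 1) = measure lebesgue (ball (0::real^'n) 1)"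
    using measure_matrix_image[of "ball 0 1" A] assms by auto
  have "measure lebesgue (ball (0::real^'n) 1) \<le> measure lebesgue (ball (0::real^'n) r)"
    using measure_mono_fmeasurable[OF sub[folded r_def]] img by (metis fmeasurableD lmeasurable_ball)
  then have "measure lborel (ball (0::real^'n) 1) \<le> measure lborel (ball (0::real^'n) r)" by simp
  then have "1 \<le> r ^ CARD('n)" using r by (simp add: content_ball)
  moreover have "r ^ CARD('n) < 1" using r by (simp add: power_less_one_iff)
  ultimately show False by simp
qed

section \<open>The special linear group as a measurable group\<close>

lemma continuous_on_det:
  fixes f :: "'a::topological_space \<Rightarrow> real^'n^'n"
  assumes "\<And>i j. continuous_on X (\<lambda>x. f x $ i $ j)"
  shows "continuous_on X (\<lambda>x. det (f x))"
  unfolding det_def by (intro continuous_intros assms)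

text \<open>Cramer's rule, polynomial in the entries. On matrices of determinant 1 it agrees with
  \<open>matrix_inv\<close>, which is defined by choice, and supplies continuity and measurability
  of the latter.\<close>

definition cofactor_inv :: "real^'n^'n \<Rightarrow> real^'n^'n"
  where "cofactor_inv A = (\<chi> i j. det (\<chi> k l. if l = i then axis j 1 $ k else A $ k $ l))"

lemma continuous_on_cofactor_inv:
  fixes X :: "(real^'n^'n) set"
  shows "continuous_on X cofactor_inv"
  unfolding cofactor_inv_def
proof (intro continuous_on_vec_lambda continuous_on_det)
  fix i j k l :: 'n
  show "continuous_on X (\<lambda>x::real^'n^'n. (\<chi> k l. if l = i then axis j 1 $ k else x $ k $ l) $ k $ l)"
    by (cases "l = i") (simp_all, intro continuous_intros)
qed

lemma det_1_inverse:
  fixes A :: "real^'n^'n"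
  assumes "det A = 1"
  shows matrix_inv_left_det_1: "matrix_inv A ** A = mat 1"
    and det_matrix_inv_det_1: "det (matrix_inv A) = 1"
    and matrix_inv_eq_cofactor: "matrix_inv A = cofactor_inv A"
proof -
  have "\<exists>B. A ** B = mat 1 \<and> B ** A = mat 1"
    using assms invertible_det_nz[of A] by (simp add: invertible_def)
  from someI_ex[OF this] have 1: "A ** matrix_inv A = mat 1" "matrix_inv A ** A = mat 1"
    by (auto simp: matrix_inv_def)
  show "matrix_inv A ** A = mat 1" by fact
  have "det A * det (matrix_inv A) = 1" by (metis 1(1) det_I det_mul)
  with assms show "det (matrix_inv A) = 1" by simp
  have "matrix_inv A $ i $ j = cofactor_inv A $ i $ j" for i j
  proof -
    define x where "x = matrix_inv A *v axis j 1"
    have Ax: "A *v x = axis j 1" by (simp add: x_def matrix_vector_mul_assoc 1)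
    have "cofactor_inv A $ i $ j = x $ i"
      using cramer_lemma[of i A x, unfolded Ax] assms by (simp add: cofactor_inv_def)
    then show ?thesis by (simp add: x_def matrix_vector_mult_basis column_def)
  qed
  then show "matrix_inv A = cofactor_inv A" by (simp add: vec_eq_iff)
qed

lemma carrier_SL: "carrier SL = {A. det A = 1}" and mult_SL: "A \<otimes>\<^bsub>SL\<^esub> B = A ** B" and one_SL: "\<one>\<^bsub>SL\<^esub> = mat 1"
  by (simp_all add: SL_def)

lemma group_SL: "group (SL :: (real^'n^'n) monoid)"
proof (rule groupI)
  fix A :: "real^'n^'n" assume "A \<in> carrier SL"
  then show "\<exists>y\<in>carrier SL. y \<otimes>\<^bsub>SL\<^esub> A = \<one>\<^bsub>SL\<^esub>"
    by (intro bexI[of _ "matrix_inv A"])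
      (simp_all add: carrier_SL mult_SL one_SL matrix_inv_left_det_1 det_matrix_inv_det_1)
qed (auto simp: carrier_SL mult_SL one_SL det_mul matrix_mul_assoc)

lemma inv_SL: "A \<in> carrier SL \<Longrightarrow> inv\<^bsub>SL\<^esub> A = matrix_inv A"
  by (rule group.inv_equality[OF group_SL])
    (auto simp: carrier_SL mult_SL one_SL matrix_inv_left_det_1 det_matrix_inv_det_1)

lemma closed_carrier_SL: "closed (carrier SL :: (real^'n^'n) set)"
proof -
  have "closed {A :: real^'n^'n. det A = 1}"
    by (intro closed_Collect_eq continuous_on_det continuous_intros)
  then show ?thesis by (simp add: carrier_SL)
qed

lemma space_SL_borel [simp]: "space SL_borel = carrier SL"
  by (simp add: SL_borel_def space_restrict_space)

lemma borel_measurable_SL_borel: "f \<in> borel_measurable borel \<Longrightarrow> f \<in> borel_measurable SL_borel"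
  unfolding SL_borel_def by (rule measurable_restrict_space1)

lemma measurable_SL_borelI:
  assumes "f \<in> borel_measurable M" "\<And>x. x \<in> space M \<Longrightarrow> det (f x) = 1"
  shows "f \<in> measurable M SL_borel"
  unfolding SL_borel_def using assms by (intro measurable_restrict_space2) (auto simp: carrier_SL)

lemma measurable_SL_mult [measurable (raw)]:
  fixes f g :: "'a \<Rightarrow> real^'n^'n"
  assumes f: "f \<in> measurable M SL_borel" and g: "g \<in> measurable M SL_borel"
  shows "(\<lambda>x. f x ** g x) \<in> measurable M SL_borel"
proof (rule measurable_SL_borelI)
  have b: "h \<in> borel_measurable M" if "h \<in> measurable M SL_borel" for h :: "'a \<Rightarrow> real^'n^'n"
    using measurable_compose[OF that borel_measurable_SL_borel[OF measurable_ident]] by simp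
  show "(\<lambda>x. f x ** g x) \<in> borel_measurable M"
    by (rule borel_measurable_continuous_Pair[OF b[OF f] b[OF g]])
      (intro bounded_bilinear.continuous_on[OF bounded_bilinear_matrix_matrix_mult] continuous_intros)
  show "det (f x ** g x) = 1" if "x \<in> space M" for x
    using measurable_space[OF f that] measurable_space[OF g that] by (simp add: carrier_SL det_mul)
qed

lemma measurable_SL_apply [measurable (raw)]:
  fixes f :: "'a \<Rightarrow> real^'n^'n"
  assumes f: "f \<in> measurable M SL_borel" and g: "g \<in> borel_measurable M"
  shows "(\<lambda>x. f x *v g x) \<in> borel_measurable M"
proof -
  have "f \<in> borel_measurable M"
    using measurable_compose[OF f borel_measurable_SL_borel[OF measurable_ident]] by simp
  then show ?thesis
    by (rule borel_measurable_continuous_Pair[OF _ g])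
      (intro bounded_bilinear.continuous_on[OF bounded_bilinear_matrix_vector_mult] continuous_intros)
qed

lemma measurable_SL_inv: "matrix_inv \<in> measurable SL_borel (SL_borel :: (real^'n^'n) measure)"
proof (rule measurable_SL_borelI)
  have "cofactor_inv \<in> borel_measurable (SL_borel :: (real^'n^'n) measure)"
    by (intro borel_measurable_SL_borel borel_measurable_continuous_onI continuous_on_cofactor_inv)
  then show "matrix_inv \<in> borel_measurable (SL_borel :: (real^'n^'n) measure)"
    by (rule measurable_cong[THEN iffD1, rotated]) (simp add: carrier_SL matrix_inv_eq_cofactor)
qed (simp add: carrier_SL det_matrix_inv_det_1)

lemma measurable_log_op_norm [measurable]: "(\<lambda>g. ln (op_norm g)) \<in> borel_measurable (SL_borel :: (real^'n^'n) measure)"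
proof -
  have "op_norm \<in> borel_measurable (SL_borel :: (real^'n^'n) measure)"
    by (intro borel_measurable_SL_borel borel_measurable_continuous_onI op_norm_continuous)
  then show ?thesis by simp
qed

lemma log_op_norm_nonneg: "g \<in> carrier SL \<Longrightarrow> ln (op_norm g) \<ge> 0"
  using op_norm_ge_1[of g] by (simp add: carrier_SL)

section \<open>Subadditive sequences\<close>

text \<open>Fekete's lemma, the limit being the infimum of the quotients. It shows that the
  \<open>lim\<close> in \<open>top_lyapunov\<close> is a genuine limit.\<close>

lemma subadditive_convergent:
  fixes a :: "nat \<Rightarrow> real"
  assumes nonneg: "\<And>k. a k \<ge> 0" and sub: "\<And>k l. a (k + l) \<le> a k + a l"
  shows "convergent (\<lambda>k. 1 / real k * a k)"
proof -
  define L where "L = (INF k\<in>{1..}. a k / k)"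
  have bdd: "bdd_below ((\<lambda>k. a k / k) ` {1..})" using nonneg by (intro bdd_belowI[of _ 0]) auto
  have L_le: "L \<le> a k / k" if "k \<ge> 1" for k unfolding L_def using bdd that by (intro cINF_lower) auto
  have mult: "a (q * m) \<le> q * a m" if "q \<ge> 1" for q m :: nat
    using that
  proof (induction q rule: dec_induct)
    case (step q)
    have "a (Suc q * m) \<le> a m + a (q * m)" using sub[of m "q * m"] by simp
    with step show ?case by (simp add: algebra_simps)
  qed simp
  have "(\<lambda>k. a k / k) \<longlonglongrightarrow> L"
  proof (rule LIMSEQ_I)
    fix \<epsilon> :: real assume \<epsilon>: "\<epsilon> > 0"
    have "\<exists>m\<in>{1..}. a m / m < L + \<epsilon> / 2"
      using cINF_less_iff[OF _ bdd, of "L + \<epsilon> / 2"] \<epsilon> by (simp add: L_def)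
    then obtain m where m: "m \<ge> 1" "a m / m < L + \<epsilon> / 2" by auto
    \<comment> \<open>Bounds the contribution of the remainder when \<open>k\<close> is divided by
      \<open>m\<close>.\<close>
    define K where "K = (\<Sum>r\<le>m. a r)"
    have K: "a r \<le> K" if "r \<le> m" for r unfolding K_def using that nonneg by (intro member_le_sum) auto
    obtain k0 :: nat where k0: "K / (\<epsilon> / 2) < k0" using reals_Archimedean2 by blast
    have "norm (a k / k - L) < \<epsilon>" if k: "k \<ge> max (max m k0) 1" for k
    proof -
      define q where "q = k div m"
      define r where "r = k mod m"
      have qr: "k = q * m + r" "r \<le> m" using m(1) by (simp_all add: q_def r_def less_imp_le)
      have q1: "q \<ge> 1" using k m(1) by (simp add: q_def div_greater_zero_iff Suc_le_eq)
      have "a k \<le> a (q * m) + a r" unfolding qr(1) by (rule sub)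
      also have "\<dots> \<le> q * a m + K" using mult[OF q1] K[OF qr(2)] by (rule add_mono)
      also have "q * a m \<le> real k * (a m / m)"
      proof -
        have "real (q * m) \<le> real k" using qr(1) by simp
        then have "real (q * m) * (a m / m) \<le> real k * (a m / m)"
          using nonneg m(1) by (intro mult_right_mono) auto
        then show ?thesis using m(1) by simp
      qed
      finally have "a k \<le> real k * (a m / m) + K" by simp
      then have "a k / k \<le> a m / m + K / k" using k by (simp add: field_simps)
      moreover have "K / k < \<epsilon> / 2"
      proof -
        have "K < \<epsilon> / 2 * k0" using k0 \<epsilon> by (simp add: field_simps)
        also have "\<dots> \<le> \<epsilon> / 2 * k" using k \<epsilon> by (intro mult_left_mono) auto
        finally show ?thesis using k by (simp add: pos_divide_less_eq)
      qed
      moreover have "L \<le> a k / k" using k by (intro L_le) simp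
      ultimately have "0 \<le> a k / k - L" "a k / k - L < \<epsilon>" using m(2) by argo+
      then show ?thesis by simp
    qed
    then show "\<exists>no. \<forall>n\<ge>no. norm (a n / n - L) < \<epsilon>" by blast
  qed
  then show ?thesis by (auto simp: convergent_def)
qed

section \<open>Convolution powers\<close>

locale SL_walk = prob_space \<mu> for \<mu> :: "(real^'n^'n) measure" +
  assumes sets_\<mu>: "sets \<mu> = sets SL_borel" and symmetric: "symmetric_measure \<mu>"
begin

abbreviation \<nu> where "\<nu> \<equiv> conv_power \<mu>"

lemma space_\<mu>: "space \<mu> = carrier SL"
  using sets_eq_imp_space_eq[OF sets_\<mu>] by simp

lemma sets_\<nu>: "sets (\<nu> k) = sets SL_borel"
  by (cases k) simp_all

lemma space_\<nu>: "space (\<nu> k) = carrier SL"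
  using sets_eq_imp_space_eq[OF sets_\<nu>] by simp

lemma measurable_\<mu>: "measurable \<mu> N = measurable SL_borel N" "measurable N \<mu> = measurable N SL_borel"
proof -
  show "measurable \<mu> N = measurable SL_borel N" by (intro measurable_cong_sets sets_\<mu> refl)
  show "measurable N \<mu> = measurable N SL_borel" by (intro measurable_cong_sets sets_\<mu> refl)
qed

lemma measurable_\<nu>: "measurable (\<nu> k) N = measurable SL_borel N"
  by (intro measurable_cong_sets sets_\<nu> refl)

lemma measurable_pair_\<mu>\<nu>: "measurable (\<mu> \<Otimes>\<^sub>M \<nu> k) N = measurable (SL_borel \<Otimes>\<^sub>M SL_borel) N"
  by (intro measurable_cong_sets sets_pair_measure_cong sets_\<nu> sets_\<mu> refl)

lemma mult_measurable: "(\<lambda>(g, h). g ** h) \<in> measurable (SL_borel \<Otimes>\<^sub>M SL_borel) (SL_borel :: (real^'n^'n) measure)"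
  by measurable

lemma prob_space_\<nu>: "prob_space (\<nu> k)"
proof (induction k)
  case 0
  then show ?case by (simp add: prob_space_return carrier_SL)
next
  case (Suc k)
  interpret N: prob_space "\<nu> k" by fact
  interpret P: pair_prob_space \<mu> "\<nu> k" by unfold_locales
  show ?case by (simp only: conv_power.simps, rule P.prob_space_distr)
      (simp only: measurable_pair_\<mu>\<nu> mult_measurable)
qed

lemma measurable_nn_integral_\<nu>:
  assumes "case_prod f \<in> borel_measurable (N \<Otimes>\<^sub>M SL_borel)"
  shows "(\<lambda>x. \<integral>\<^sup>+h. f x h \<partial>\<nu> k) \<in> borel_measurable N"
proof -
  interpret N: prob_space "\<nu> k" by (rule prob_space_\<nu>)
  have "measurable (N \<Otimes>\<^sub>M \<nu> k) borel = measurable (N \<Otimes>\<^sub>M SL_borel) (borel :: ennreal measure)"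
    by (intro measurable_cong_sets sets_pair_measure_cong sets_\<nu> refl)
  then show ?thesis using assms by (intro N.borel_measurable_nn_integral) simp
qed

lemma measurable_nn_integral_\<mu>:
  assumes "case_prod f \<in> borel_measurable (N \<Otimes>\<^sub>M SL_borel)"
  shows "(\<lambda>x. \<integral>\<^sup>+h. f x h \<partial>\<mu>) \<in> borel_measurable N"
proof -
  have "measurable (N \<Otimes>\<^sub>M \<mu>) borel = measurable (N \<Otimes>\<^sub>M SL_borel) (borel :: ennreal measure)"
    by (intro measurable_cong_sets sets_pair_measure_cong sets_\<mu> refl)
  then show ?thesis using assms by (intro borel_measurable_nn_integral) simp
qed

lemma nn_integral_\<nu>_Suc:
  assumes [measurable]: "\<phi> \<in> borel_measurable SL_borel"
  shows "(\<integral>\<^sup>+x. \<phi> x \<partial>\<nu> (Suc k)) = (\<integral>\<^sup>+g. \<integral>\<^sup>+h. \<phi> (g ** h) \<partial>\<nu> k \<partial>\<mu>)"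
proof -
  interpret N: prob_space "\<nu> k" by (rule prob_space_\<nu>)
  have "(\<integral>\<^sup>+x. \<phi> x \<partial>\<nu> (Suc k)) = (\<integral>\<^sup>+p. \<phi> ((\<lambda>(g, h). g ** h) p) \<partial>(\<mu> \<Otimes>\<^sub>M \<nu> k))"
    by (simp only: conv_power.simps, rule nn_integral_distr)
      (simp_all only: measurable_pair_\<mu>\<nu> mult_measurable measurable_distr_eq1 assms)
  also have "\<dots> = (\<integral>\<^sup>+g. \<integral>\<^sup>+h. \<phi> ((\<lambda>(g, h). g ** h) (g, h)) \<partial>\<nu> k \<partial>\<mu>)"
  proof (rule N.nn_integral_fst[symmetric])
    show "(\<lambda>p. \<phi> ((\<lambda>(g, h). g ** h) p)) \<in> borel_measurable (\<mu> \<Otimes>\<^sub>M \<nu> k)"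
      unfolding measurable_pair_\<mu>\<nu> by measurable
  qed
  finally show ?thesis by simp
qed

text \<open>\<open>conv_power\<close> adds factors on the left; associativity allows a splitting at
  any place, in particular with a single factor on the right as in \<open>Fe_Suc\<close>.\<close>

lemma nn_integral_\<nu>_add:
  "\<phi> \<in> borel_measurable SL_borel \<Longrightarrow> (\<integral>\<^sup>+x. \<phi> x \<partial>\<nu> (k + l)) = (\<integral>\<^sup>+g. \<integral>\<^sup>+h. \<phi> (g ** h) \<partial>\<nu> l \<partial>\<nu> k)"
proof (induction k arbitrary: \<phi>)
  case 0
  note [measurable] = 0
  have "(\<lambda>g. \<integral>\<^sup>+h. \<phi> (g ** h) \<partial>\<nu> l) \<in> borel_measurable SL_borel"
    by (rule measurable_nn_integral_\<nu>) measurable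
  then show ?case by (simp add: nn_integral_return carrier_SL)
next
  case (Suc k)
  note [measurable] = Suc.prems
  have m: "(\<lambda>x. \<integral>\<^sup>+h. \<phi> (x ** h) \<partial>\<nu> l) \<in> borel_measurable SL_borel"
    by (rule measurable_nn_integral_\<nu>) measurable
  have "(\<integral>\<^sup>+x. \<phi> x \<partial>\<nu> (Suc k + l)) = (\<integral>\<^sup>+g. \<integral>\<^sup>+x. \<phi> (g ** x) \<partial>\<nu> (k + l) \<partial>\<mu>)"
    using nn_integral_\<nu>_Suc[OF Suc.prems, of "k + l"] by simp
  also have "\<dots> = (\<integral>\<^sup>+g. \<integral>\<^sup>+x. \<integral>\<^sup>+h. \<phi> (g ** (x ** h)) \<partial>\<nu> l \<partial>\<nu> k \<partial>\<mu>)"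
  proof (rule nn_integral_cong)
    fix g assume "g \<in> space \<mu>"
    then have "g \<in> space SL_borel" by (simp add: space_\<mu>)
    then have "(\<lambda>x. \<phi> (g ** x)) \<in> borel_measurable SL_borel" by measurable
    then show "(\<integral>\<^sup>+x. \<phi> (g ** x) \<partial>\<nu> (k + l)) = (\<integral>\<^sup>+x. \<integral>\<^sup>+h. \<phi> (g ** (x ** h)) \<partial>\<nu> l \<partial>\<nu> k)"
      by (rule Suc.IH)
  qed
  also have "\<dots> = (\<integral>\<^sup>+x. \<integral>\<^sup>+h. \<phi> (x ** h) \<partial>\<nu> l \<partial>\<nu> (Suc k))"
    by (subst nn_integral_\<nu>_Suc[OF m]) (simp add: matrix_mul_assoc)
  finally show ?case .
qed

lemma nn_integral_\<nu>_1:
  assumes [measurable]: "\<phi> \<in> borel_measurable SL_borel"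
  shows "(\<integral>\<^sup>+x. \<phi> x \<partial>\<nu> 1) = (\<integral>\<^sup>+g. \<phi> g \<partial>\<mu>)"
proof -
  have "(\<integral>\<^sup>+x. \<phi> x \<partial>\<nu> (Suc 0)) = (\<integral>\<^sup>+g. \<integral>\<^sup>+h. \<phi> (g ** h) \<partial>\<nu> 0 \<partial>\<mu>)" by (rule nn_integral_\<nu>_Suc) fact
  also have "\<dots> = (\<integral>\<^sup>+g. \<phi> g \<partial>\<mu>)"
  proof (rule nn_integral_cong)
    fix g assume "g \<in> space \<mu>"
    then have "g \<in> space SL_borel" by (simp add: space_\<mu>)
    then have "(\<lambda>x. \<phi> (g ** x)) \<in> borel_measurable SL_borel" by measurable
    then show "(\<integral>\<^sup>+h. \<phi> (g ** h) \<partial>\<nu> 0) = \<phi> g" by (simp add: nn_integral_return carrier_SL)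
  qed
  finally show ?thesis by simp
qed

lemma nn_integral_symmetric:
  assumes "\<phi> \<in> borel_measurable SL_borel"
  shows "(\<integral>\<^sup>+g. \<phi> (matrix_inv g) \<partial>\<mu>) = (\<integral>\<^sup>+g. \<phi> g \<partial>\<mu>)"
proof -
  have "(\<integral>\<^sup>+g. \<phi> g \<partial>\<mu>) = (\<integral>\<^sup>+g. \<phi> g \<partial>distr \<mu> \<mu> matrix_inv)"
    using symmetric by (simp add: symmetric_measure_def)
  also have "\<dots> = (\<integral>\<^sup>+g. \<phi> (matrix_inv g) \<partial>\<mu>)"
    by (rule nn_integral_distr) (simp_all only: measurable_distr_eq1 measurable_\<mu> measurable_SL_inv assms)
  finally show ?thesis by simp
qed

section \<open>The averaging operator and its coefficients on the unit ball\<close>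

lemma nn_integral_lborel_SL:
  assumes "g \<in> carrier SL" "f \<in> borel_measurable borel"
  shows "(\<integral>\<^sup>+x. f (g *v x) \<partial>lborel) = (\<integral>\<^sup>+x. f x \<partial>lborel)"
proof -
  have "(\<integral>\<^sup>+x. f x \<partial>lborel) = (\<integral>\<^sup>+x. f x \<partial>distr lborel borel ((*v) g))"
    using distr_lborel_matrix[of g] assms by (simp add: carrier_SL)
  also have "\<dots> = (\<integral>\<^sup>+x. f (g *v x) \<partial>lborel)"
    using assms by (intro nn_integral_distr) (auto intro!: borel_measurable_continuous_onI linear_continuous_on)
  finally show ?thesis by simp
qed

lemma measurable_pair_\<mu>_lborel:
  "measurable (\<mu> \<Otimes>\<^sub>M (lborel :: (real^'n) measure)) N = measurable (SL_borel \<Otimes>\<^sub>M borel) N"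
  by (intro measurable_cong_sets sets_pair_measure_cong sets_\<mu> sets_lborel refl)

definition ball_ind :: "real^'n \<Rightarrow> ennreal" where "ball_ind = indicator (cball 0 1)"

lemma measurable_ball_ind [measurable]: "ball_ind \<in> borel_measurable borel"
  unfolding ball_ind_def by (intro borel_measurable_indicator borel_closed closed_cball)

text \<open>The averaging operator on functions with values in \<open>ennreal\<close>: Fubini and
  self-adjointness hold there without integrability conditions, and real values are taken only for
  the iterates of the ball indicator, which are at most 1.\<close>

definition avg :: "(real^'n \<Rightarrow> ennreal) \<Rightarrow> real^'n \<Rightarrow> ennreal"
  where "avg u x = (\<integral>\<^sup>+g. u (g *v x) \<partial>\<mu>)"

lemma measurable_avg [measurable (raw)]:
  assumes [measurable]: "u \<in> borel_measurable borel"
  shows "avg u \<in> borel_measurable borel"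
  unfolding avg_def by (rule measurable_nn_integral_\<mu>) measurable

lemma nn_integral_avg:
  assumes [measurable]: "u \<in> borel_measurable borel" "v \<in> borel_measurable borel"
  shows "(\<integral>\<^sup>+x. avg u x * v x \<partial>lborel) = (\<integral>\<^sup>+g. \<integral>\<^sup>+x. u (g *v x) * v x \<partial>lborel \<partial>\<mu>)"
proof -
  interpret P: pair_sigma_finite \<mu> lborel by unfold_locales
  have "(\<integral>\<^sup>+x. avg u x * v x \<partial>lborel) = (\<integral>\<^sup>+x. \<integral>\<^sup>+g. u (g *v x) * v x \<partial>\<mu> \<partial>lborel)"
  proof (rule nn_integral_cong)
    fix x
    have "(\<lambda>g. u (g *v x)) \<in> borel_measurable \<mu>" unfolding measurable_\<mu> by measurable
    then show "avg u x * v x = (\<integral>\<^sup>+g. u (g *v x) * v x \<partial>\<mu>)"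
      by (simp add: avg_def nn_integral_multc)
  qed
  also have "\<dots> = (\<integral>\<^sup>+g. \<integral>\<^sup>+x. u (g *v x) * v x \<partial>lborel \<partial>\<mu>)"
  proof (rule P.Fubini')
    show "(\<lambda>(g, x). u (g *v x) * v x) \<in> borel_measurable (\<mu> \<Otimes>\<^sub>M lborel)"
      unfolding measurable_pair_\<mu>_lborel by measurable
  qed
  finally show ?thesis .
qed

text \<open>Invariance of Lebesgue measure under \<open>g\<close> moves \<open>g\<close> from
  \<open>u\<close> to \<open>v\<close>, where it appears as its inverse; symmetry of \<mu> removes
  the inversion.\<close>

lemma avg_self_adjoint:
  assumes [measurable]: "u \<in> borel_measurable borel" "v \<in> borel_measurable borel"
  shows "(\<integral>\<^sup>+x. avg u x * v x \<partial>lborel) = (\<integral>\<^sup>+x. u x * avg v x \<partial>lborel)"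
proof -
  let ?\<psi> = "\<lambda>g. \<integral>\<^sup>+x. u x * v (g *v x) \<partial>lborel"
  have \<psi>: "?\<psi> \<in> borel_measurable SL_borel"
    by (rule lborel.borel_measurable_nn_integral) measurable
  have "(\<integral>\<^sup>+x. avg u x * v x \<partial>lborel) = (\<integral>\<^sup>+g. \<integral>\<^sup>+x. u (g *v x) * v x \<partial>lborel \<partial>\<mu>)"
    by (rule nn_integral_avg) measurable
  also have "\<dots> = (\<integral>\<^sup>+g. ?\<psi> (matrix_inv g) \<partial>\<mu>)"
  proof (rule nn_integral_cong)
    fix g assume "g \<in> space \<mu>"
    then have g: "det g = 1" by (simp add: space_\<mu> carrier_SL)
    have m: "(\<lambda>x. matrix_inv g *v x) \<in> borel_measurable borel"
      by (intro borel_measurable_continuous_onI linear_continuous_on) auto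
    then have "(\<lambda>x. v (matrix_inv g *v x)) \<in> borel_measurable borel" by simp
    then have "(\<integral>\<^sup>+x. u (g *v x) * v (matrix_inv g *v (g *v x)) \<partial>lborel) = ?\<psi> (matrix_inv g)"
      using g by (intro nn_integral_lborel_SL[of g "\<lambda>x. u x * v (matrix_inv g *v x)"]) (auto simp: carrier_SL)
    then show "(\<integral>\<^sup>+x. u (g *v x) * v x \<partial>lborel) = ?\<psi> (matrix_inv g)"
      using g by (simp add: matrix_vector_mul_assoc matrix_inv_left_det_1)
  qed
  also have "\<dots> = (\<integral>\<^sup>+g. ?\<psi> g \<partial>\<mu>)" by (rule nn_integral_symmetric[OF \<psi>])
  also have "\<dots> = (\<integral>\<^sup>+x. avg v x * u x \<partial>lborel)"
    by (subst nn_integral_avg) (simp_all add: mult.commute)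
  finally show ?thesis by (simp add: mult.commute)
qed

text \<open>The k-th iterate of \<open>avg\<close> at the indicator of the unit ball, as
  \<open>Fe_0\<close> and \<open>Fe_Suc\<close> show. The expression by the convolution power is
  what links it to norms of random products.\<close>

definition Fe :: "nat \<Rightarrow> real^'n \<Rightarrow> ennreal"
  where "Fe k x = (\<integral>\<^sup>+g. ball_ind (g *v x) \<partial>\<nu> k)"

lemma measurable_Fe [measurable]: "Fe k \<in> borel_measurable borel"
  unfolding Fe_def by (rule measurable_nn_integral_\<nu>) measurable

lemma Fe_le_1: "Fe k x \<le> 1"
proof -
  interpret N: prob_space "\<nu> k" by (rule prob_space_\<nu>)
  have "Fe k x \<le> (\<integral>\<^sup>+g. 1 \<partial>\<nu> k)" unfolding Fe_def by (intro nn_integral_mono) (auto simp: ball_ind_def indicator_def)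
  then show ?thesis by (simp add: N.emeasure_space_1)
qed

lemma Fe_0: "Fe 0 x = ball_ind x"
proof -
  have "(\<lambda>g. ball_ind (g *v x)) \<in> borel_measurable SL_borel" by measurable
  then show ?thesis by (simp add: Fe_def nn_integral_return carrier_SL)
qed

lemma Fe_Suc: "Fe (Suc k) x = avg (Fe k) x"
proof -
  interpret N: prob_space "\<nu> k" by (rule prob_space_\<nu>)
  interpret P: pair_sigma_finite \<mu> "\<nu> k" by unfold_locales
  let ?i = ball_ind
  have m [measurable]: "(\<lambda>g. ?i (g *v y)) \<in> borel_measurable SL_borel" for y by measurable
  have "Fe (k + 1) x = (\<integral>\<^sup>+g. \<integral>\<^sup>+h. ?i ((g ** h) *v x) \<partial>\<nu> 1 \<partial>\<nu> k)"
    unfolding Fe_def by (rule nn_integral_\<nu>_add) measurable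
  also have "\<dots> = (\<integral>\<^sup>+g. \<integral>\<^sup>+h. ?i (g *v (h *v x)) \<partial>\<mu> \<partial>\<nu> k)"
  proof (rule nn_integral_cong)
    fix g assume "g \<in> space (\<nu> k)"
    then have "g \<in> space SL_borel" by (simp add: space_\<nu>)
    then have "(\<lambda>h. ?i ((g ** h) *v x)) \<in> borel_measurable SL_borel" by measurable
    then show "(\<integral>\<^sup>+h. ?i ((g ** h) *v x) \<partial>\<nu> 1) = (\<integral>\<^sup>+h. ?i (g *v (h *v x)) \<partial>\<mu>)"
      by (subst nn_integral_\<nu>_1) (auto simp: matrix_vector_mul_assoc)
  qed
  also have "\<dots> = (\<integral>\<^sup>+h. \<integral>\<^sup>+g. ?i (g *v (h *v x)) \<partial>\<nu> k \<partial>\<mu>)"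
  proof (rule P.Fubini')
    show "(\<lambda>(h, g). ?i (g *v (h *v x))) \<in> borel_measurable (\<mu> \<Otimes>\<^sub>M \<nu> k)"
      unfolding measurable_pair_\<mu>\<nu> by measurable
  qed
  finally show ?thesis by (simp add: avg_def Fe_def)
qed

text \<open>Self-adjointness moves iterates from one factor to the other, so the scalar product
  depends on \<open>k + l\<close> alone. These are the moments \<open>c\<close> defined
  below.\<close>

lemma nn_integral_Fe_Fe: "(\<integral>\<^sup>+x. Fe k x * Fe l x \<partial>lborel) = (\<integral>\<^sup>+x. Fe 0 x * Fe (k + l) x \<partial>lborel)"
proof (induction k arbitrary: l)
  case (Suc k)
  have "(\<integral>\<^sup>+x. Fe (Suc k) x * Fe l x \<partial>lborel) = (\<integral>\<^sup>+x. avg (Fe k) x * Fe l x \<partial>lborel)"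
    by (simp add: Fe_Suc)
  also have "\<dots> = (\<integral>\<^sup>+x. Fe k x * avg (Fe l) x \<partial>lborel)" by (rule avg_self_adjoint) measurable
  also have "\<dots> = (\<integral>\<^sup>+x. Fe k x * Fe (Suc l) x \<partial>lborel)" by (simp add: Fe_Suc)
  finally show ?case using Suc by simp
qed simp

definition ball_vol :: real where "ball_vol = measure lborel (cball (0::real^'n) 1)"

lemma emeasure_ball_vol: "emeasure lborel (cball (0::real^'n) 1) = ennreal ball_vol"
  by (simp add: ball_vol_def emeasure_cball content_cball)

lemma ball_vol_pos: "ball_vol > 0"
  by (simp add: ball_vol_def content_cball)

definition F :: "nat \<Rightarrow> real^'n \<Rightarrow> real" where "F k x = enn2real (Fe k x)"
definition c :: "nat \<Rightarrow> real" where "c k = enn2real (\<integral>\<^sup>+x. Fe 0 x * Fe k x \<partial>lborel)"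

lemma measurable_F [measurable]: "F k \<in> borel_measurable borel"
  unfolding F_def by measurable

lemma F_nonneg: "F k x \<ge> 0" by (simp add: F_def)

lemma Fe_eq: "Fe k x = ennreal (F k x)"
  unfolding F_def using order_le_less_trans[OF Fe_le_1[of k x] ennreal_one_less_top] by (simp add: ennreal_enn2real)

lemma c_nonneg: "c k \<ge> 0" by (simp add: c_def)

lemma nn_integral_c: "(\<integral>\<^sup>+x. Fe 0 x * Fe k x \<partial>lborel) = ennreal (c k)" and c_le: "c k \<le> ball_vol"
proof -
  have "(\<integral>\<^sup>+x. Fe 0 x * Fe k x \<partial>lborel) \<le> (\<integral>\<^sup>+x. indicator (cball (0::real^'n) 1) x \<partial>lborel)"
    using Fe_le_1 by (intro nn_integral_mono) (auto simp: Fe_0 ball_ind_def indicator_def)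
  then have le: "(\<integral>\<^sup>+x. Fe 0 x * Fe k x \<partial>lborel) \<le> ennreal ball_vol" by (simp add: emeasure_ball_vol)
  then show 1: "(\<integral>\<^sup>+x. Fe 0 x * Fe k x \<partial>lborel) = ennreal (c k)"
    unfolding c_def using order_le_less_trans[OF le ennreal_less_top] by (simp add: ennreal_enn2real)
  show "c k \<le> ball_vol" using le ball_vol_pos unfolding 1 by simp
qed

lemma c_0: "c 0 = ball_vol"
proof -
  have "(\<integral>\<^sup>+x. Fe 0 x * Fe 0 x \<partial>lborel) = (\<integral>\<^sup>+x. indicator (cball (0::real^'n) 1) x \<partial>lborel)"
    by (intro nn_integral_cong) (auto simp: Fe_0 ball_ind_def indicator_def)
  then show ?thesis using ball_vol_pos by (simp add: c_def emeasure_ball_vol)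
qed

lemma has_integral_F: "has_bochner_integral lborel (\<lambda>x. F k x * F l x) (c (k + l))"
proof (rule has_bochner_integral_nn_integral)
  show "(\<integral>\<^sup>+x. ennreal (F k x * F l x) \<partial>lborel) = ennreal (c (k + l))"
    using nn_integral_Fe_Fe[of k l] by (simp add: Fe_eq ennreal_mult'[OF F_nonneg] nn_integral_c[unfolded Fe_eq])
qed (auto simp: F_nonneg c_nonneg)

text \<open>Submultiplicativity of the operator norm gives subadditivity, and the inequality x \<le>
  1 + x^2 bounds the first moment of the logarithm by the second.\<close>

lemma log_moment_finite:
  assumes "finite_second_moment \<mu>"
  shows "(\<integral>\<^sup>+g. ennreal (ln (op_norm g)) \<partial>\<nu> k) < \<infinity>"
    and "(\<integral>\<^sup>+g. ennreal (ln (op_norm g)) \<partial>\<nu> (k + l)) \<le>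
      (\<integral>\<^sup>+g. ennreal (ln (op_norm g)) \<partial>\<nu> k) + (\<integral>\<^sup>+g. ennreal (ln (op_norm g)) \<partial>\<nu> l)"
proof -
  let ?A = "\<lambda>k. \<integral>\<^sup>+g. ennreal (ln (op_norm g)) \<partial>\<nu> k"
  have meas [measurable]: "(\<lambda>g. ennreal (ln (op_norm g))) \<in> borel_measurable (SL_borel :: (real^'n^'n) measure)" by measurable
  have sub: "?A (k + l) \<le> ?A k + ?A l" for k l
  proof -
    interpret N: prob_space "\<nu> l" by (rule prob_space_\<nu>)
    interpret M: prob_space "\<nu> k" by (rule prob_space_\<nu>)
    have "?A (k + l) = (\<integral>\<^sup>+g. \<integral>\<^sup>+h. ennreal (ln (op_norm (g ** h))) \<partial>\<nu> l \<partial>\<nu> k)"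
      by (rule nn_integral_\<nu>_add) measurable
    also have "\<dots> \<le> (\<integral>\<^sup>+g. \<integral>\<^sup>+h. ennreal (ln (op_norm g)) + ennreal (ln (op_norm h)) \<partial>\<nu> l \<partial>\<nu> k)"
    proof (intro nn_integral_mono)
      fix g h assume "g \<in> space (\<nu> k)" "h \<in> space (\<nu> l)"
      then have g: "det g = 1" and h: "det h = 1" by (simp_all add: space_\<nu> carrier_SL)
      have pos: "op_norm g \<ge> 1" "op_norm h \<ge> 1" "op_norm (g ** h) \<ge> 1"
        using g h by (auto intro!: op_norm_ge_1 simp: det_mul)
      then have "ln (op_norm (g ** h)) \<le> ln (op_norm g * op_norm h)"
        using op_norm_mult[of g h] by (intro ln_mono) auto
      also have "\<dots> = ln (op_norm g) + ln (op_norm h)" using pos by (simp add: ln_mult)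
      finally show "ennreal (ln (op_norm (g ** h))) \<le> ennreal (ln (op_norm g)) + ennreal (ln (op_norm h))"
        using pos by (simp flip: ennreal_plus)
    qed
    also have "\<dots> = (\<integral>\<^sup>+g. ennreal (ln (op_norm g)) + ?A l \<partial>\<nu> k)"
      by (intro nn_integral_cong, subst nn_integral_add) (auto simp: measurable_\<nu> N.emeasure_space_1)
    also have "\<dots> = ?A k + ?A l"
      by (subst nn_integral_add) (auto simp: measurable_\<nu> M.emeasure_space_1)
    finally show ?thesis .
  qed
  then show "?A (k + l) \<le> ?A k + ?A l" .
  have "?A 1 < \<infinity>"
  proof -
    let ?m = "\<lambda>g. ln (max (op_norm g) (op_norm (matrix_inv g)))"
    have "(\<lambda>g. op_norm (matrix_inv g)) \<in> borel_measurable (SL_borel :: (real^'n^'n) measure)"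
      by (rule measurable_compose[OF measurable_SL_inv])
        (intro borel_measurable_SL_borel borel_measurable_continuous_onI op_norm_continuous)
    moreover have "op_norm \<in> borel_measurable (SL_borel :: (real^'n^'n) measure)"
      by (intro borel_measurable_SL_borel borel_measurable_continuous_onI op_norm_continuous)
    ultimately have m: "(\<lambda>g. ennreal ((?m g)\<^sup>2)) \<in> borel_measurable \<mu>" unfolding measurable_\<mu> by simp
    have "?A 1 = (\<integral>\<^sup>+g. ennreal (ln (op_norm g)) \<partial>\<mu>)" by (rule nn_integral_\<nu>_1) measurable
    also have "\<dots> \<le> (\<integral>\<^sup>+g. 1 + ennreal ((?m g)\<^sup>2) \<partial>\<mu>)"
    proof (rule nn_integral_mono)
      fix g assume "g \<in> space \<mu>"
      then have g: "op_norm g \<ge> 1" by (auto intro!: op_norm_ge_1 simp: space_\<mu> carrier_SL)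
      then have "ln (op_norm g) \<le> ?m g" by (intro ln_mono) auto
      also have "?m g \<le> 1 + (?m g)\<^sup>2" using zero_le_power2[of "?m g - 1"] zero_le_power2[of "?m g"]
        by (simp add: power2_eq_square algebra_simps) (smt (verit) mult_nonneg_nonneg zero_le_square)
      finally show "ennreal (ln (op_norm g)) \<le> 1 + ennreal ((?m g)\<^sup>2)"
        by (simp flip: ennreal_plus ennreal_1)
    qed
    also have "\<dots> = 1 + (\<integral>\<^sup>+g. ennreal ((?m g)\<^sup>2) \<partial>\<mu>)"
      using m by (subst nn_integral_add) (auto simp: emeasure_space_1)
    also have "\<dots> < \<infinity>" using assms by (simp add: finite_second_moment_def)
    finally show ?thesis .
  qed
  then show "?A k < \<infinity>"
  proof (induction k)
    case 0
    then show ?case by (simp add: nn_integral_return carrier_SL)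
  next
    case (Suc k)
    then show ?case using sub[of 1 k] by (simp add: order_le_less_trans)
  qed
qed

section \<open>The exponent and the lower bound for the moments\<close>

definition a :: "nat \<Rightarrow> real" where "a k = (\<integral>g. ln (op_norm g) \<partial>\<nu> k)"

lemma AE_log_nonneg: "AE g in \<nu> k. 0 \<le> ln (op_norm g)"
  by (rule AE_I2) (simp add: space_\<nu> log_op_norm_nonneg)

lemma has_integral_log:
  assumes "finite_second_moment \<mu>"
  shows "has_bochner_integral (\<nu> k) (\<lambda>g. ln (op_norm g)) (a k)"
    and "(\<integral>\<^sup>+g. ennreal (ln (op_norm g)) \<partial>\<nu> k) = ennreal (a k)"
proof -
  have m: "(\<lambda>g. ln (op_norm g)) \<in> borel_measurable (\<nu> k)" unfolding measurable_\<nu> by measurable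
  have int: "integrable (\<nu> k) (\<lambda>g. ln (op_norm g))"
    using m AE_log_nonneg log_moment_finite(1)[OF assms] by (rule integrableI_nonneg)
  then show "has_bochner_integral (\<nu> k) (\<lambda>g. ln (op_norm g)) (a k)"
    unfolding a_def by (rule has_bochner_integral_integrable)
  show "(\<integral>\<^sup>+g. ennreal (ln (op_norm g)) \<partial>\<nu> k) = ennreal (a k)"
    unfolding a_def using int AE_log_nonneg by (rule nn_integral_eq_integral)
qed

lemma a_nonneg: "a k \<ge> 0"
  unfolding a_def by (rule integral_nonneg_AE) (rule AE_log_nonneg)

lemma tendsto_top_lyapunov:
  assumes "finite_second_moment \<mu>"
  shows "(\<lambda>k. 1 / real k * a k) \<longlonglongrightarrow> top_lyapunov \<mu>"
proof -
  have "a (k + l) \<le> a k + a l" for k l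
    using log_moment_finite(2)[OF assms, of k l] a_nonneg[of k] a_nonneg[of l]
    by (simp add: has_integral_log(2)[OF assms] flip: ennreal_plus)
  then have "convergent (\<lambda>k. 1 / real k * a k)" by (intro subadditive_convergent a_nonneg)
  then show ?thesis by (simp add: top_lyapunov_def a_def convergent_LIMSEQ_iff)
qed

lemma c_lower:
  assumes "finite_second_moment \<mu>"
  shows "c k \<ge> ball_vol * exp (- real CARD('n) * a k)"
proof -
  let ?n = "real CARD('n)" and ?L = "\<lambda>g :: real^'n^'n. ln (op_norm g)"
  interpret N: prob_space "\<nu> k" by (rule prob_space_\<nu>)
  interpret P: pair_sigma_finite lborel "\<nu> k" by unfold_locales
  have m: "?L \<in> borel_measurable (\<nu> k)" unfolding measurable_\<nu> by measurable
  have "ennreal (c k) = (\<integral>\<^sup>+x. ball_ind x * Fe k x \<partial>lborel)" by (simp add: nn_integral_c[symmetric] Fe_0)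
  also have "\<dots> = (\<integral>\<^sup>+x. \<integral>\<^sup>+g. ball_ind x * ball_ind (g *v x) \<partial>\<nu> k \<partial>lborel)"
  proof (rule nn_integral_cong)
    fix x
    have "(\<lambda>g. ball_ind (g *v x)) \<in> borel_measurable (\<nu> k)" unfolding measurable_\<nu> by measurable
    then show "ball_ind x * Fe k x = (\<integral>\<^sup>+g. ball_ind x * ball_ind (g *v x) \<partial>\<nu> k)"
      by (simp add: Fe_def nn_integral_cmult)
  qed
  also have "\<dots> = (\<integral>\<^sup>+g. \<integral>\<^sup>+x. ball_ind x * ball_ind (g *v x) \<partial>lborel \<partial>\<nu> k)"
  proof (rule P.Fubini'[symmetric])
    have "measurable ((lborel :: (real^'n) measure) \<Otimes>\<^sub>M \<nu> k) (borel :: ennreal measure) = measurable (borel \<Otimes>\<^sub>M SL_borel) borel"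
      by (intro measurable_cong_sets sets_pair_measure_cong sets_\<nu> sets_lborel refl)
    moreover have "(\<lambda>(x, g). ball_ind x * ball_ind (g *v x)) \<in> borel_measurable (borel \<Otimes>\<^sub>M SL_borel)" by measurable
    ultimately show "(\<lambda>(x, g). ball_ind x * ball_ind (g *v x)) \<in> borel_measurable (lborel \<Otimes>\<^sub>M \<nu> k)" by simp
  qed
  also have "\<dots> \<ge> (\<integral>\<^sup>+g. ennreal (ball_vol * exp (- ?n * ?L g)) \<partial>\<nu> k)"
  proof (rule nn_integral_mono)
    fix g assume "g \<in> space (\<nu> k)"
    then have g1: "op_norm g \<ge> 1" by (auto intro!: op_norm_ge_1 simp: space_\<nu> carrier_SL)
    \<comment> \<open>The ball of this radius lies in the unit ball, the operator norm being at
      least 1, and \<open>g\<close> maps it into the unit ball; its volume is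
      \<open>ball_vol * r ^ CARD('n)\<close>.\<close>
    define r where "r = 1 / op_norm g"
    have r: "0 < r" "r \<le> 1" "op_norm g * r = 1" using g1 by (auto simp: r_def)
    have "exp (- ?n * ?L g) = r ^ CARD('n)"
    proof -
      have "exp (- ?n * ?L g) = exp (- ?L g) ^ CARD('n)" by (simp add: exp_of_nat_mult[symmetric])
      also have "exp (- ?L g) = r" using g1 by (simp add: exp_minus r_def inverse_eq_divide)
      finally show ?thesis .
    qed
    then have "ennreal (ball_vol * exp (- ?n * ?L g)) = emeasure lborel (cball (0::real^'n) r)"
      using r by (simp add: ball_vol_def content_cball emeasure_cball)
    also have "\<dots> = (\<integral>\<^sup>+x. indicator (cball (0::real^'n) r) x \<partial>lborel)" by simp
    also have "\<dots> \<le> (\<integral>\<^sup>+x. ball_ind x * ball_ind (g *v x) \<partial>lborel)"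
    proof (rule nn_integral_mono)
      fix x :: "real^'n"
      have "norm (g *v x) \<le> 1" if "norm x \<le> r"
        using op_norm[of g x] mult_left_mono[OF that op_norm_nonneg[of g]] r(3) by simp
      then show "indicator (cball 0 r) x \<le> ball_ind x * ball_ind (g *v x)"
        using r(2) by (auto simp: ball_ind_def indicator_def)
    qed
    finally show "ennreal (ball_vol * exp (- ?n * ?L g)) \<le> (\<integral>\<^sup>+x. ball_ind x * ball_ind (g *v x) \<partial>lborel)" .
  qed
  finally have le: "(\<integral>\<^sup>+g. ennreal (ball_vol * exp (- ?n * ?L g)) \<partial>\<nu> k) \<le> ennreal (c k)" .
  have L: "has_bochner_integral (\<nu> k) ?L (a k)" by (rule has_integral_log(1)[OF assms])
  have int: "integrable (\<nu> k) (\<lambda>g. ball_vol * exp (- ?n * ?L g))"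
  proof (rule N.integrable_const_bound[of _ ball_vol])
    show "AE g in \<nu> k. norm (ball_vol * exp (- ?n * ?L g)) \<le> ball_vol"
      using AE_log_nonneg[of k] by eventually_elim (use ball_vol_pos in \<open>auto simp: mult_le_cancel_left1\<close>)
  qed (use m in measurable)
  \<comment> \<open>The tangent line of the exponential at the mean value \<open>a k\<close>;
    integrating it is Jensen's inequality.\<close>
  let ?h = "\<lambda>g. ball_vol * exp (- ?n * a k) * (1 + ?n * a k - ?n * ?L g)"
  have h: "has_bochner_integral (\<nu> k) ?h (ball_vol * exp (- ?n * a k) * ((1 + ?n * a k) * measure (\<nu> k) (space (\<nu> k)) - ?n * a k))"
    by (intro has_bochner_integral_mult_right has_bochner_integral_diff L)
      (simp add: has_bochner_integral_iff)
  have "ball_vol * exp (- ?n * a k) = (\<integral>g. ?h g \<partial>\<nu> k)"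
    using has_bochner_integral_integral_eq[OF h] by (simp add: N.prob_space)
  also have "\<dots> \<le> (\<integral>g. ball_vol * exp (- ?n * ?L g) \<partial>\<nu> k)"
  proof (rule integral_mono[OF integrable.intros[OF h] int])
    fix g
    have "exp (- ?n * a k) * (1 + (?n * a k - ?n * ?L g)) \<le> exp (- ?n * a k) * exp (?n * a k - ?n * ?L g)"
      by (intro mult_left_mono exp_ge_add_one_self) auto
    also have "\<dots> = exp (- ?n * ?L g)" by (simp add: exp_add[symmetric])
    finally have "ball_vol * (exp (- ?n * a k) * (1 + (?n * a k - ?n * ?L g))) \<le> ball_vol * exp (- ?n * ?L g)"
      using ball_vol_pos by (intro mult_left_mono) auto
    then show "?h g \<le> ball_vol * exp (- ?n * ?L g)" by (simp add: mult.assoc add_diff_eq)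
  qed
  also have "ennreal \<dots> = (\<integral>\<^sup>+g. ennreal (ball_vol * exp (- ?n * ?L g)) \<partial>\<nu> k)"
    using int ball_vol_pos by (intro nn_integral_eq_integral[symmetric]) auto
  finally show ?thesis using le c_nonneg[of k] ennreal_le_iff order_trans
    by (smt (verit) ennreal_leI int integral_nonneg_AE nn_integral_eq_integral)
qed

end

section \<open>Almost invariant functions\<close>

text \<open>
  In spectral terms \<open>c k\<close> is the \<open>k\<close>-th moment of a measure on \<open>[-1, 1]\<close>; if the moments do not decay exponentially,
  the measure charges every neighbourhood of the endpoints.
\<close>

lemma moment_ratio:
  fixes c :: "nat \<Rightarrow> real"
  assumes v: "v > 0" and c0: "c 0 \<le> v" and bdd: "\<And>k. c k \<le> v"
    and convex: "\<And>k. c (2 * k) - 2 * c (2 * k + 2) + c (2 * k + 4) \<ge> 0"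
    and cross: "\<And>k \<delta>. 2 * \<delta> * (c (2 * k + 1) - c (2 * k + 3)) \<le> \<delta>\<^sup>2 * c (2 * k + 2) + (c (2 * k) - 2 * c (2 * k + 2) + c (2 * k + 4))"
    and lower: "\<And>\<tau>. \<tau> > 0 \<Longrightarrow> \<exists>K. \<forall>k\<ge>K. c k \<ge> v * exp (- \<tau> * real k)" and \<eta>: "\<eta> > 0"
  shows "\<exists>k. c (2 * k) > 0 \<and> 2 * (c (2 * k) + c (2 * k + 1) - c (2 * k + 2) - c (2 * k + 3)) \<le> \<eta> * c (2 * k)"
proof -
  \<comment> \<open>Even moments are the squared norms of the iterates, which makes them accessible
    by convexity.\<close>
  define e where "e = (\<lambda>k. c (2 * k))"
  have c2: "c (2 * k) = e k" "c (2 * k + 2) = e (k + 1)" "c (2 * k + 4) = e (k + 2)" for k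
    unfolding e_def by (auto intro!: arg_cong[of _ _ c])
  have e2: "e k - 2 * e (k + 1) + e (k + 2) \<ge> 0" for k
    using convex[of k] unfolding c2 .
  \<comment> \<open>A convex sequence that increases once grows at least linearly from there on,
    against the bound \<open>v\<close>.\<close>
  have dec: "e (k + 1) \<le> e k" for k
  proof (rule ccontr)
    assume "\<not> e (k + 1) \<le> e k"
    define d where "d = e (k + 1) - e k"
    have d: "d > 0" using \<open>\<not> e (k + 1) \<le> e k\<close> by (simp add: d_def)
    have diff: "e (k + j + 1) - e (k + j) \<ge> d" for j
    proof (induction j)
      case (Suc j)
      then show ?case using e2[of "k + j"] by simp
    qed (simp add: d_def)
    have "e (k + j) \<ge> e k + j * d" for j
    proof (induction j)
      case (Suc j)
      then show ?case using diff[of j] by (simp add: algebra_simps)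
    qed simp
    moreover obtain j :: nat where "v - e k < j * d" using reals_Archimedean3[OF d] by blast
    ultimately have "e (k + j) > v" by (smt (verit))
    with bdd show False by (simp add: e_def leD)
  qed
  have mono: "e l \<le> e k" if "k \<le> l" for k l
    using that by (induction l rule: dec_induct) (use dec in \<open>auto intro: order_trans simp del: One_nat_def simp add: Suc_eq_plus1\<close>)
  have pos: "e k > 0" for k
  proof -
    obtain K where K: "\<And>k. k \<ge> K \<Longrightarrow> c k \<ge> v * exp (- 1 * real k)" using lower[of 1] by auto
    have "0 < v * exp (- 1 * real (2 * (k + K)))" using v by simp
    also have "\<dots> \<le> e (k + K)" unfolding e_def by (rule K) simp
    also have "\<dots> \<le> e k" by (rule mono) simp
    finally show ?thesis .
  qed
  define \<epsilon> where "\<epsilon> = min (1/2) (min (\<eta> / 8) (\<eta>\<^sup>2 / 8))"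
  have \<epsilon>: "0 < \<epsilon>" "\<epsilon> \<le> 1/2" "\<epsilon> \<le> \<eta> / 8" "\<epsilon> \<le> \<eta>\<^sup>2 / 8" using \<eta> unfolding \<epsilon>_def by auto
  \<comment> \<open>Otherwise the even moments decay exponentially at rate \<open>q\<close>. The
    rate \<open>q / 4\<close> in \<open>lower\<close>, doubled by the index \<open>2 * k\<close>, is
    half of that and gives a contradiction.\<close>
  have "\<exists>k. e (k + 1) \<ge> (1 - \<epsilon>) * e k"
  proof (rule ccontr)
    assume "\<not> ?thesis"
    then have less: "e (k + 1) < (1 - \<epsilon>) * e k" for k by (simp add: not_le)
    define q where "q = - ln (1 - \<epsilon>)"
    have q: "q > 0" "exp (- q) = 1 - \<epsilon>" using \<epsilon> by (auto simp: q_def)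
    have up: "e k \<le> v * exp (- q * k)" for k
    proof (induction k)
      case (Suc k)
      have "e (Suc k) \<le> (1 - \<epsilon>) * e k" using less[of k] by simp
      also have "\<dots> \<le> (1 - \<epsilon>) * (v * exp (- q * k))" using Suc \<epsilon> by (intro mult_left_mono) auto
      also have "\<dots> = v * (exp (- q) * exp (- q * k))" by (simp add: q(2))
      also have "\<dots> = v * exp (- q * Suc k)" by (simp add: exp_add[symmetric] algebra_simps)
      finally show ?case .
    qed (simp add: e_def c0)
    obtain K where K: "\<And>k. k \<ge> K \<Longrightarrow> c k \<ge> v * exp (- (q / 4) * real k)" using lower[of "q / 4"] q by auto
    have "v * exp (- (q / 4) * real (2 * (K + 1))) \<le> e (K + 1)" unfolding e_def by (rule K) simp
    also have "\<dots> \<le> v * exp (- q * real (K + 1))" by (rule up)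
    finally have "- (q / 4) * real (2 * (K + 1)) \<le> - q * real (K + 1)" using v by simp
    then have "q * real (K + 1) \<le> 0" by (simp add: algebra_simps)
    moreover have "q * real (K + 1) > 0" using q by simp
    ultimately show False by linarith
  qed
  then obtain k where k: "e (k + 1) \<ge> (1 - \<epsilon>) * e k" by blast
  have X: "e k - 2 * e (k + 1) + e (k + 2) \<le> \<epsilon> * e k"
    using k dec[of "k + 1"] by (simp add: algebra_simps)
  \<comment> \<open>Convexity says nothing about the odd moments; their difference is bounded by
    \<open>cross\<close> with \<eta>/4 for \<delta>.\<close>
  have "\<eta> / 2 * (c (2 * k + 1) - c (2 * k + 3)) \<le> \<eta>\<^sup>2 / 16 * e k + \<eta>\<^sup>2 / 8 * e k"
  proof -
    have "\<eta> / 2 * (c (2 * k + 1) - c (2 * k + 3)) \<le> (\<eta> / 4)\<^sup>2 * e (k + 1) + (e k - 2 * e (k + 1) + e (k + 2))"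
      using cross[of "\<eta> / 4" k] unfolding c2 by simp
    also have "\<dots> \<le> (\<eta> / 4)\<^sup>2 * e k + \<eta>\<^sup>2 / 8 * e k"
    proof (rule add_mono)
      show "(\<eta> / 4)\<^sup>2 * e (k + 1) \<le> (\<eta> / 4)\<^sup>2 * e k" by (intro mult_left_mono dec) simp
      have "\<epsilon> * e k \<le> \<eta>\<^sup>2 / 8 * e k" using \<epsilon>(4) pos[of k] by (intro mult_right_mono) auto
      with X show "e k - 2 * e (k + 1) + e (k + 2) \<le> \<eta>\<^sup>2 / 8 * e k" by linarith
    qed
    finally show ?thesis by (simp add: power2_eq_square)
  qed
  then have "\<eta> * (c (2 * k + 1) - c (2 * k + 3)) \<le> \<eta> * (3 * \<eta> / 8 * e k)"
    by (simp add: power2_eq_square algebra_simps)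
  then have 1: "c (2 * k + 1) - c (2 * k + 3) \<le> 3 * \<eta> / 8 * e k" using \<eta> by simp
  have "\<epsilon> * e k \<le> \<eta> / 8 * e k" using \<epsilon>(3) pos[of k] by (intro mult_right_mono) auto
  with k have 2: "e k - e (k + 1) \<le> \<eta> / 8 * e k" by (simp add: algebra_simps)
  have "2 * (c (2 * k) + c (2 * k + 1) - c (2 * k + 2) - c (2 * k + 3)) \<le> \<eta> * c (2 * k)"
    unfolding c2 using 1 2 by argo
  then show ?thesis using pos[of k] by (auto simp: e_def)
qed

section \<open>Norms and displacements expressed by moments\<close>

context SL_walk
begin

lemma has_integral_lborel_SL:
  fixes f :: "real^'n \<Rightarrow> real"
  assumes g: "g \<in> carrier SL" and f: "has_bochner_integral lborel f r"
  shows "has_bochner_integral lborel (\<lambda>x. f (g *v x)) r"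
proof -
  have m: "(*v) g \<in> measurable lborel borel"
    by (simp add: borel_measurable_continuous_onI linear_continuous_on)
  have d: "distr lborel borel ((*v) g) = lborel" using g by (intro distr_lborel_matrix) (simp add: carrier_SL)
  have fm: "f \<in> borel_measurable borel" using f by (auto simp: has_bochner_integral_iff)
  have "integrable lborel (\<lambda>x. f (g *v x)) \<longleftrightarrow> integrable lborel f"
    using integrable_distr_eq[OF m fm] by (simp add: d)
  moreover have "(\<integral>x. f x \<partial>lborel) = (\<integral>x. f (g *v x) \<partial>lborel)"
    using integral_distr[OF m fm] by (simp add: d)
  ultimately show ?thesis using f by (simp add: has_bochner_integral_iff)
qed

text \<open>Both are integrals of squares: of \<open>F k - F (k + 2)\<close>, and of
  \<open>\<delta> * F (k + 1)\<close> minus that difference, which is Cauchy-Schwarz in a form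
  without roots.\<close>

lemma c_convex: "c (2 * k) - 2 * c (2 * k + 2) + c (2 * k + 4) \<ge> 0"
  and c_cross: "2 * \<delta> * (c (2 * k + 1) - c (2 * k + 3)) \<le> \<delta>\<^sup>2 * c (2 * k + 2) + (c (2 * k) - 2 * c (2 * k + 2) + c (2 * k + 4))"
proof -
  have idx: "k + k = 2 * k" "k + 1 + (k + 1) = 2 * k + 2" "k + (k + 2) = 2 * k + 2" "k + 2 + (k + 2) = 2 * k + 4"
    "k + (k + 1) = 2 * k + 1" "k + 1 + (k + 2) = 2 * k + 3" by simp_all
  note hI = has_integral_F[of k k, unfolded idx] has_integral_F[of k "k + 2", unfolded idx]
    has_integral_F[of "k + 2" "k + 2", unfolded idx] has_integral_F[of "k + 1" "k + 1", unfolded idx]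
    has_integral_F[of k "k + 1", unfolded idx] has_integral_F[of "k + 1" "k + 2", unfolded idx]
  have 1: "has_bochner_integral lborel (\<lambda>x. F k x * F k x - 2 * (F k x * F (k + 2) x) + F (k + 2) x * F (k + 2) x)
      (c (2 * k) - 2 * c (2 * k + 2) + c (2 * k + 4))"
    by (intro has_bochner_integral_add has_bochner_integral_diff has_bochner_integral_mult_right hI)
  have nn1: "F k x * F k x - 2 * (F k x * F (k + 2) x) + F (k + 2) x * F (k + 2) x \<ge> 0" for x
    using zero_le_power2[of "F k x - F (k + 2) x"] by (simp add: power2_eq_square algebra_simps)
  show "c (2 * k) - 2 * c (2 * k + 2) + c (2 * k + 4) \<ge> 0"
    using has_bochner_integral_integral_eq[OF 1] nn1 by (metis (no_types, lifting) integral_nonneg_AE AE_I2)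
  have 2: "has_bochner_integral lborel
      (\<lambda>x. \<delta>\<^sup>2 * (F (k + 1) x * F (k + 1) x) + (F k x * F k x - 2 * (F k x * F (k + 2) x) + F (k + 2) x * F (k + 2) x)
        - 2 * \<delta> * (F k x * F (k + 1) x - F (k + 1) x * F (k + 2) x))
      (\<delta>\<^sup>2 * c (2 * k + 2) + (c (2 * k) - 2 * c (2 * k + 2) + c (2 * k + 4)) - 2 * \<delta> * (c (2 * k + 1) - c (2 * k + 3)))"
    by (intro has_bochner_integral_add has_bochner_integral_diff has_bochner_integral_mult_right hI)
  have nn2: "\<delta>\<^sup>2 * (F (k + 1) x * F (k + 1) x) + (F k x * F k x - 2 * (F k x * F (k + 2) x) + F (k + 2) x * F (k + 2) x)
        - 2 * \<delta> * (F k x * F (k + 1) x - F (k + 1) x * F (k + 2) x) \<ge> 0" for x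
    using zero_le_power2[of "\<delta> * F (k + 1) x - (F k x - F (k + 2) x)"] by (simp add: power2_eq_square algebra_simps)
  have "0 \<le> \<delta>\<^sup>2 * c (2 * k + 2) + (c (2 * k) - 2 * c (2 * k + 2) + c (2 * k + 4)) - 2 * \<delta> * (c (2 * k + 1) - c (2 * k + 3))"
    unfolding has_bochner_integral_integral_eq[OF 2, symmetric] by (rule integral_nonneg_AE, rule AE_I2, rule nn2)
  then show "2 * \<delta> * (c (2 * k + 1) - c (2 * k + 3)) \<le> \<delta>\<^sup>2 * c (2 * k + 2) + (c (2 * k) - 2 * c (2 * k + 2) + c (2 * k + 4))"
    by simp
qed

text \<open>A nonpositive exponent makes \<open>a k\<close> eventually smaller than any positive
  multiple of \<open>k\<close>, and \<open>c_lower\<close> turns this into a bound for the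
  moments.\<close>

lemma c_subexponential:
  assumes fsm: "finite_second_moment \<mu>" and lyap: "top_lyapunov \<mu> \<le> 0" and \<tau>: "\<tau> > 0"
  shows "\<exists>K. \<forall>k\<ge>K. c k \<ge> ball_vol * exp (- \<tau> * real k)"
proof -
  let ?n = "real CARD('n)"
  have n: "?n > 0" by simp
  have "top_lyapunov \<mu> < \<tau> / ?n" using lyap \<tau> n by (smt (verit) divide_pos_pos)
  then have "eventually (\<lambda>k. 1 / real k * a k < \<tau> / ?n) sequentially"
    using tendsto_top_lyapunov[OF fsm] by (rule order_tendstoD(2)[rotated])
  then obtain K where K: "\<And>k. k \<ge> K \<Longrightarrow> 1 / real k * a k < \<tau> / ?n" by (auto simp: eventually_sequentially)
  have "c k \<ge> ball_vol * exp (- \<tau> * real k)" if k: "k \<ge> K + 1" for k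
  proof -
    have "a k / real k < \<tau> / ?n" using K[of k] k by simp
    then have "?n * a k \<le> \<tau> * real k" using n k by (simp add: divide_simps mult_ac)
    then have "ball_vol * exp (- \<tau> * real k) \<le> ball_vol * exp (- ?n * a k)"
      using ball_vol_pos by (intro mult_left_mono) auto
    also have "\<dots> \<le> c k" by (rule c_lower[OF fsm])
    finally show ?thesis .
  qed
  then show ?thesis by blast
qed

text \<open>Write A for the averaging operator. The function \<open>G\<close> is (1 + A) applied to
  \<open>F k\<close>, a factor that suppresses the spectrum near -1, where averaging nearly reverses
  the sign. The mean squared displacement is twice the quadratic form of 1 - A at \<open>G\<close>,
  and (1 - A)(1 + A)^2 = 1 + A - A^2 - A^3 accounts for the four moments.\<close>

lemma nn_integral_translation_distance:
  fixes k :: nat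
  defines "G \<equiv> \<lambda>x. F k x + F (k + 1) x"
  shows "has_bochner_integral lborel (\<lambda>x. (G x)\<^sup>2) (c (2 * k) + 2 * c (2 * k + 1) + c (2 * k + 2))"
    and "(\<integral>\<^sup>+g. ennreal (\<integral>x. (G (g *v x) - G x)\<^sup>2 \<partial>lborel) \<partial>\<mu>)
      = ennreal (2 * (c (2 * k) + c (2 * k + 1) - c (2 * k + 2) - c (2 * k + 3)))"
proof -
  have idx: "k + k = 2 * k" "k + 1 + (k + 1) = 2 * k + 2" "k + (k + 1) = 2 * k + 1"
    "k + 1 + k = 2 * k + 1" "k + 2 + k = 2 * k + 2" "k + 2 + (k + 1) = 2 * k + 3" by simp_all
  note hI = has_integral_F[of k k, unfolded idx] has_integral_F[of k "k + 1", unfolded idx]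
    has_integral_F[of "k + 1" "k + 1", unfolded idx] has_integral_F[of "k + 1" k, unfolded idx]
    has_integral_F[of "k + 2" k, unfolded idx] has_integral_F[of "k + 2" "k + 1", unfolded idx]
  define N where "N = c (2 * k) + 2 * c (2 * k + 1) + c (2 * k + 2)"
  define R where "R = (c (2 * k + 1) + c (2 * k + 2)) + (c (2 * k + 2) + c (2 * k + 3))"
  have Gm [measurable]: "G \<in> borel_measurable borel" unfolding G_def by measurable
  have G_nonneg: "G x \<ge> 0" for x by (simp add: G_def F_nonneg)
  have "has_bochner_integral lborel (\<lambda>x. F k x * F k x + 2 * (F k x * F (k + 1) x) + F (k + 1) x * F (k + 1) x) N"
    unfolding N_def by (intro has_bochner_integral_add has_bochner_integral_mult_right hI)
  moreover have "(\<lambda>x. F k x * F k x + 2 * (F k x * F (k + 1) x) + F (k + 1) x * F (k + 1) x) = (\<lambda>x. (G x)\<^sup>2)"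
    by (auto simp: G_def power2_eq_square algebra_simps)
  ultimately have N: "has_bochner_integral lborel (\<lambda>x. (G x)\<^sup>2) N" by simp
  then show "has_bochner_integral lborel (\<lambda>x. (G x)\<^sup>2) (c (2 * k) + 2 * c (2 * k + 1) + c (2 * k + 2))"
    by (simp add: N_def)
  define J where "J = (\<lambda>g. \<integral>\<^sup>+x. ennreal (G (g *v x)) * ennreal (G x) \<partial>lborel)"
  define I where "I = (\<lambda>g. \<integral>x. G (g *v x) * G x \<partial>lborel)"
  have JI: "J g = ennreal (I g)" and int: "integrable lborel (\<lambda>x. G (g *v x) * G x)" if g: "g \<in> carrier SL" for g
  proof -
    have gm: "(\<lambda>x. g *v x) \<in> borel_measurable borel"
      by (intro borel_measurable_continuous_onI linear_continuous_on) auto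
    then have m: "(\<lambda>x. G (g *v x) * G x) \<in> borel_measurable borel" by measurable
    have "integrable lborel (\<lambda>x. (G (g *v x))\<^sup>2 + (G x)\<^sup>2)"
      using has_integral_lborel_SL[OF g N] N by (auto simp: has_bochner_integral_iff)
    then show int: "integrable lborel (\<lambda>x. G (g *v x) * G x)"
    proof (rule Bochner_Integration.integrable_bound)
      show "AE x in lborel. norm (G (g *v x) * G x) \<le> norm ((G (g *v x))\<^sup>2 + (G x)\<^sup>2)"
      proof (rule AE_I2)
        fix x
        have "2 * (G (g *v x) * G x) \<le> (G (g *v x))\<^sup>2 + (G x)\<^sup>2"
          using zero_le_power2[of "G (g *v x) - G x"] by (simp add: power2_eq_square algebra_simps)
        moreover have "0 \<le> G (g *v x) * G x" using G_nonneg by simp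
        ultimately show "norm (G (g *v x) * G x) \<le> norm ((G (g *v x))\<^sup>2 + (G x)\<^sup>2)" by simp
      qed
    qed (use m in simp)
    have "J g = (\<integral>\<^sup>+x. ennreal (G (g *v x) * G x) \<partial>lborel)" by (simp add: J_def ennreal_mult' G_nonneg)
    also have "\<dots> = ennreal (I g)" unfolding I_def using int by (intro nn_integral_eq_integral) (auto simp: G_nonneg)
    finally show "J g = ennreal (I g)" .
  qed
  have J_meas: "J \<in> borel_measurable \<mu>"
    unfolding J_def measurable_\<mu> by (rule lborel.borel_measurable_nn_integral) measurable
  define u where "u = (\<lambda>x. ennreal (G x))"
  have u: "u = (\<lambda>x. Fe k x + Fe (k + 1) x)" by (auto simp: u_def G_def Fe_eq F_nonneg)
  have um: "u \<in> borel_measurable borel" unfolding u_def by measurable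
  have avg_u: "avg u x = Fe (k + 1) x + Fe (k + 2) x" for x
  proof -
    have "(\<lambda>g. Fe k (g *v x)) \<in> borel_measurable \<mu>" "(\<lambda>g. Fe (k + 1) (g *v x)) \<in> borel_measurable \<mu>"
      unfolding measurable_\<mu> by measurable
    then have "avg u x = avg (Fe k) x + avg (Fe (k + 1)) x"
      unfolding u avg_def by (rule nn_integral_add)
    then show ?thesis using Fe_Suc[of k x] Fe_Suc[of "k + 1" x] by simp
  qed
  have "(\<integral>\<^sup>+g. J g \<partial>\<mu>) = (\<integral>\<^sup>+x. avg u x * u x \<partial>lborel)"
    unfolding J_def by (subst nn_integral_avg[OF um um]) (simp add: u_def)
  also have "\<dots> = (\<integral>\<^sup>+x. ennreal ((F (k + 1) x + F (k + 2) x) * G x) \<partial>lborel)"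
  proof (rule nn_integral_cong)
    fix x
    have "avg u x = ennreal (F (k + 1) x + F (k + 2) x)" unfolding avg_u by (simp add: Fe_eq F_nonneg)
    then show "avg u x * u x = ennreal ((F (k + 1) x + F (k + 2) x) * G x)"
      by (simp add: u_def ennreal_mult' F_nonneg)
  qed
  also have "\<dots> = ennreal R"
  proof -
    have "has_bochner_integral lborel (\<lambda>x. (F (k + 1) x * F k x + F (k + 1) x * F (k + 1) x)
        + (F (k + 2) x * F k x + F (k + 2) x * F (k + 1) x)) R"
      unfolding R_def by (intro has_bochner_integral_add hI)
    moreover have "(\<lambda>x. (F (k + 1) x * F k x + F (k + 1) x * F (k + 1) x)
        + (F (k + 2) x * F k x + F (k + 2) x * F (k + 1) x)) = (\<lambda>x. (F (k + 1) x + F (k + 2) x) * G x)"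
      by (auto simp: G_def algebra_simps)
    ultimately have "has_bochner_integral lborel (\<lambda>x. (F (k + 1) x + F (k + 2) x) * G x) R" by simp
    then show ?thesis
      using nn_integral_eq_integral[of lborel "\<lambda>x. (F (k + 1) x + F (k + 2) x) * G x"]
      by (simp add: has_bochner_integral_iff F_nonneg G_nonneg)
  qed
  finally have J_int: "(\<integral>\<^sup>+g. J g \<partial>\<mu>) = ennreal R" .
  have R_nonneg: "R \<ge> 0" using c_nonneg by (simp add: R_def)
  have D: "(\<integral>x. (G (g *v x) - G x)\<^sup>2 \<partial>lborel) = 2 * N - 2 * I g" if g: "g \<in> carrier SL" for g
  proof -
    have "has_bochner_integral lborel (\<lambda>x. (G (g *v x))\<^sup>2 + (G x)\<^sup>2 - 2 * (G (g *v x) * G x)) (N + N - 2 * I g)"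
      unfolding I_def
      by (intro has_bochner_integral_add has_bochner_integral_diff has_bochner_integral_mult_right
          has_integral_lborel_SL[OF g N] N has_bochner_integral_integrable int[OF g])
    moreover have "(\<lambda>x. (G (g *v x))\<^sup>2 + (G x)\<^sup>2 - 2 * (G (g *v x) * G x)) = (\<lambda>x. (G (g *v x) - G x)\<^sup>2)"
      by (auto simp: power2_eq_square algebra_simps)
    ultimately show ?thesis using has_bochner_integral_integral_eq by fastforce
  qed
  have I_nonneg: "I g \<ge> 0" for g unfolding I_def by (intro integral_nonneg_AE AE_I2) (simp add: G_nonneg)
  have J_enn: "I g = enn2real (J g)" if "g \<in> carrier SL" for g using JI[OF that] I_nonneg by simp
  have I_meas: "I \<in> borel_measurable \<mu>"
  proof (rule measurable_cong[THEN iffD1])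
    show "(\<lambda>g. enn2real (J g)) \<in> borel_measurable \<mu>" using J_meas by simp
  qed (simp add: J_enn space_\<mu>)
  have "has_bochner_integral \<mu> I R"
  proof (rule has_bochner_integral_nn_integral[OF I_meas])
    have "(\<integral>\<^sup>+g. ennreal (I g) \<partial>\<mu>) = (\<integral>\<^sup>+g. J g \<partial>\<mu>)"
      by (intro nn_integral_cong) (simp add: JI space_\<mu>)
    then show "(\<integral>\<^sup>+g. ennreal (I g) \<partial>\<mu>) = ennreal R" by (simp add: J_int)
  qed (simp_all add: I_nonneg R_nonneg)
  then have hb: "has_bochner_integral \<mu> (\<lambda>g. 2 * N - 2 * I g) (2 * N - 2 * R)"
    by (intro has_bochner_integral_diff has_bochner_integral_mult_right)
      (simp_all add: has_bochner_integral_iff prob_space)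
  have D_nonneg: "0 \<le> 2 * N - 2 * I g" if "g \<in> carrier SL" for g
    unfolding D[OF that, symmetric] by (intro integral_nonneg_AE AE_I2) simp
  have "(\<integral>\<^sup>+g. ennreal (\<integral>x. (G (g *v x) - G x)\<^sup>2 \<partial>lborel) \<partial>\<mu>) = (\<integral>\<^sup>+g. ennreal (2 * N - 2 * I g) \<partial>\<mu>)"
    by (intro nn_integral_cong) (simp add: D space_\<mu>)
  also have "\<dots> = ennreal (2 * N - 2 * R)"
  proof -
    have "AE g in \<mu>. 0 \<le> 2 * N - 2 * I g" by (rule AE_I2) (use D_nonneg in \<open>simp add: space_\<mu>\<close>)
    with hb show ?thesis using nn_integral_eq_integral[of \<mu> "\<lambda>g. 2 * N - 2 * I g"]
      by (simp add: has_bochner_integral_iff)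
  qed
  also have "2 * N - 2 * R = 2 * (c (2 * k) + c (2 * k + 1) - c (2 * k + 2) - c (2 * k + 3))"
    by (simp add: N_def R_def)
  finally show "(\<integral>\<^sup>+g. ennreal (\<integral>x. (G (g *v x) - G x)\<^sup>2 \<partial>lborel) \<partial>\<mu>)
      = ennreal (2 * (c (2 * k) + c (2 * k + 1) - c (2 * k + 2) - c (2 * k + 3)))" .
qed

text \<open>\<open>moment_ratio\<close> bounds the displacement by \<eta> times
  \<open>c (2 * k)\<close>. As all moments are nonnegative, \<open>c (2 * k)\<close> is at most the
  squared norm \<open>N\<close>, so normalization leaves the bound \<eta>.\<close>

lemma ex_almost_invariant_function:
  assumes fsm: "finite_second_moment \<mu>" and lyap: "top_lyapunov \<mu> \<le> 0" and \<eta>: "\<eta> > 0"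
  shows "\<exists>G. G \<in> borel_measurable borel \<and> has_bochner_integral lborel (\<lambda>x. (G x)\<^sup>2) (1::real) \<and>
    (\<integral>\<^sup>+g. ennreal (\<integral>x. (G (g *v x) - G x)\<^sup>2 \<partial>lborel) \<partial>\<mu>) \<le> ennreal \<eta>"
proof -
  obtain k where k: "c (2 * k) > 0"
    "2 * (c (2 * k) + c (2 * k + 1) - c (2 * k + 2) - c (2 * k + 3)) \<le> \<eta> * c (2 * k)"
    using moment_ratio[OF ball_vol_pos _ c_le c_convex c_cross c_subexponential[OF fsm lyap] \<eta>] by (auto simp: c_0)
  define N where "N = c (2 * k) + 2 * c (2 * k + 1) + c (2 * k + 2)"
  have N: "N > 0" "c (2 * k) \<le> N" using k(1) c_nonneg[of "2 * k + 1"] c_nonneg[of "2 * k + 2"] by (auto simp: N_def)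
  define G0 where "G0 = (\<lambda>x. F k x + F (k + 1) x)"
  define G where "G = (\<lambda>x. G0 x / sqrt N)"
  have G0: "has_bochner_integral lborel (\<lambda>x. (G0 x)\<^sup>2) N"
    "(\<integral>\<^sup>+g. ennreal (\<integral>x. (G0 (g *v x) - G0 x)\<^sup>2 \<partial>lborel) \<partial>\<mu>)
      = ennreal (2 * (c (2 * k) + c (2 * k + 1) - c (2 * k + 2) - c (2 * k + 3)))"
    unfolding G0_def N_def by (rule nn_integral_translation_distance)+
  have G0m: "G0 \<in> borel_measurable borel" unfolding G0_def by measurable
  have "has_bochner_integral lborel (\<lambda>x. (G0 x)\<^sup>2 / N) (N / N)" using G0(1) by (rule has_bochner_integral_divide_zero)
  then have G1: "has_bochner_integral lborel (\<lambda>x. (G x)\<^sup>2) 1" using N by (simp add: G_def power_divide)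
  have i_eq: "(\<integral>x. (G (g *v x) - G x)\<^sup>2 \<partial>lborel) = (1 / N) * (\<integral>x. (G0 (g *v x) - G0 x)\<^sup>2 \<partial>lborel)" for g
    using N by (simp add: G_def diff_divide_distrib[symmetric] power_divide)
  have eq: "ennreal (\<integral>x. (G (g *v x) - G x)\<^sup>2 \<partial>lborel) = ennreal (1 / N) * ennreal (\<integral>x. (G0 (g *v x) - G0 x)\<^sup>2 \<partial>lborel)" for g
    unfolding i_eq by (rule ennreal_mult') (use N in simp)
  have "(\<integral>\<^sup>+g. ennreal (\<integral>x. (G (g *v x) - G x)\<^sup>2 \<partial>lborel) \<partial>\<mu>)
    = ennreal (1 / N) * (\<integral>\<^sup>+g. ennreal (\<integral>x. (G0 (g *v x) - G0 x)\<^sup>2 \<partial>lborel) \<partial>\<mu>)"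
    unfolding eq
  proof (rule nn_integral_cmult)
    have "(\<lambda>g. \<integral>x. (G0 (g *v x) - G0 x)\<^sup>2 \<partial>lborel) \<in> borel_measurable SL_borel"
      by (rule lborel.borel_measurable_lebesgue_integral) (use G0m in measurable)
    then show "(\<lambda>g. ennreal (\<integral>x. (G0 (g *v x) - G0 x)\<^sup>2 \<partial>lborel)) \<in> borel_measurable \<mu>"
      unfolding measurable_\<mu> by measurable
  qed
  also have "\<dots> = ennreal (1 / N) * ennreal (2 * (c (2 * k) + c (2 * k + 1) - c (2 * k + 2) - c (2 * k + 3)))"
    unfolding G0(2) ..
  also have "\<dots> \<le> ennreal (1 / N) * ennreal (\<eta> * N)"
    using k(2) N \<eta> by (intro mult_left_mono ennreal_leI) (auto intro: order_trans)
  also have "\<dots> = ennreal \<eta>" using N \<eta> by (simp flip: ennreal_mult)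
  finally have "(\<integral>\<^sup>+g. ennreal (\<integral>x. (G (g *v x) - G x)\<^sup>2 \<partial>lborel) \<partial>\<mu>) \<le> ennreal \<eta>" .
  moreover have "G \<in> borel_measurable borel" unfolding G_def using G0m by measurable
  ultimately show ?thesis using G1 by blast
qed

end

section \<open>The invariant mean of a walk without drift\<close>

text \<open>Tychonoff's theorem for the cube of all functions into [0, 1]. Uncountably many sets are
  to converge at once, so a filter finer than \<open>sequentially\<close> takes the place of a
  subsequence; it consists of the indices at which \<open>P\<close> is near the cluster
  point.\<close>

lemma cluster_filter:
  fixes P :: "nat \<Rightarrow> 'a \<Rightarrow> real"
  assumes P: "\<And>j S. 0 \<le> P j S \<and> P j S \<le> 1"
  obtains \<F> \<Lambda> where "\<F> \<noteq> bot" "\<F> \<le> sequentially" "\<And>S. ((\<lambda>j. P j S) \<longlongrightarrow> \<Lambda> S) \<F>"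
proof -
  let ?X = "PiE UNIV (\<lambda>_::'a. {0..1::real})"
  have "compactin (product_topology (\<lambda>_. euclidean) UNIV) ?X"
    unfolding compactin_PiE by simp
  then have "compact ?X" by (simp add: euclidean_product_topology)
  moreover have "eventually (\<lambda>f. f \<in> ?X) (filtermap P sequentially)"
    using P by (simp add: eventually_filtermap PiE_UNIV_domain)
  moreover have "filtermap P sequentially \<noteq> bot" by (simp add: filtermap_bot_iff)
  ultimately obtain \<Lambda> where \<Lambda>: "inf (nhds \<Lambda>) (filtermap P sequentially) \<noteq> bot"
    unfolding compact_filter by blast
  define \<F> where "\<F> = inf (filtercomap P (nhds \<Lambda>)) sequentially"
  have "\<F> \<noteq> bot"
  proof
    assume "\<F> = bot"
    then have "eventually (\<lambda>_. False) \<F>" by simp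
    then obtain Q R where QR: "eventually Q (filtercomap P (nhds \<Lambda>))" "eventually R sequentially" "\<And>j. \<not> (Q j \<and> R j)"
      unfolding \<F>_def eventually_inf by auto
    then obtain Q' where Q': "eventually Q' (nhds \<Lambda>)" "\<And>j. Q' (P j) \<Longrightarrow> Q j"
      unfolding eventually_filtercomap by blast
    have "eventually (\<lambda>f. \<exists>j. R j \<and> f = P j) (filtermap P sequentially)"
      using QR(2) unfolding eventually_filtermap by (rule eventually_mono) auto
    with Q'(1) have "eventually (\<lambda>_. False) (inf (nhds \<Lambda>) (filtermap P sequentially))"
      unfolding eventually_inf using Q'(2) QR(3) by blast
    with \<Lambda> show False by (simp add: trivial_limit_def)
  qed
  moreover have "\<F> \<le> sequentially" by (simp add: \<F>_def)
  moreover have "((\<lambda>j. P j S) \<longlongrightarrow> \<Lambda> S) \<F>" for S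
  proof -
    have P_lim: "filterlim P (nhds \<Lambda>) \<F>"
      unfolding \<F>_def by (rule filterlim_mono[OF filterlim_filtercomap]) auto
    show ?thesis
    proof (rule topological_tendstoI)
      fix U :: "real set" assume U: "open U" "\<Lambda> S \<in> U"
      have "continuous_on UNIV (\<lambda>f :: 'a \<Rightarrow> real. f S)" by (rule continuous_on_product_coordinates)
      then have "open ((\<lambda>f. f S) -` U)" using U(1) by (rule open_vimage[rotated])
      then have "eventually (\<lambda>f. f \<in> (\<lambda>f. f S) -` U) (nhds \<Lambda>)" by (rule eventually_nhds_in_open) (simp add: U(2))
      then show "eventually (\<lambda>j. P j S \<in> U) \<F>" using filterlim_iff[THEN iffD1, OF P_lim] by force
    qed
  qed
  ultimately show ?thesis using that by blast
qed

text \<open>The probability with density G^2; having a density, it vanishes on proper subspaces. The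
  bounds hold for every set, as \<open>cluster_filter\<close> needs them: where the integrand is not
  integrable, the integral is 0 by convention.\<close>

lemma weighted_measure:
  fixes G :: "real^'n \<Rightarrow> real"
  assumes Gm: "G \<in> borel_measurable borel" and G: "has_bochner_integral lborel (\<lambda>x. (G x)\<^sup>2) (1::real)"
  defines "p \<equiv> \<lambda>S. \<integral>x. indicator S x * (G x)\<^sup>2 \<partial>lborel"
  shows weighted_measure_integrable: "S \<in> sets borel \<Longrightarrow> integrable lborel (\<lambda>x. indicator S x * (G x)\<^sup>2)"
    and weighted_measure_bounds: "0 \<le> p S \<and> p S \<le> 1"
    and weighted_measure_UNIV: "p UNIV = 1"
    and weighted_measure_union: "S \<in> sets borel \<Longrightarrow> T \<in> sets borel \<Longrightarrow> S \<inter> T = {} \<Longrightarrow> p (S \<union> T) = p S + p T"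
    and weighted_measure_subspace: "subspace U \<Longrightarrow> U \<noteq> UNIV \<Longrightarrow> p U = 0"
proof -
  have iG: "integrable lborel (\<lambda>x. (G x)\<^sup>2)" and iG1: "(\<integral>x. (G x)\<^sup>2 \<partial>lborel) = 1"
    using G by (auto simp: has_bochner_integral_iff)
  show int: "integrable lborel (\<lambda>x. indicator S x * (G x)\<^sup>2)" if "S \<in> sets borel" for S
  proof (rule Bochner_Integration.integrable_bound[OF iG])
    show "(\<lambda>x. indicator S x * (G x)\<^sup>2) \<in> borel_measurable lborel" using that Gm by simp
  qed (auto simp: indicator_def)
  have nonneg: "0 \<le> p S" for S unfolding p_def by (intro integral_nonneg_AE AE_I2) (simp add: indicator_def)
  have "p S \<le> 1" for S
  proof (cases "integrable lborel (\<lambda>x. indicator S x * (G x)\<^sup>2)")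
    case True
    then have "p S \<le> (\<integral>x. (G x)\<^sup>2 \<partial>lborel)"
      unfolding p_def using iG by (intro integral_mono) (auto simp: indicator_def)
    then show ?thesis by (simp add: iG1)
  qed (simp add: p_def not_integrable_integral_eq)
  with nonneg show "0 \<le> p S \<and> p S \<le> 1" by simp
  show "p UNIV = 1" by (simp add: p_def iG1)
  show "p (S \<union> T) = p S + p T" if "S \<in> sets borel" "T \<in> sets borel" "S \<inter> T = {}" for S T
  proof -
    have "(\<lambda>x. indicator (S \<union> T) x * (G x)\<^sup>2) = (\<lambda>x. indicator S x * (G x)\<^sup>2 + indicator T x * (G x)\<^sup>2)"
      using that(3) by (auto simp: indicator_def fun_eq_iff)
    then show ?thesis unfolding p_def using int that by simp
  qed
  show "p U = 0" if U: "subspace U" "U \<noteq> UNIV" for U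
  proof -
    have "dim U < DIM(real^'n)"
      using U dim_eq_full[of U] dim_subset_UNIV[of U] by (metis le_neq_implies_less span_eq_iff)
    then have "negligible U" by (rule negligible_lowdim)
    then have "U \<in> null_sets lebesgue" by (simp add: negligible_iff_null_sets)
    moreover have "U \<in> sets borel" using closed_subspace[OF U(1)] by simp
    ultimately have "U \<in> null_sets lborel" by (simp add: null_sets_def)
    then have "AE x in lborel. x \<notin> U" by (rule AE_not_in)
    then have "AE x in lborel. indicator U x * (G x)\<^sup>2 = 0" by eventually_elim simp
    then have "p U = (\<integral>x. 0 \<partial>(lborel :: (real^'n) measure))"
      unfolding p_def using \<open>U \<in> sets borel\<close> Gm by (intro integral_cong_AE) auto
    then show ?thesis by simp
  qed
qed

context SL_walk
begin

text \<open>By invariance of Lebesgue measure the difference is at most the integral of the absolute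
  difference of G^2 and its translate. The parameter \<delta> replaces Cauchy-Schwarz: a value
  comparable to the norm of the displacement makes both terms small.\<close>

lemma weighted_measure_translate:
  fixes G :: "real^'n \<Rightarrow> real"
  assumes Gm: "G \<in> borel_measurable borel" and G: "has_bochner_integral lborel (\<lambda>x. (G x)\<^sup>2) (1::real)"
    and h: "h \<in> carrier SL" and S: "S \<in> sets borel" and \<delta>: "\<delta> > 0"
  shows "\<bar>(\<integral>x. indicator {x. h *v x \<in> S} x * (G x)\<^sup>2 \<partial>lborel) - (\<integral>x. indicator S x * (G x)\<^sup>2 \<partial>lborel)\<bar>
    \<le> (\<integral>x. (G (h *v x) - G x)\<^sup>2 \<partial>lborel) / (2 * \<delta>) + 2 * \<delta>"
proof -
  have hm: "(\<lambda>x. h *v x) \<in> borel_measurable borel"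
    by (intro borel_measurable_continuous_onI linear_continuous_on) auto
  have hS: "{x. h *v x \<in> S} \<in> sets borel"
    using measurable_sets[OF hm S] by (simp add: vimage_def)
  have Ghm: "(\<lambda>x. G (h *v x)) \<in> borel_measurable borel" using measurable_compose[OF hm Gm] .
  note Gh = has_integral_lborel_SL[OF h G]
  have i1: "integrable lborel (\<lambda>x. indicator {x. h *v x \<in> S} x * (G x)\<^sup>2)"
    by (rule weighted_measure_integrable[OF Gm G hS])
  have i2: "integrable lborel (\<lambda>x. indicator {x. h *v x \<in> S} x * (G (h *v x))\<^sup>2)"
    by (rule weighted_measure_integrable[OF Ghm Gh hS])
  have iD: "integrable lborel (\<lambda>x. (G (h *v x) - G x)\<^sup>2)"
  proof (rule Bochner_Integration.integrable_bound[of _ "\<lambda>x. 2 * ((G (h *v x))\<^sup>2 + (G x)\<^sup>2)"])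
    show "integrable lborel (\<lambda>x. 2 * ((G (h *v x))\<^sup>2 + (G x)\<^sup>2))"
      using G Gh by (auto simp: has_bochner_integral_iff)
    show "(\<lambda>x. (G (h *v x) - G x)\<^sup>2) \<in> borel_measurable lborel" using Gm Ghm by simp
    have "(a - b)\<^sup>2 \<le> 2 * (a\<^sup>2 + b\<^sup>2)" for a b :: real
      using zero_le_power2[of "a + b"] by (simp add: power2_eq_square algebra_simps)
    then show "AE x in lborel. norm ((G (h *v x) - G x)\<^sup>2) \<le> norm (2 * ((G (h *v x))\<^sup>2 + (G x)\<^sup>2))" by simp
  qed
  have "has_bochner_integral lborel (\<lambda>x. indicator S x * (G x)\<^sup>2) (\<integral>x. indicator S x * (G x)\<^sup>2 \<partial>lborel)"
    by (intro has_bochner_integral_integrable weighted_measure_integrable[OF Gm G S])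
  from has_integral_lborel_SL[OF h this]
  have "(\<integral>x. indicator S x * (G x)\<^sup>2 \<partial>lborel) = (\<integral>x. indicator {x. h *v x \<in> S} x * (G (h *v x))\<^sup>2 \<partial>lborel)"
    by (simp add: has_bochner_integral_iff indicator_def)
  then have "\<bar>(\<integral>x. indicator {x. h *v x \<in> S} x * (G x)\<^sup>2 \<partial>lborel) - (\<integral>x. indicator S x * (G x)\<^sup>2 \<partial>lborel)\<bar>
    = \<bar>\<integral>x. indicator {x. h *v x \<in> S} x * (G x)\<^sup>2 - indicator {x. h *v x \<in> S} x * (G (h *v x))\<^sup>2 \<partial>lborel\<bar>"
    using i1 i2 by simp
  also have "\<dots> \<le> (\<integral>x. \<bar>indicator {x. h *v x \<in> S} x * (G x)\<^sup>2 - indicator {x. h *v x \<in> S} x * (G (h *v x))\<^sup>2\<bar> \<partial>lborel)"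
    by (rule integral_abs_bound)
  also have "\<dots> \<le> (\<integral>x. (G (h *v x) - G x)\<^sup>2 / (2 * \<delta>) + \<delta> * ((G (h *v x))\<^sup>2 + (G x)\<^sup>2) \<partial>lborel)"
  proof (rule integral_mono)
    show "integrable lborel (\<lambda>x. \<bar>indicator {x. h *v x \<in> S} x * (G x)\<^sup>2 - indicator {x. h *v x \<in> S} x * (G (h *v x))\<^sup>2\<bar>)"
      using i1 i2 by (intro integrable_abs Bochner_Integration.integrable_diff)
    show "integrable lborel (\<lambda>x. (G (h *v x) - G x)\<^sup>2 / (2 * \<delta>) + \<delta> * ((G (h *v x))\<^sup>2 + (G x)\<^sup>2))"
      using G Gh iD by (auto simp: has_bochner_integral_iff)
    fix x
    \<comment> \<open>AM-GM for the factors of a difference of squares\<close>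
    have am: "\<bar>b\<^sup>2 - a\<^sup>2\<bar> \<le> (a - b)\<^sup>2 / (2 * \<delta>) + \<delta> * (a\<^sup>2 + b\<^sup>2)" for a b :: real
    proof -
      have "0 \<le> (\<bar>a - b\<bar> - \<delta> * \<bar>a + b\<bar>)\<^sup>2" by simp
      then have "2 * \<delta> * (\<bar>a - b\<bar> * \<bar>a + b\<bar>) \<le> \<bar>a - b\<bar>\<^sup>2 + \<delta>\<^sup>2 * \<bar>a + b\<bar>\<^sup>2"
        by (simp add: power2_diff power_mult_distrib mult_ac)
      also have "\<bar>a + b\<bar>\<^sup>2 \<le> 2 * (a\<^sup>2 + b\<^sup>2)"
        using zero_le_power2[of "a - b"] by (simp add: power2_eq_square algebra_simps)
      then have "\<delta>\<^sup>2 * \<bar>a + b\<bar>\<^sup>2 \<le> \<delta>\<^sup>2 * (2 * (a\<^sup>2 + b\<^sup>2))" by (intro mult_left_mono) auto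
      finally have "2 * \<delta> * (\<bar>a - b\<bar> * \<bar>a + b\<bar>) \<le> (a - b)\<^sup>2 + \<delta>\<^sup>2 * (2 * (a\<^sup>2 + b\<^sup>2))" by simp
      then have "\<bar>a - b\<bar> * \<bar>a + b\<bar> \<le> ((a - b)\<^sup>2 + \<delta>\<^sup>2 * (2 * (a\<^sup>2 + b\<^sup>2))) / (2 * \<delta>)"
        using \<delta> by (simp add: pos_le_divide_eq mult.commute)
      also have "\<dots> = (a - b)\<^sup>2 / (2 * \<delta>) + \<delta> * (a\<^sup>2 + b\<^sup>2)"
        using \<delta> by (simp add: add_divide_distrib power2_eq_square)
      finally have "\<bar>(a - b) * (a + b)\<bar> \<le> (a - b)\<^sup>2 / (2 * \<delta>) + \<delta> * (a\<^sup>2 + b\<^sup>2)" by (simp add: abs_mult)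
      moreover have "\<bar>b\<^sup>2 - a\<^sup>2\<bar> = \<bar>(a - b) * (a + b)\<bar>"
        by (subst abs_minus_commute) (simp add: power2_eq_square algebra_simps)
      ultimately show ?thesis by simp
    qed
    have "\<bar>indicator {x. h *v x \<in> S} x * (G x)\<^sup>2 - indicator {x. h *v x \<in> S} x * (G (h *v x))\<^sup>2\<bar> \<le> \<bar>(G x)\<^sup>2 - (G (h *v x))\<^sup>2\<bar>"
      by (simp add: indicator_def)
    also have "\<dots> \<le> (G (h *v x) - G x)\<^sup>2 / (2 * \<delta>) + \<delta> * ((G (h *v x))\<^sup>2 + (G x)\<^sup>2)" by (rule am)
    finally show "\<bar>indicator {x. h *v x \<in> S} x * (G x)\<^sup>2 - indicator {x. h *v x \<in> S} x * (G (h *v x))\<^sup>2\<bar>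
      \<le> (G (h *v x) - G x)\<^sup>2 / (2 * \<delta>) + \<delta> * ((G (h *v x))\<^sup>2 + (G x)\<^sup>2)" .
  qed
  also have "\<dots> = (\<integral>x. (G (h *v x) - G x)\<^sup>2 \<partial>lborel) / (2 * \<delta>) + 2 * \<delta>"
  proof -
    have "has_bochner_integral lborel (\<lambda>x. (G (h *v x) - G x)\<^sup>2 / (2 * \<delta>) + \<delta> * ((G (h *v x))\<^sup>2 + (G x)\<^sup>2))
      ((\<integral>x. (G (h *v x) - G x)\<^sup>2 \<partial>lborel) / (2 * \<delta>) + \<delta> * (1 + 1))"
      by (intro has_bochner_integral_add has_bochner_integral_divide_zero has_bochner_integral_mult_right
          has_bochner_integral_integrable iD G Gh)
    from has_bochner_integral_integral_eq[OF this] show ?thesis by simp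
  qed
  finally show ?thesis .
qed

text \<open>Mean displacements of at most \<open>(1/2) ^ j\<close> have a finite sum, so for almost
  every \<open>g\<close> the displacements themselves are summable and tend to 0.\<close>

lemma ex_almost_invariant_sequence:
  assumes fsm: "finite_second_moment \<mu>" and lyap: "top_lyapunov \<mu> \<le> 0"
  obtains G :: "nat \<Rightarrow> real^'n \<Rightarrow> real" where "\<And>j. G j \<in> borel_measurable borel"
    "\<And>j. has_bochner_integral lborel (\<lambda>x. (G j x)\<^sup>2) 1"
    "AE g in \<mu>. (\<lambda>j. \<integral>x. (G j (g *v x) - G j x)\<^sup>2 \<partial>lborel) \<longlonglongrightarrow> 0"
proof -
  have "\<exists>G. G \<in> borel_measurable borel \<and> has_bochner_integral lborel (\<lambda>x. (G x)\<^sup>2) (1::real) \<and>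
    (\<integral>\<^sup>+g. ennreal (\<integral>x. (G (g *v x) - G x)\<^sup>2 \<partial>lborel) \<partial>\<mu>) \<le> ennreal ((1/2) ^ j)" for j :: nat
    by (rule ex_almost_invariant_function[OF fsm lyap]) simp
  from choice[OF allI, OF this] obtain G :: "nat \<Rightarrow> real^'n \<Rightarrow> real" where
    G: "\<forall>j. G j \<in> borel_measurable borel \<and> has_bochner_integral lborel (\<lambda>x. (G j x)\<^sup>2) (1::real) \<and>
      (\<integral>\<^sup>+g. ennreal (\<integral>x. (G j (g *v x) - G j x)\<^sup>2 \<partial>lborel) \<partial>\<mu>) \<le> ennreal ((1/2) ^ j)" ..
  have Gm: "G j \<in> borel_measurable borel" for j
    using spec[OF G, of j] by (rule conjunct1)
  have G1: "has_bochner_integral lborel (\<lambda>x. (G j x)\<^sup>2) (1::real)" for j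
    using spec[OF G, of j] by (rule conjunct1[OF conjunct2])
  have Gle: "(\<integral>\<^sup>+g. ennreal (\<integral>x. (G j (g *v x) - G j x)\<^sup>2 \<partial>lborel) \<partial>\<mu>) \<le> ennreal ((1/2) ^ j)" for j
    using spec[OF G, of j] by (rule conjunct2[OF conjunct2])
  let ?D = "\<lambda>j g. \<integral>x. (G j (g *v x) - G j x)\<^sup>2 \<partial>lborel"
  have meas: "(\<lambda>g. ennreal (?D j g)) \<in> borel_measurable \<mu>" for j
  proof -
    note Gm[measurable]
    have "?D j \<in> borel_measurable SL_borel"
      by (rule lborel.borel_measurable_lebesgue_integral) measurable
    then show ?thesis unfolding measurable_\<mu> by measurable
  qed
  have "(\<integral>\<^sup>+g. (\<Sum>j. ennreal (?D j g)) \<partial>\<mu>) = (\<Sum>j. \<integral>\<^sup>+g. ennreal (?D j g) \<partial>\<mu>)"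
    by (rule nn_integral_suminf) (rule meas)
  also have "\<dots> \<le> (\<Sum>j. ennreal ((1/2) ^ j))" using Gle by (intro suminf_le) auto
  also have "\<dots> = ennreal (\<Sum>j. (1/2) ^ j)" by (rule suminf_ennreal2) auto
  also have "\<dots> < \<infinity>" by simp
  finally have "(\<integral>\<^sup>+g. (\<Sum>j. ennreal (?D j g)) \<partial>\<mu>) \<noteq> \<infinity>" by simp
  moreover have "(\<lambda>g. \<Sum>j. ennreal (?D j g)) \<in> borel_measurable \<mu>"
    by (rule borel_measurable_suminf_order) (rule meas)
  ultimately have "AE g in \<mu>. (\<Sum>j. ennreal (?D j g)) \<noteq> \<infinity>" by (intro nn_integral_noteq_infinite)
  then have "AE g in \<mu>. (\<lambda>j. ?D j g) \<longlonglongrightarrow> 0"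
  proof eventually_elim
    fix g assume "(\<Sum>j. ennreal (?D j g)) \<noteq> \<infinity>"
    then have "summable (\<lambda>j. ?D j g)"
      by (intro summable_suminf_not_top) (auto intro!: integral_nonneg_AE)
    then show "(\<lambda>j. ?D j g) \<longlonglongrightarrow> 0" by (rule summable_LIMSEQ_zero)
  qed
  with Gm G1 show ?thesis using that by blast
qed

section \<open>The support and the invariant mean\<close>

lemma openin_measurable: "openin (top_of_set (carrier SL)) U \<Longrightarrow> U \<in> sets \<mu>"
  unfolding sets_\<mu> SL_borel_def sets_restrict_space openin_open by (auto simp: image_iff intro: borel_open)

text \<open>The complement of the support is a union of relatively open null sets, of which
  countably many suffice by Lindelof's theorem.\<close>

lemma AE_support: "AE g in \<mu>. g \<in> SL_support \<mu>"
proof -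
  define \<U> where "\<U> = {U. openin (top_of_set (carrier SL)) U \<and> emeasure \<mu> U = 0}"
  have \<U>: "openin (top_of_set (carrier SL)) U" if "U \<in> \<U>" for U using that by (simp add: \<U>_def)
  obtain \<V> where \<V>: "\<V> \<subseteq> \<U>" "countable \<V>" "\<Union>\<V> = \<Union>\<U>" using Lindelof_openin[OF \<U>] by metis
  have "(\<Union>U\<in>\<V>. U) \<in> null_sets \<mu>"
    using \<V> by (intro null_sets_UN') (auto simp: null_sets_def \<U>_def openin_measurable)
  then show ?thesis
  proof (rule AE_I')
    show "{g \<in> space \<mu>. g \<notin> SL_support \<mu>} \<subseteq> (\<Union>U\<in>\<V>. U)"
    proof
      fix g assume "g \<in> {g \<in> space \<mu>. g \<notin> SL_support \<mu>}"
      then obtain U where "openin (top_of_set (carrier SL)) U" "g \<in> U" "emeasure \<mu> U = 0"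
        by (auto simp: SL_support_def space_\<mu> not_less)
      then have "g \<in> \<Union>\<U>" by (auto simp: \<U>_def)
      then show "g \<in> (\<Union>U\<in>\<V>. U)" using \<V>(3) by simp
    qed
  qed
qed

text \<open>Inversion is continuous and preserves \<mu>. Inverses of generators can thus be
  approximated in the same way as generators.\<close>

lemma support_inverse:
  assumes g: "g \<in> SL_support \<mu>"
  shows "matrix_inv g \<in> SL_support \<mu>"
proof -
  have gc: "g \<in> carrier SL" using g by (simp add: SL_support_def)
  have cont: "continuous_on (carrier SL) (matrix_inv :: real^'n^'n \<Rightarrow> real^'n^'n)"
    by (rule continuous_on_eq[OF continuous_on_cofactor_inv]) (simp add: carrier_SL matrix_inv_eq_cofactor)
  have closed: "matrix_inv h \<in> carrier SL" if "h \<in> carrier SL" for h :: "real^'n^'n"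
    using that by (simp add: carrier_SL det_matrix_inv_det_1)
  have "emeasure \<mu> U > 0" if U: "openin (top_of_set (carrier SL)) U" "matrix_inv g \<in> U" for U
  proof -
    define V where "V = carrier SL \<inter> matrix_inv -` U"
    have "openin (top_of_set (carrier SL)) V"
      unfolding V_def using cont _ U(1) by (rule continuous_openin_preimage) (use closed in auto)
    moreover have "g \<in> V" using gc U by (simp add: V_def)
    ultimately have "emeasure \<mu> V > 0" using g by (simp add: SL_support_def)
    also have "emeasure \<mu> V = emeasure (distr \<mu> \<mu> matrix_inv) U"
      using openin_measurable[OF U(1)] measurable_SL_inv
      by (subst emeasure_distr) (simp_all add: measurable_\<mu> V_def space_\<mu> Int_commute)
    also have "distr \<mu> \<mu> matrix_inv = \<mu>" using symmetric by (simp add: symmetric_measure_def)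
    finally show ?thesis .
  qed
  then show ?thesis using closed[OF gc] by (simp add: SL_support_def)
qed

lemma bounded_of_zero_lyapunov:
  fixes \<Gamma> :: "(real^'n^'n) monoid"
  defines "\<Gamma> \<equiv> subgroup_generated SL (SL_support \<mu>)"
  assumes fsm: "finite_second_moment \<mu>" and lyap: "top_lyapunov \<mu> \<le> 0"
    and grp: "group \<Gamma>" and FR: "property_FR \<Gamma> (CARD('n) * (CARD('n) + 1) div 2 - 1)" and n: "CARD('n) \<ge> 2"
  shows "bounded (carrier \<Gamma>)"
proof -
  interpret \<Gamma>: group \<Gamma> by fact
  let ?G = "carrier \<Gamma>"
  have supp: "SL_support \<mu> \<subseteq> carrier SL" by (auto simp: SL_support_def)
  have carrier: "?G = generate SL (SL_support \<mu>)"
    using supp by (simp add: \<Gamma>_def subgroup_generated_def Int_absorb1)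
  have mult: "g \<otimes>\<^bsub>\<Gamma>\<^esub> h = g ** h" and one: "\<one>\<^bsub>\<Gamma>\<^esub> = mat 1" for g h
    by (simp_all add: \<Gamma>_def subgroup_generated_def mult_SL one_SL)
  have G_SL: "?G \<subseteq> carrier SL" using group.generate_incl[OF group_SL supp] by (simp add: carrier)
  interpret matrix_group ?G
  proof
    show "mat 1 \<in> ?G" using \<Gamma>.one_closed by (simp add: one)
    show "g ** h \<in> ?G" if "g \<in> ?G" "h \<in> ?G" for g h using \<Gamma>.m_closed[OF that] by (simp add: mult)
    show "\<exists>h\<in>?G. g ** h = mat 1 \<and> h ** g = mat 1" if "g \<in> ?G" for g
      using \<Gamma>.r_inv[OF that] \<Gamma>.l_inv[OF that] \<Gamma>.inv_closed[OF that] by (auto simp: mult one)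
  qed
  obtain G where Gm: "\<And>j. G j \<in> borel_measurable borel"
    and G1: "\<And>j. has_bochner_integral lborel (\<lambda>x. (G j x)\<^sup>2) (1::real)"
    and AE0: "AE g in \<mu>. (\<lambda>j. \<integral>x. (G j (g *v x) - G j x)\<^sup>2 \<partial>lborel) \<longlonglongrightarrow> 0"
    using ex_almost_invariant_sequence[OF fsm lyap] by blast
  define P where "P = (\<lambda>j S. \<integral>x. indicator S x * (G j x)\<^sup>2 \<partial>lborel)"
  have P_bounds: "0 \<le> P j S \<and> P j S \<le> 1" for j S
    unfolding P_def by (rule weighted_measure_bounds[OF Gm G1])
  obtain \<F> \<Lambda> where \<F>: "\<F> \<noteq> bot" "\<F> \<le> sequentially" and lim: "\<And>S. ((\<lambda>j. P j S) \<longlongrightarrow> \<Lambda> S) \<F>"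
    by (rule cluster_filter[of P, OF P_bounds]) (rule that)
  \<comment> \<open>This set has full measure. It is dense in the support, since relatively open
    sets around points of the support have positive measure.\<close>
  define A where "A = {h \<in> SL_support \<mu>. (\<lambda>j. \<integral>x. (G j (h *v x) - G j x)\<^sup>2 \<partial>lborel) \<longlonglongrightarrow> 0}"
  have AE_A: "AE h in \<mu>. h \<in> A" using AE0 AE_support by eventually_elim (simp add: A_def)
  have inv_A: "\<Lambda> {x. h *v x \<in> S} = \<Lambda> S" if h: "h \<in> A" and S: "S \<in> sets borel" for h S
  proof -
    have hSL: "h \<in> carrier SL" using h supp by (auto simp: A_def)
    have "(\<lambda>j. P j {x. h *v x \<in> S} - P j S) \<longlonglongrightarrow> 0"
    proof (rule LIMSEQ_I)
      fix e :: real assume e: "e > 0"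
      define \<delta> where "\<delta> = e / 8"
      have \<delta>: "\<delta> > 0" using e by (simp add: \<delta>_def)
      let ?D = "\<lambda>j. \<integral>x. (G j (h *v x) - G j x)\<^sup>2 \<partial>lborel"
      have "eventually (\<lambda>j. ?D j < \<delta> * \<delta>) sequentially"
        using h \<delta> by (intro order_tendstoD(2)[of _ 0]) (auto simp: A_def)
      then obtain J where J: "\<And>j. j \<ge> J \<Longrightarrow> ?D j < \<delta> * \<delta>" by (auto simp: eventually_sequentially)
      have "norm (P j {x. h *v x \<in> S} - P j S - 0) < e" if "j \<ge> J" for j
      proof -
        have "\<bar>P j {x. h *v x \<in> S} - P j S\<bar> \<le> ?D j / (2 * \<delta>) + 2 * \<delta>"
          unfolding P_def by (rule weighted_measure_translate[OF Gm G1 hSL S \<delta>])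
        also have "?D j / (2 * \<delta>) \<le> \<delta> / 2"
          using J[OF that] \<delta> by (simp add: pos_divide_le_eq)
        also have "\<delta> / 2 + 2 * \<delta> < e" using e by (simp add: \<delta>_def)
        finally show ?thesis by simp
      qed
      then show "\<exists>no. \<forall>j\<ge>no. norm (P j {x. h *v x \<in> S} - P j S - 0) < e" by blast
    qed
    then have "((\<lambda>j. P j {x. h *v x \<in> S} - P j S) \<longlongrightarrow> 0) \<F>" using \<F>(2) by (rule tendsto_mono[rotated])
    moreover have "((\<lambda>j. P j {x. h *v x \<in> S} - P j S) \<longlongrightarrow> \<Lambda> {x. h *v x \<in> S} - \<Lambda> S) \<F>"
      by (intro tendsto_diff lim)
    ultimately have "\<Lambda> {x. h *v x \<in> S} - \<Lambda> S = 0" using \<F>(1) tendsto_unique by blast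
    then show ?thesis by simp
  qed
  have dense_A: "\<exists>h\<in>A. norm (h - g) < \<tau>" if g: "g \<in> SL_support \<mu>" and \<tau>: "\<tau> > 0" for g \<tau>
  proof (rule ccontr)
    assume contr: "\<not> ?thesis"
    let ?U = "carrier SL \<inter> ball g \<tau>"
    have open_U: "openin (top_of_set (carrier SL)) ?U" by (simp add: openin_open_Int)
    have "emeasure \<mu> ?U > 0" using g \<tau> open_U by (auto simp: SL_support_def)
    moreover have not_U: "h \<notin> ?U" if "h \<in> A" for h
    proof
      assume "h \<in> ?U"
      then have "norm (h - g) < \<tau>" by (simp add: dist_norm norm_minus_commute)
      with contr that show False by blast
    qed
    have "AE h in \<mu>. h \<notin> ?U" using AE_A by (rule AE_mp) (rule AE_I2, rule impI, rule not_U)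
    then have "?U \<in> null_sets \<mu>" using openin_measurable[OF open_U] by (simp only: AE_iff_null_sets)
    then have "emeasure \<mu> ?U = 0" by (rule null_setsD1)
    ultimately show False by simp
  qed
  \<comment> \<open>Closed under products, so its density in the group follows by induction over
    \<open>generate\<close>; the inverse of a generator is again in the support.\<close>
  define H where "H = {h \<in> ?G. \<forall>S\<in>sets borel. \<Lambda> {x. h *v x \<in> S} = \<Lambda> S}"
  have A_H: "A \<subseteq> H"
    using inv_A by (auto simp: H_def carrier A_def intro: generate.incl)
  have H_mult: "h ** k \<in> H" if "h \<in> H" "k \<in> H" for h k
  proof -
    have "\<Lambda> {x. (h ** k) *v x \<in> S} = \<Lambda> S" if S: "S \<in> sets borel" for S
    proof -
      have "(\<lambda>x. h *v x) \<in> borel_measurable borel"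
        by (intro borel_measurable_continuous_onI linear_continuous_on) auto
      from measurable_sets[OF this S] have hS: "{x. h *v x \<in> S} \<in> sets borel" by (simp add: vimage_def)
      have "\<Lambda> {x. (h ** k) *v x \<in> S} = \<Lambda> {x. k *v x \<in> {x. h *v x \<in> S}}"
        by (simp add: matrix_vector_mul_assoc)
      also have "\<dots> = \<Lambda> {x. h *v x \<in> S}" using \<open>k \<in> H\<close> hS unfolding H_def by blast
      also have "\<dots> = \<Lambda> S" using \<open>h \<in> H\<close> S unfolding H_def by blast
      finally show ?thesis .
    qed
    then show ?thesis using that by (simp add: H_def mult_mem)
  qed
  have dense_H: "\<exists>h\<in>H. norm (h - g) < \<tau>" if "g \<in> generate SL (SL_support \<mu>)" "\<tau> > 0" for g \<tau>
    using that
  proof (induction arbitrary: \<tau> rule: generate.induct)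
    case one
    then show ?case using one_mem by (intro bexI[of _ "mat 1"]) (auto simp: one_SL H_def)
  next
    case (incl h)
    then show ?case using dense_A[of h \<tau>] A_H by blast
  next
    case (inv h)
    then have "inv\<^bsub>SL\<^esub> h \<in> SL_support \<mu>" using supp support_inverse by (auto simp: inv_SL subset_iff)
    then show ?case using dense_A[of _ \<tau>] inv A_H by blast
  next
    case (eng h1 h2)
    \<comment> \<open>The two errors are multiplied by \<open>norm h1\<close> and by a bound
      \<open>norm h2 + 1\<close> for the second approximating factor, the latter by \<delta> \<le>
      1.\<close>
    define \<delta> where "\<delta> = min 1 (\<tau> / (2 * (norm h1 + norm h2 + 2)))"
    have pos: "norm h1 + norm h2 + 2 > 0" by (simp add: add_nonneg_pos)
    have \<delta>: "\<delta> > 0" "\<delta> \<le> 1" "\<delta> \<le> \<tau> / (2 * (norm h1 + norm h2 + 2))"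
      unfolding \<delta>_def using eng.prems pos by simp_all
    obtain k1 where k1: "k1 \<in> H" "norm (k1 - h1) < \<delta>" using eng.IH(1)[OF \<delta>(1)] by blast
    obtain k2 where k2: "k2 \<in> H" "norm (k2 - h2) < \<delta>" using eng.IH(2)[OF \<delta>(1)] by blast
    have "norm k2 \<le> norm h2 + 1" using norm_triangle_ineq2[of k2 h2] k2(2) \<delta>(2) by linarith
    have "k1 ** k2 - h1 ** h2 = (k1 - h1) ** k2 + h1 ** (k2 - h2)"
      by (simp add: bounded_bilinear.diff_left[OF bounded_bilinear_matrix_matrix_mult]
          bounded_bilinear.diff_right[OF bounded_bilinear_matrix_matrix_mult])
    then have "norm (k1 ** k2 - h1 ** h2) \<le> norm ((k1 - h1) ** k2) + norm (h1 ** (k2 - h2))"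
      by (simp add: norm_triangle_ineq)
    also have "\<dots> \<le> norm (k1 - h1) * norm k2 + norm h1 * norm (k2 - h2)"
      by (intro add_mono norm_matrix_matrix_mult_le)
    also have "\<dots> \<le> \<delta> * (norm h2 + 1) + norm h1 * \<delta>"
      using k1(2) k2(2) \<open>norm k2 \<le> norm h2 + 1\<close> \<delta>(1) by (intro add_mono mult_mono) auto
    also have "\<dots> \<le> \<delta> * (norm h1 + norm h2 + 2)" using \<delta>(1) by (simp add: algebra_simps)
    also have "\<dots> \<le> \<tau> / 2"
    proof -
      have "\<delta> * (norm h1 + norm h2 + 2) \<le> \<tau> / (2 * (norm h1 + norm h2 + 2)) * (norm h1 + norm h2 + 2)"
        using \<delta>(3) pos by (intro mult_right_mono) auto
      also have "\<dots> = \<tau> / 2" using pos by (simp add: field_simps)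
      finally show ?thesis .
    qed
    also have "\<dots> < \<tau>" using eng.prems by simp
    finally show ?case using H_mult[OF k1(1) k2(1)] by (auto simp: mult_SL)
  qed
  interpret almost_invariant_mean ?G \<Lambda>
  proof
    show "\<Lambda> S \<ge> 0" for S by (rule tendsto_lowerbound[OF lim _ \<F>(1)]) (simp add: P_bounds)
    show "\<Lambda> UNIV = 1"
    proof -
      have "P j UNIV = 1" for j unfolding P_def by (rule weighted_measure_UNIV[OF Gm G1])
      then show ?thesis using lim[of UNIV] \<F>(1) tendsto_unique[OF \<F>(1) tendsto_const] by force
    qed
    show "\<Lambda> (S \<union> T) = \<Lambda> S + \<Lambda> T" if "S \<in> sets borel" "T \<in> sets borel" "S \<inter> T = {}" for S T
    proof (rule tendsto_unique[OF \<F>(1) lim])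
      have "P j (S \<union> T) = P j S + P j T" for j unfolding P_def by (rule weighted_measure_union[OF Gm G1 that])
      then show "((\<lambda>j. P j (S \<union> T)) \<longlongrightarrow> \<Lambda> S + \<Lambda> T) \<F>" using tendsto_add[OF lim lim] by simp
    qed
    show "\<Lambda> U = 0" if "subspace U" "U \<noteq> UNIV" for U
    proof (rule tendsto_unique[OF \<F>(1) lim])
      have "P j U = 0" for j unfolding P_def by (rule weighted_measure_subspace[OF Gm G1 that])
      then show "((\<lambda>j. P j U) \<longlongrightarrow> 0) \<F>" by simp
    qed
    show "\<exists>h\<in>?G. norm (h - g) < \<tau> \<and> (\<forall>S\<in>sets borel. \<Lambda> {x. h *v x \<in> S} = \<Lambda> S)"
      if "g \<in> ?G" "\<tau> > 0" for g \<tau>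
      using dense_H[of g \<tau>] that by (auto simp: carrier H_def)
  qed
  show ?thesis by (rule bounded_of_property_FR[OF FR grp mult one refl n])
qed

end

theorem corollary1p6:
  fixes \<mu> :: "(real ^ 'n ^ 'n) measure"
    and \<Gamma> :: "(real ^ 'n ^ 'n) monoid"
  defines "\<Gamma> \<equiv> subgroup_generated SL (SL_support \<mu>)"
  assumes "CARD('n) \<ge> 2"
    and "prob_space \<mu>" and "sets \<mu> = sets SL_borel"
    and "symmetric_measure \<mu>"
    and "finite_second_moment \<mu>"
    and "finitely_generated_group \<Gamma>"
    and "property_FR \<Gamma> (CARD('n) * (CARD('n) + 1) div 2 - 1)"
    and "\<not> compactin (top_of_set (carrier SL)) (top_of_set (carrier SL) closure_of carrier \<Gamma>)"
  shows "top_lyapunov \<mu> > 0"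
proof (rule ccontr)
  assume "\<not> top_lyapunov \<mu> > 0"
  then have lyap: "top_lyapunov \<mu> \<le> 0" by simp
  interpret SL_walk \<mu> using assms by (simp add: SL_walk_def SL_walk_axioms_def)
  have "group \<Gamma>" using assms(7) by (simp add: finitely_generated_group_def)
  then have bdd: "bounded (carrier \<Gamma>)"
    using bounded_of_zero_lyapunov assms(2,6,8) lyap unfolding \<Gamma>_def by blast
  \<comment> \<open>\<open>SL\<close> is closed in the space of matrices, so the relative closure of
    a bounded subset is closed and bounded there, hence compact.\<close>
  let ?C = "top_of_set (carrier SL) closure_of carrier \<Gamma>"
  have C: "?C = carrier SL \<inter> closure (carrier SL \<inter> carrier \<Gamma>)"
    by (simp add: closure_of_subtopology)
  have "closed ?C" unfolding C using closed_carrier_SL by (intro closed_Int) auto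
  moreover have "bounded ?C" unfolding C using bdd by (meson Int_lower2 bounded_closure bounded_subset)
  ultimately have "compact ?C" by (simp add: compact_eq_bounded_closed)
  then have "compactin (top_of_set (carrier SL)) ?C" by (simp add: compactin_subtopology C)
  with assms(9) show False by simp
qed

end
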